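(* Let $n$ be a positive integer, let $G$ be a (not necessarily finite) $n$-centralizer group, and let $H$ be a non-abelian subgroup of $G$. (a) If $n=4$ or $n=5$, then $G$ is isoclinic with $H$. (b) If $n=4,5,7$ or $9$, then $|\mathrm{Cent}(G)|=|\mathrm{Cent}(H)|$ and $G'\cong H'\cong C_2, C_3, C_5$ or $C_7$ respectively (i.e. $G'\cong H'\cong C_{n-2}$). (c) If $n=8$ and $|\mathrm{Cent}(G)|=|\mathrm{Cent}(H)|$, then $G$ is isoclinic with $H$.
   Context: For a group $G$, $\mathrm{Cent}(G)=\{C_G(x): x\in G\}$ is the set of centralizers of elements of $G$. $G$ is $n$-centralizer if $|\mathrm{Cent}(G)|=n$. $G'$ is the commutator subgroup, $Z(G)$ the center, $C_n$ the cyclic group of order $n$. Two groups $G$ and $H$ are isoclinic if there are isomorphisms $\varphi:G/Z(G)\to H/Z(H)$ and $\phi:G'\to H'$ such that whenever $\varphi(g_iZ(G))=h_iZ(H)$ for $i=1,2$ ($g_i\in G$, $h_i\in H$), one has $\phi([g_1,g_2])=[h_1,h_2]$. *)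

theory Defs
  imports "HOL-Algebra.Algebra"
begin

definition group_centralizer :: "('a, 'b) monoid_scheme \<Rightarrow> 'a \<Rightarrow> 'a set" where
  "group_centralizer G x = {g \<in> carrier G. g \<otimes>\<^bsub>G\<^esub> x = x \<otimes>\<^bsub>G\<^esub> g}"

definition Cent :: "('a, 'b) monoid_scheme \<Rightarrow> 'a set set" where
  "Cent G = group_centralizer G ` carrier G"

text \<open>\<^const>\<open>card\<close> is 0 on infinite sets, so this expresses "exactly \<open>n\<close> centralizers"
  only for positive \<open>n\<close>.\<close>
definition n_centralizer :: "nat \<Rightarrow> ('a, 'b) monoid_scheme \<Rightarrow> bool" where
  "n_centralizer n G \<longleftrightarrow> card (Cent G) = n"

definition group_center :: "('a, 'b) monoid_scheme \<Rightarrow> 'a set" where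
  "group_center G = {z \<in> carrier G. \<forall>g \<in> carrier G. z \<otimes>\<^bsub>G\<^esub> g = g \<otimes>\<^bsub>G\<^esub> z}"

text \<open>The library's \<^const>\<open>derived\<close> yields only the carrier of the commutator subgroup.\<close>
definition commutator_subgroup :: "('a, 'b) monoid_scheme \<Rightarrow> ('a, 'b) monoid_scheme" where
  "commutator_subgroup G = G\<lparr>carrier := derived G (carrier G)\<rparr>"

text \<open>The convention is the one of \<^const>\<open>derived\<close>. The convention
  \<open>x\<inverse> y\<inverse> x y\<close> gives the same commutator subgroup and the same notion of isoclinism,
  since it only replaces \<open>x\<close> and \<open>y\<close> by their inverses.\<close>
definition group_commutator :: "('a, 'b) monoid_scheme \<Rightarrow> 'a \<Rightarrow> 'a \<Rightarrow> 'a" where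
  "group_commutator G x y = x \<otimes>\<^bsub>G\<^esub> y \<otimes>\<^bsub>G\<^esub> inv\<^bsub>G\<^esub> x \<otimes>\<^bsub>G\<^esub> inv\<^bsub>G\<^esub> y"

definition isoclinic :: "('a, 'b) monoid_scheme \<Rightarrow> ('c, 'd) monoid_scheme \<Rightarrow> bool" where
  "isoclinic G H \<longleftrightarrow>
     (\<exists>\<phi> \<in> iso (G Mod group_center G) (H Mod group_center H).
      \<exists>\<psi> \<in> iso (commutator_subgroup G) (commutator_subgroup H).
        \<forall>g1 \<in> carrier G. \<forall>g2 \<in> carrier G. \<forall>h1 \<in> carrier H. \<forall>h2 \<in> carrier H.
          \<phi> (group_center G #>\<^bsub>G\<^esub> g1) = group_center H #>\<^bsub>H\<^esub> h1 \<longrightarrow>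
          \<phi> (group_center G #>\<^bsub>G\<^esub> g2) = group_center H #>\<^bsub>H\<^esub> h2 \<longrightarrow>
          \<psi> (group_commutator G g1 g2) = group_commutator H h1 h2)"

end

theory Submission
  imports Defs
begin

text \<open>
  If the centralizer \<open>K\<close> of a non-central element is not abelian, then counting centralizers of elements
  inside and outside \<open>K\<close> gives at least ten of them. So for \<open>n \<le> 9\<close> the images in \<open>Q = G/Z(G)\<close> of the
  \<open>n - 1\<close> proper centralizers form a conjugation invariant partition of \<open>Q\<close> into abelian subgroups. For
  \<open>y \<notin> D\<close> the elements of the coset \<open>y D\<close> lie in pairwise distinct members other than \<open>D\<close>, hence
  \<open>|D| \<le> n - 2\<close> and \<open>Q\<close> is finite. A member with \<open>|D| = n - 2\<close> is normal and is complemented by every other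
  member. For \<open>n = 4, 5, 7, 9\<close> such a member exists: the possible order statistics of the partition are
  excluded by divisibility and by the fact that commuting elements of coprime orders share a member.
  Writing \<open>A\<close> for its preimage and \<open>c \<notin> A\<close>, the map \<open>u \<mapsto> [u, c]\<close> on \<open>A\<close> has kernel \<open>Z(G)\<close> and image \<open>G'\<close>, which is
  therefore of prime order \<open>n - 2\<close>, and \<open>H' = G'\<close> because \<open>H'\<close> is non-trivial. The
  coset argument inside \<open>H\<close> then shows that \<open>H\<close> meets all members outside the identity.
  Members of prime order lie in \<open>H Z(G)/Z(G)\<close>, so for \<open>n = 4, 5\<close> we get \<open>G = H Z(G)\<close>, which implies isoclinism. For
  \<open>n = 8\<close> the same conclusion holds after excluding the cases with members of order 4 or 6.
\<close>

section \<open>Partitions of a group into abelian subgroups\<close>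

text \<open>The values 4, 5, 7, 9 are those below ten for which \<open>n - 2\<close> is prime: a
  member of maximal order has \<open>n - 2\<close> elements, and this is also the order of the
  commutator subgroup. For \<open>n = 8\<close> the number 6 is composite, so that route is closed;
  instead the subgroup is assumed to meet every member, and a proper subgroup of the quotient with
  this property must be ruled out. Counting alone cannot do that. It leaves the quotient of order 16
  with four members of order 4 and three of order 2, and this type does occur: take four of the five
  planes of a spread of the elementary abelian group of order 16, split the fifth plane into its
  three subgroups of order 2, and let the subgroup be a hyperplane through the fifth plane. The
  contradiction has to come from G itself. There commutators are central and behave like an
  alternating bilinear form; being trivial on four planes of the spread, the form is trivial on the
  fifth one too, which should then be one member and not three.\<close>

lemma prime_dvd_card_fixpoint_free:
  fixes f :: "'a \<Rightarrow> 'a"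
  assumes "Factorial_Ring.prime q" and "finite S" and "\<And>x. x \<in> S \<Longrightarrow> f x \<in> S"
    and "\<And>x. x \<in> S \<Longrightarrow> (f ^^ q) x = x" and "\<And>x. x \<in> S \<Longrightarrow> f x \<noteq> x"
  shows "q dvd card S"
  using assms(2-)
proof (induction "card S" arbitrary: S rule: less_induct)
  case less
  show ?case
  proof (cases "S = {}")
    case False
    then obtain x where x: "x \<in> S" by auto
    \<comment> \<open>\<open>R\<close> is the orbit of \<open>x\<close>. Orbits of a fixed-point
      free map of prime order have exactly \<open>q\<close> elements, and the induction removes one
      of them.\<close>
    define R where "R = (\<lambda>i. (f ^^ i) x) ` {..<q}"
    have q: "q > 1" using \<open>Factorial_Ring.prime q\<close> prime_gt_1_nat by blast
    have inS: "(f ^^ i) x \<in> S" for i by (induction i) (auto simp: x less.prems)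
    have mult: "(f ^^ (k * q)) y = y" if "y \<in> S" for k y
      by (induction k) (auto simp: funpow_add less.prems that)
    have inj: "inj_on (\<lambda>i. (f ^^ i) x) {..<q}"
    proof (rule linorder_inj_onI)
      fix i j assume ij: "i < j" "i \<in> {..<q}" "j \<in> {..<q}"
      show "(f ^^ i) x \<noteq> (f ^^ j) x"
      proof
        assume eq: "(f ^^ i) x = (f ^^ j) x"
        define y where "y = (f ^^ i) x"
        have y: "y \<in> S" using inS y_def by simp
        have "(f ^^ (j - i)) y = y"
          using eq ij(1) funpow_add[of "j - i" i f] by (simp add: y_def)
        then have d: "(f ^^ (k * (j - i))) y = y" for k
          by (induction k) (auto simp: funpow_add)
        have "coprime (j - i) q"
          using \<open>Factorial_Ring.prime q\<close> ij by (metis coprime_commute diff_is_0_eq diff_less_mono2 lessThan_iff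
              linorder_not_le nat_dvd_not_less order.strict_trans1 prime_imp_coprime zero_less_diff diff_le_self)
        \<comment> \<open>A Bezout combination of the two periods \<open>j - i\<close> and
          \<open>q\<close> of \<open>y\<close> equals 1, so \<open>f\<close> itself would fix
          \<open>y\<close>.\<close>
        then obtain a b where ab: "(j - i) * a = q * b + 1"
          using ij coprime_bezout_strong[of "j - i" q] q by auto
        have "f y = (f ^^ (1 + b * q)) y"
          using mult[OF y, of b] by simp
        also have "\<dots> = (f ^^ (a * (j - i))) y"
          using ab by (simp add: mult.commute)
        finally have "f y = y" using d by simp
        then show False using less.prems y by blast
      qed
    qed auto
    have RS: "R \<subseteq> S" using inS by (auto simp: R_def)
    have cR: "card R = q" unfolding R_def by (subst card_image[OF inj]) simp
    have finv: "f y \<in> S - R" if y: "y \<in> S - R" for y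
    proof -
      have "f y \<notin> R"
      proof
        assume "f y \<in> R"
        then obtain i where i: "f y = (f ^^ i) x" by (auto simp: R_def)
        \<comment> \<open>\<open>f ^^ (q - 1)\<close> undoes \<open>f\<close>, so \<open>y\<close>
          would return to the orbit of \<open>x\<close>; hence the complement of the orbit is
          invariant.\<close>
        have "y = (f ^^ (q - 1)) (f y)"
          using less.prems(3)[of y] y q funpow_add[of "q-1" 1 f] by simp
        also have "\<dots> = (f ^^ (q - 1 + i)) x" by (simp add: i funpow_add)
        also have "\<dots> = (f ^^ ((q - 1 + i) mod q + (q - 1 + i) div q * q)) x" by simp
        also have "\<dots> = (f ^^ ((q - 1 + i) mod q)) x"
          using mult[OF x] unfolding funpow_add by simp
        finally have "y \<in> R" using q by (auto simp: R_def)
        then show False using y by auto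
      qed
      then show ?thesis using y less.prems by auto
    qed
    have "card (S - R) = card S - q"
      using cR RS less.prems(1) by (simp add: card_Diff_subset finite_subset)
    moreover have "q \<le> card S" using cR RS less.prems(1) card_mono by metis
    moreover have "q dvd card (S - R)"
    proof (rule less.hyps)
      show "card (S - R) < card S" using calculation q by linarith
      show "finite (S - R)" using less.prems(1) by simp
      show "f y \<in> S - R" "(f ^^ q) y = y" "f y \<noteq> y" if "y \<in> S - R" for y
        using finv[OF that] less.prems(3,4)[of y] that by blast+
    qed
    ultimately show ?thesis by (metis dvd_diffD dvd_refl)
  qed simp
qed

section \<open>Powers and elements of prime order in finite subgroups\<close>

lemma (in group) pow_card_subgroup:
  assumes "subgroup D G" "finite D" "x \<in> D"
  shows "x [^] card D = \<one>"
proof -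
  interpret D: group "G\<lparr>carrier := D\<rparr>" using assms(1) by (rule subgroup_imp_group)
  have "x [^]\<^bsub>G\<lparr>carrier := D\<rparr>\<^esub> order (G\<lparr>carrier := D\<rparr>) = \<one>"
    using D.pow_order_eq_1[of x] assms by simp
  then show ?thesis unfolding nat_pow_consistent[of x _ D] by (simp add: order_def)
qed

lemma (in group) pow_mem_subgroup:
  assumes "subgroup D G" "x \<in> D"
  shows "x [^] (n::nat) \<in> D"
  by (induction n) (simp_all add: assms subgroup.one_closed subgroup.m_closed)

lemma (in group) Cauchy_subgroup:
  assumes "subgroup D G" "finite D" "Factorial_Ring.prime q" "q dvd card D"
  obtains s where "s \<in> D" "s \<noteq> \<one>" "s [^] q = \<one>"
proof -
  interpret D: group "G\<lparr>carrier := D\<rparr>" using assms(1) by (rule subgroup_imp_group)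
  obtain m where "card D = q * m" using assms(4) by auto
  then obtain H where H: "subgroup H (G\<lparr>carrier := D\<rparr>)" "card H = q"
    using sylow_thm[OF assms(3) D.is_group, of 1 m] assms(2) by (auto simp: order_def)
  have HD: "H \<subseteq> D" using subgroup.subset[OF H(1)] by simp
  have fH: "finite H" using HD assms(2) finite_subset by blast
  have "q > 1" using assms(3) prime_gt_1_nat by blast
  then have "\<not> H \<subseteq> {\<one>}" using H(2) card_mono[of "{\<one>}" H] by auto
  then obtain s where s: "s \<in> H" "s \<noteq> \<one>" by blast
  have "s [^] q = \<one>"
    using pow_card_subgroup[OF incl_subgroup[OF assms(1) H(1)] fH s(1)] H(2) by simp
  then show ?thesis using that s HD by blast
qed

lemma (in group) coprime_pow_eq_one:
  assumes "x \<in> carrier G" "x [^] (a::nat) = \<one>" "x [^] (b::nat) = \<one>" "coprime a b"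
  shows "x = \<one>"
  using assms by (metis coprime_common_divisor_nat nat_pow_eone nat_pow_one ord_eq_1 pow_eq_id)

definition conjugate :: "('a, 'b) monoid_scheme \<Rightarrow> 'a \<Rightarrow> 'a set \<Rightarrow> 'a set" where
  "conjugate G g D = (\<lambda>x. g \<otimes>\<^bsub>G\<^esub> x \<otimes>\<^bsub>G\<^esub> inv\<^bsub>G\<^esub> g) ` D"

text \<open>The model is \<open>G/Z(G)\<close> with the images of the proper centralizers. Stated
  abstractly, the counting needs no representatives of cosets. Only the number of members is assumed
  finite; finiteness of the group is derived below.\<close>

locale abelian_partition = group Q for Q (structure) +
  fixes \<D> :: "'a set set"
  assumes fin: "finite \<D>"
    and sub: "D \<in> \<D> \<Longrightarrow> subgroup D Q"
    and nontriv: "D \<in> \<D> \<Longrightarrow> D \<noteq> {\<one>}"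
    and proper: "D \<in> \<D> \<Longrightarrow> D \<noteq> carrier Q"
    and cover: "x \<in> carrier Q \<Longrightarrow> \<exists>D\<in>\<D>. x \<in> D"
    and disj: "\<lbrakk>D \<in> \<D>; E \<in> \<D>; x \<in> D; x \<in> E; x \<noteq> \<one>\<rbrakk> \<Longrightarrow> D = E"
    and conj_closed: "\<lbrakk>g \<in> carrier Q; D \<in> \<D>\<rbrakk> \<Longrightarrow> conjugate Q g D \<in> \<D>"
    and comm: "\<lbrakk>D \<in> \<D>; x \<in> D; y \<in> D\<rbrakk> \<Longrightarrow> x \<otimes> y = y \<otimes> x"
begin

lemma mem_carrier: "D \<in> \<D> \<Longrightarrow> x \<in> D \<Longrightarrow> x \<in> carrier Q"
  by (rule subgroup.mem_carrier[OF sub])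

lemmas mult_mem = subgroup.m_closed[OF sub]
lemmas inv_mem = subgroup.m_inv_closed[OF sub]
lemmas one_mem = subgroup.one_closed[OF sub]

lemma mult_mem_cancel_left:
  assumes "D \<in> \<D>" "x \<in> D" "y \<in> carrier Q" shows "x \<otimes> y \<in> D \<longleftrightarrow> y \<in> D"
  using assms sub inv_mem mult_mem mem_carrier by (metis inv_solve_left m_closed)

lemma mult_mem_cancel_right:
  assumes "D \<in> \<D>" "x \<in> D" "y \<in> carrier Q" shows "y \<otimes> x \<in> D \<longleftrightarrow> y \<in> D"
  using assms sub inv_mem mult_mem mem_carrier by (metis inv_solve_right m_closed)

text \<open>When \<open>L\<close> is the image of a subgroup H of G, these members correspond to the
  proper centralizers of H, so that the size of this set measures
  \<open>card (Cent H)\<close>.\<close>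

definition meeting :: "'a set \<Rightarrow> 'a set set" where
  "meeting L = {D \<in> \<D>. \<exists>x \<in> D \<inter> L. x \<noteq> \<one>}"

lemma meeting_carrier: "meeting (carrier Q) = \<D>"
proof -
  have "\<exists>x \<in> D \<inter> carrier Q. x \<noteq> \<one>" if "D \<in> \<D>" for D
    using nontriv[OF that] one_mem[OF that] mem_carrier[OF that] by blast
  then show ?thesis by (auto simp: meeting_def)
qed

text \<open>Two elements of \<open>y D\<close> in one member \<open>E \<noteq> D\<close> differ by an element of \<open>D \<inter> E\<close>.\<close>
lemma coset_injection:
  assumes L: "subgroup L Q" and D: "D \<in> \<D>" and y: "y \<in> L" "y \<notin> D"
  obtains f where "inj_on f (D \<inter> L)" "f ` (D \<inter> L) \<subseteq> meeting L - {D}"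
    "\<And>u. u \<in> D \<inter> L \<Longrightarrow> y \<otimes> u \<in> f u"
proof -
  have yc: "y \<in> carrier Q" using subgroup.mem_carrier[OF L y(1)] .
  have "\<exists>E. E \<in> meeting L - {D} \<and> y \<otimes> u \<in> E" if u: "u \<in> D \<inter> L" for u
  proof -
    have yu: "y \<otimes> u \<in> L" "y \<otimes> u \<notin> D"
      using u y yc mult_mem_cancel_right[OF D] subgroup.m_closed[OF L] by simp_all
    have "y \<otimes> u \<in> carrier Q" using subgroup.mem_carrier[OF L yu(1)] .
    then obtain E where E: "E \<in> \<D>" "y \<otimes> u \<in> E" using cover by blast
    moreover have "y \<otimes> u \<noteq> \<one>" using yu(2) D one_mem by auto
    ultimately show ?thesis using yu by (auto simp: meeting_def)
  qed
  then obtain f where f: "\<And>u. u \<in> D \<inter> L \<Longrightarrow> f u \<in> meeting L - {D} \<and> y \<otimes> u \<in> f u" by metis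
  have "inj_on f (D \<inter> L)"
  proof (rule inj_onI)
    fix u v assume uv: "u \<in> D \<inter> L" "v \<in> D \<inter> L" "f u = f v"
    have E: "f u \<in> \<D>" "f u \<noteq> D" "y \<otimes> u \<in> f u" "y \<otimes> v \<in> f u"
      using f uv by (auto simp: meeting_def)
    have c: "u \<in> carrier Q" "v \<in> carrier Q" using uv D mem_carrier by auto
    have "inv (y \<otimes> u) \<otimes> (y \<otimes> v) = inv u \<otimes> v"
      using c yc by (simp add: inv_mult_group m_assoc inv_solve_left' flip: m_assoc[of "inv y" y v])
    then have "inv u \<otimes> v \<in> f u" using E inv_mem mult_mem by metis
    moreover have "inv u \<otimes> v \<in> D" using uv D inv_mem mult_mem by auto
    ultimately have "inv u \<otimes> v = \<one>" using disj[OF D E(1)] E(2) by blast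
    then show "u = v" using c by (metis inv_closed inv_equality inv_inv)
  qed
  then show ?thesis using that f by blast
qed

text \<open>Numerical form of the coset argument, kept relative to \<open>L\<close> for two uses:
  with the whole group it bounds the order of a member, with the image of H it forces that image to
  meet many members.\<close>

lemma card_Int_le:
  assumes "subgroup L Q" and "D \<in> \<D>" and "\<not> L \<subseteq> D"
  shows "card (D \<inter> L) \<le> card (meeting L - {D})"
proof -
  obtain y where "y \<in> L" "y \<notin> D" using assms by auto
  then obtain f where "inj_on f (D \<inter> L)" "f ` (D \<inter> L) \<subseteq> meeting L - {D}"
    using coset_injection assms by metis
  then show ?thesis using fin by (intro card_inj_on_le) (auto simp: meeting_def)
qed

lemma outside: assumes "D \<in> \<D>" obtains y where "y \<in> carrier Q" "y \<notin> D"
  using assms proper mem_carrier by blast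

text \<open>An infinite set has \<open>card\<close> 0, so the inequality above would say nothing
  here; finiteness is read off from the injection itself.\<close>

lemma finite_member: assumes "D \<in> \<D>" shows "finite D"
proof -
  obtain y where "y \<in> carrier Q" "y \<notin> D" using assms outside by blast
  then obtain f where "inj_on f (D \<inter> carrier Q)" "f ` (D \<inter> carrier Q) \<subseteq> meeting (carrier Q) - {D}"
    using coset_injection[OF subgroup_self] assms by metis
  moreover have "D \<inter> carrier Q = D" using assms mem_carrier by auto
  ultimately show ?thesis using fin by (metis finite_Diff finite_subset finite_imageD meeting_carrier)
qed

lemma finite_carrier: "finite (carrier Q)"
  using fin finite_member cover by (auto intro!: finite_subset[of "carrier Q" "\<Union>\<D>"])

lemma card_member_le: assumes "D \<in> \<D>" shows "card D \<le> card \<D> - 1"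
proof -
  have "D \<inter> carrier Q = D" using assms mem_carrier by auto
  then show ?thesis
    using card_Int_le[OF subgroup_self assms] assms outside fin
    by (metis card_Diff_singleton meeting_carrier subsetD)
qed

lemma card_member_ge: assumes "D \<in> \<D>" shows "2 \<le> card D"
proof -
  obtain x where "x \<in> D" "x \<noteq> \<one>"
    using assms nontriv one_mem by blast
  then have "{\<one>, x} \<subseteq> D" "card {\<one>, x} = 2" using assms one_mem by auto
  then show ?thesis using card_mono finite_member assms by metis
qed

lemma card_member_dvd: "D \<in> \<D> \<Longrightarrow> card D dvd card (carrier Q)"
  using lagrange[OF sub] by (metis dvd_triv_right order_def)

text \<open>The members cut \<open>L\<close> into pieces that overlap only in the identity. Every
  piece contains the identity, so the truncated subtraction is exact.\<close>

lemma card_subgroup: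
  assumes L: "subgroup L Q"
  shows "card L = 1 + (\<Sum>D\<in>\<D>. card (D \<inter> L) - 1)"
proof -
  have LL: "L - {\<one>} = (\<Union>D\<in>\<D>. D \<inter> L - {\<one>})"
    using cover subgroup.mem_carrier[OF L] by auto
  have "finite L" using L finite_carrier finite_subset subgroup.subset by blast
  moreover have "\<one> \<in> L" using L subgroup.one_closed by blast
  ultimately have "card L = 1 + card (L - {\<one>})"
    by (metis card.remove plus_1_eq_Suc)
  also have "card (L - {\<one>}) = (\<Sum>D\<in>\<D>. card (D \<inter> L - {\<one>}))"
    unfolding LL using fin finite_member disj by (intro card_UN_disjoint) auto
  also have "\<dots> = (\<Sum>D\<in>\<D>. card (D \<inter> L) - 1)"
    using finite_member one_mem \<open>\<one> \<in> L\<close> by (intro sum.cong) auto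
  finally show ?thesis .
qed

lemma card_carrier: "card (carrier Q) = 1 + (\<Sum>D\<in>\<D>. card D - 1)"
proof -
  have "(\<Sum>D\<in>\<D>. card (D \<inter> carrier Q) - 1) = (\<Sum>D\<in>\<D>. card D - 1)"
    by (rule sum.cong) (auto simp: mem_carrier Int_absorb2 subsetI)
  then show ?thesis using card_subgroup[OF subgroup_self] by simp
qed

section \<open>Products of two members, normality and commuting elements\<close>

lemma product_inj:
  assumes "D \<in> \<D>" "E \<in> \<D>" "D \<noteq> E"
  shows "inj_on (\<lambda>(x, y). x \<otimes> y) (D \<times> E)"
proof (rule inj_onI, clarsimp)
  fix a b c d assume h: "a \<in> D" "b \<in> E" "c \<in> D" "d \<in> E" "a \<otimes> b = c \<otimes> d"
  have cc: "a \<in> carrier Q" "b \<in> carrier Q" "c \<in> carrier Q" "d \<in> carrier Q"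
    using h assms mem_carrier by auto
  have "inv c \<otimes> a = d \<otimes> inv b"
    using h(5) cc by (metis inv_closed inv_solve_left inv_solve_right m_assoc m_closed)
  moreover have "inv c \<otimes> a \<in> D" "d \<otimes> inv b \<in> E"
    using h assms inv_mem mult_mem by auto
  ultimately have "inv c \<otimes> a = \<one>" using disj assms by metis
  then have "a = c" using cc by (metis inv_closed inv_equality inv_inv)
  then show "a = c \<and> b = d" using h(5) cc by auto
qed

lemma card_mult_le:
  assumes "D \<in> \<D>" "E \<in> \<D>" "D \<noteq> E"
  shows "card D * card E \<le> card (carrier Q)"
proof -
  have "card (D \<times> E) \<le> card (carrier Q)"
    by (rule card_inj_on_le[OF product_inj[OF assms] _ finite_carrier]) (use assms mem_carrier in auto)
  then show ?thesis by (simp add: card_cartesian_product)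
qed

lemma product_eq:
  assumes "D \<in> \<D>" "E \<in> \<D>" "D \<noteq> E" "card D * card E = card (carrier Q)" "g \<in> carrier Q"
  obtains x y where "x \<in> D" "y \<in> E" "g = x \<otimes> y"
proof -
  have "(\<lambda>(x, y). x \<otimes> y) ` (D \<times> E) = carrier Q"
    by (rule card_subset_eq[OF finite_carrier])
      (use assms mem_carrier card_image[OF product_inj[OF assms(1-3)]] in \<open>auto simp: card_cartesian_product\<close>)
  then have "g \<in> (\<lambda>(x, y). x \<otimes> y) ` (D \<times> E)" using assms(5) by simp
  then show ?thesis using that by auto
qed

lemma conj_inj: "g \<in> carrier Q \<Longrightarrow> inj_on (\<lambda>x. g \<otimes> x \<otimes> inv g) (carrier Q)"
  by (rule inj_onI) (metis inv_closed inv_mult_group l_cancel m_closed r_cancel)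

lemma card_conjugate: assumes "g \<in> carrier Q" "D \<in> \<D>" shows "card (conjugate Q g D) = card D"
  unfolding conjugate_def
  by (rule card_image, rule inj_on_subset[OF conj_inj[OF assms(1)]])
    (use assms mem_carrier in blast)

text \<open>A group is never the product of a proper subgroup with one of its conjugates.\<close>
lemma normalI:
  assumes D: "D \<in> \<D>" and g: "g \<in> carrier Q"
    and fac: "\<And>E. \<lbrakk>E \<in> \<D>; E \<noteq> D; card E = card D\<rbrakk> \<Longrightarrow> \<exists>x\<in>E. \<exists>y\<in>D. g = x \<otimes> y"
  shows "conjugate Q g D = D"
proof (rule ccontr)
  assume ne: "conjugate Q g D \<noteq> D"
  have "\<exists>x\<in>conjugate Q g D. \<exists>y\<in>D. g = x \<otimes> y"
    using fac[OF conj_closed[OF g D] ne card_conjugate[OF g D]] .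
  then obtain v y where vy: "v \<in> D" "y \<in> D" "g = g \<otimes> v \<otimes> inv g \<otimes> y"
    by (auto simp: conjugate_def)
  have c: "v \<in> carrier Q" "y \<in> carrier Q" using vy D mem_carrier by auto
  have "g \<otimes> (v \<otimes> (inv g \<otimes> y)) = g \<otimes> \<one>" using vy(3) c g by (simp add: m_assoc)
  then have "v \<otimes> (inv g \<otimes> y) = \<one>" using c g by simp
  then have "inv g \<otimes> y = inv v" using c g by (metis inv_closed l_cancel m_closed r_inv)
  then have "inv g \<otimes> y \<in> D" using inv_mem[OF D vy(1)] by simp
  then have "inv g \<in> D" using mult_mem_cancel_right[OF D vy(2)] g by simp
  then have gD: "g \<in> D" using inv_mem[OF D] g by fastforce
  have "conjugate Q g D \<subseteq> D" unfolding conjugate_def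
    using gD D inv_mem mult_mem by auto
  then show False using ne card_conjugate[OF g D] finite_member[OF D] card_subset_eq by metis
qed

lemma normal_unique:
  assumes "D \<in> \<D>" "g \<in> carrier Q" "\<And>E. E \<in> \<D> \<Longrightarrow> card E = card D \<Longrightarrow> E = D"
  shows "conjugate Q g D = D"
  using assms by (intro normalI) auto

text \<open>If \<open>x\<close> and \<open>y\<close> commuted, the \<open>b\<close>-th power of
  their product would be the \<open>b\<close>-th power of \<open>x\<close>, a non-trivial element of
  \<open>D\<close>. Then the product, and with it \<open>y\<close>, would lie in
  \<open>D\<close>.\<close>

lemma coprime_not_commute:
  assumes "D \<in> \<D>" "E \<in> \<D>" "D \<noteq> E" "x \<in> D" "y \<in> E" "x \<noteq> \<one>" "y \<noteq> \<one>"
    "x [^] (a::nat) = \<one>" "y [^] (b::nat) = \<one>" "coprime a b"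
  shows "x \<otimes> y \<noteq> y \<otimes> x"
proof
  assume xy: "x \<otimes> y = y \<otimes> x"
  have c: "x \<in> carrier Q" "y \<in> carrier Q" using assms mem_carrier by auto
  obtain F where F: "F \<in> \<D>" "x \<otimes> y \<in> F" using cover c by blast
  have "(x \<otimes> y) [^] b = x [^] b"
    using pow_mult_distrib[OF xy c] assms(9) c by simp
  moreover have "(x \<otimes> y) [^] b \<in> F"
    using F sub pow_mem_subgroup by blast
  moreover have "x [^] b \<in> D"
    using assms sub pow_mem_subgroup by blast
  moreover have "x [^] b \<noteq> \<one>" using coprime_pow_eq_one c assms by blast
  ultimately have "F = D" using disj F assms by metis
  then have "y \<in> D" using F mult_mem_cancel_left assms c by blast
  then show False using disj assms by blast
qed

text \<open>The commutator of \<open>x\<close> and \<open>y\<close> lies both in \<open>D\<close>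
  and in \<open>E\<close>, which meet trivially.\<close>

lemma normalizing_commute:
  assumes "D \<in> \<D>" "E \<in> \<D>" "D \<noteq> E" "x \<in> D" "y \<in> E"
    "conjugate Q y D = D" "conjugate Q x E = E"
  shows "x \<otimes> y = y \<otimes> x"
proof -
  have c: "x \<in> carrier Q" "y \<in> carrier Q" using assms mem_carrier by auto
  have "x \<otimes> y \<otimes> inv x \<in> E" using assms(5,7) unfolding conjugate_def by blast
  then have 1: "x \<otimes> y \<otimes> inv x \<otimes> inv y \<in> E" using assms inv_mem mult_mem by auto
  have "inv x \<in> D" using inv_mem assms by auto
  then have "y \<otimes> inv x \<otimes> inv y \<in> D" using assms(6) unfolding conjugate_def by blast
  then have "x \<otimes> (y \<otimes> inv x \<otimes> inv y) \<in> D" using assms mult_mem by auto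
  then have "x \<otimes> y \<otimes> inv x \<otimes> inv y \<in> D" using c by (simp add: m_assoc)
  then have "x \<otimes> y \<otimes> inv x \<otimes> inv y = \<one>" using disj 1 assms by metis
  then have "x \<otimes> y \<otimes> inv (y \<otimes> x) = \<one>" using c by (simp add: inv_mult_group m_assoc)
  then show ?thesis using c by (metis inv_equality inv_inv m_closed inv_closed)
qed

section \<open>Divisibility conditions on the number of members of a given order\<close>

lemma conj_funpow:
  assumes "s \<in> carrier Q" "E \<subseteq> carrier Q"
  shows "(conjugate Q s ^^ k) E = conjugate Q (s [^] k) E"
proof (induction k)
  case 0
  then show ?case using assms by (force simp: conjugate_def)
next
  case (Suc k)
  have "s \<otimes> (s [^] k \<otimes> x \<otimes> inv (s [^] k)) \<otimes> inv s = s [^] Suc k \<otimes> x \<otimes> inv (s [^] Suc k)"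
    if "x \<in> carrier Q" for x
    using assms that nat_pow_Suc2[OF assms(1)] by (simp add: inv_mult_group m_assoc del: nat_pow_Suc)
  then have "conjugate Q s (conjugate Q (s [^] k) E) = conjugate Q (s [^] Suc k) E"
    unfolding conjugate_def image_image using assms(2) by (intro image_cong) auto
  then show ?case using Suc by (simp del: nat_pow_Suc)
qed

definition num :: "nat \<Rightarrow> nat" where "num d = card {D \<in> \<D>. card D = d}"

text \<open>An element \<open>s\<close> of order \<open>q\<close> in \<open>D\<close> permutes the
  members of order \<open>d\<close> by conjugation. A fixed member would contain a non-trivial
  element commuting with \<open>s\<close>, against coprimality of the orders. The next two lemmas
  provide the hypothesis \<open>fix_comm\<close> in different ways.\<close>

lemma prime_dvd_num:
  assumes D: "D \<in> \<D>" and q: "Factorial_Ring.prime q" "q dvd card D" "\<not> q dvd d"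
    and fix_comm: "\<And>s E. \<lbrakk>s \<in> D; E \<in> \<D>; card E = d; conjugate Q s E = E\<rbrakk>
      \<Longrightarrow> \<exists>y\<in>E. y \<noteq> \<one> \<and> s \<otimes> y = y \<otimes> s"
  shows "q dvd num d"
proof -
  obtain s where s: "s \<in> D" "s \<noteq> \<one>" "s [^] q = \<one>"
    using Cauchy_subgroup[OF sub[OF D] finite_member[OF D] q(1,2)] by blast
  have sc: "s \<in> carrier Q" using s D mem_carrier by blast
  show ?thesis unfolding num_def
  proof (rule prime_dvd_card_fixpoint_free[OF q(1), where f = "conjugate Q s"])
    fix E assume E: "E \<in> {D \<in> \<D>. card D = d}"
    then show "conjugate Q s E \<in> {D \<in> \<D>. card D = d}"
      using card_conjugate conj_closed sc by auto
    have Ec: "E \<subseteq> carrier Q" using E mem_carrier by auto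
    show "(conjugate Q s ^^ q) E = E"
      unfolding conj_funpow[OF sc Ec] s(3) using conj_funpow[OF sc Ec, of 0] by simp
    show "conjugate Q s E \<noteq> E"
    proof
      assume "conjugate Q s E = E"
      then obtain y where y: "y \<in> E" "y \<noteq> \<one>" "s \<otimes> y = y \<otimes> s" using fix_comm s E by blast
      have "D \<noteq> E" using q E by auto
      moreover have "coprime q d" using q prime_imp_coprime by blast
      moreover have "y [^] d = \<one>"
        using pow_card_subgroup[of E y] sub finite_member E y by blast
      ultimately show False using coprime_not_commute[OF D _ _ s(1) y(1)] s y E by blast
    qed
  qed (use fin in auto)
qed

text \<open>A member of order 2 has a single non-trivial element, so normalizing the member means
  centralizing that element.\<close>

lemma prime_dvd_num_two:
  assumes "num e > 0" "Factorial_Ring.prime q" "q dvd e" "odd q"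
  shows "q dvd num 2"
proof -
  obtain D where D: "D \<in> \<D>" "card D = e"
    using assms(1) unfolding num_def card_gt_0_iff by blast
  show ?thesis
  proof (rule prime_dvd_num[OF D(1) assms(2)])
    show "\<not> q dvd 2" using assms(2,4) by (metis dvd_refl primes_dvd_imp_eq two_is_prime_nat)
    fix s E assume h: "s \<in> D" "E \<in> \<D>" "card E = 2" "conjugate Q s E = E"
    have sc: "s \<in> carrier Q" using h D mem_carrier by blast
    obtain y where y: "y \<in> E" "y \<noteq> \<one>" using nontriv[OF h(2)] one_mem[OF h(2)] by blast
    have yc: "y \<in> carrier Q" using y h mem_carrier by blast
    have E: "E = {\<one>, y}"
      using y one_mem[OF h(2)] h(3) finite_member[OF h(2)] by (intro card_seteq[symmetric]) auto
    have "s \<otimes> y \<otimes> inv s \<in> E" using h(4) y unfolding conjugate_def by blast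
    moreover have "s \<otimes> y \<otimes> inv s \<noteq> \<one>"
      using sc yc y(2) by (metis inv_closed inv_equality inv_inv l_cancel_one m_closed)
    ultimately have "s \<otimes> y \<otimes> inv s = y" using E by auto
    then have "s \<otimes> y = y \<otimes> s" using sc yc by (metis inv_solve_right m_closed)
    then show "\<exists>y\<in>E. y \<noteq> \<one> \<and> s \<otimes> y = y \<otimes> s" using y by blast
  qed (use assms D in auto)
qed

text \<open>The only member of order \<open>e\<close> is normal. If \<open>s\<close> fixes
  \<open>E\<close>, then \<open>s\<close> normalizes \<open>E\<close> and \<open>E\<close>
  normalizes the member of \<open>s\<close>, so the two commute elementwise where it
  matters.\<close>

lemma prime_dvd_num_unique:
  assumes "num e = 1" "Factorial_Ring.prime q" "q dvd e" "\<not> q dvd d"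
  shows "q dvd num d"
proof -
  obtain D where D: "{D \<in> \<D>. card D = e} = {D}"
    using assms(1) unfolding num_def by (metis card_1_singletonE)
  then have D': "D \<in> \<D>" "card D = e" by auto
  show ?thesis
  proof (rule prime_dvd_num[OF D'(1) assms(2)])
    fix s E assume h: "s \<in> D" "E \<in> \<D>" "card E = d" "conjugate Q s E = E"
    obtain y where y: "y \<in> E" "y \<noteq> \<one>" using nontriv[OF h(2)] one_mem[OF h(2)] by blast
    have "conjugate Q y D = D"
      using D D' y h mem_carrier by (intro normal_unique) auto
    moreover have "D \<noteq> E" using assms D' h by auto
    ultimately show "\<exists>y\<in>E. y \<noteq> \<one> \<and> s \<otimes> y = y \<otimes> s"
      using normalizing_commute[OF D'(1) h(2) _ h(1) y(1)] h y by blast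
  qed (use assms D' in auto)
qed

lemma num_dvd: "num d > 0 \<Longrightarrow> d dvd card (carrier Q)"
  unfolding num_def card_gt_0_iff using card_member_dvd by blast

lemma num_mult_le:
  assumes "num d > 0" "num e > 0" "d \<noteq> e \<or> num d > 1"
  shows "d * e \<le> card (carrier Q)"
proof -
  obtain D where D: "D \<in> \<D>" "card D = d"
    using assms(1) unfolding num_def card_gt_0_iff by blast
  obtain E where E: "E \<in> \<D>" "card E = e" "E \<noteq> D"
  proof (cases "d = e")
    case True
    then have "\<not> {E \<in> \<D>. card E = e} \<subseteq> {D}"
      using assms(3) card_mono[of "{D}" "{E \<in> \<D>. card E = e}"] by (auto simp: num_def)
    then show ?thesis using that by blast
  next
    case False
    then show ?thesis using assms(2) that D unfolding num_def card_gt_0_iff by blast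
  qed
  then show ?thesis using card_mult_le D by metis
qed

lemma sum_members:
  assumes "finite S" "\<And>D. D \<in> \<D> \<Longrightarrow> card D \<in> S"
  shows "(\<Sum>D\<in>\<D>. f (card D)) = (\<Sum>d\<in>S. num d * f d)"
proof -
  have "(\<Sum>D\<in>\<D>. f (card D)) = (\<Sum>d\<in>S. \<Sum>D\<in>{D \<in> \<D>. card D = d}. f (card D))"
    using assms fin by (intro sum.group[symmetric]) auto
  also have "\<dots> = (\<Sum>d\<in>S. num d * f d)"
    by (intro sum.cong) (auto simp: num_def)
  finally show ?thesis .
qed

end

section \<open>Members of maximal order\<close>

text \<open>\<open>a, b, c, d, e\<close> are the numbers of members of order 2, 3, 4, 5, 6. The last seven conditions express
  that an element of prime order \<open>q\<close> acts without fixed points on the members of a given order prime to \<open>q\<close>,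
  if it lies in the only member of its order or if the members acted on have order 2.\<close>
definition admissible_type :: "nat \<Rightarrow> nat \<Rightarrow> nat \<Rightarrow> nat \<Rightarrow> nat \<Rightarrow> bool" where
  "admissible_type a b c d e \<longleftrightarrow>
    (let N = 1 + a + 2 * b + 3 * c + 4 * d + 5 * e in
      (a > 0 \<longrightarrow> N mod 2 = 0) \<and> (b > 0 \<longrightarrow> N mod 3 = 0) \<and> (c > 0 \<longrightarrow> N mod 4 = 0) \<and>
      (d > 0 \<longrightarrow> N mod 5 = 0) \<and> (e > 0 \<longrightarrow> N mod 6 = 0) \<and> (e > 1 \<longrightarrow> 36 \<le> N) \<and>
      (a = 1 \<longrightarrow> b mod 2 = 0 \<and> d mod 2 = 0) \<and>
      (b = 1 \<longrightarrow> a mod 3 = 0 \<and> c mod 3 = 0 \<and> d mod 3 = 0) \<and>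
      (c = 1 \<longrightarrow> b mod 2 = 0 \<and> d mod 2 = 0) \<and>
      (d = 1 \<longrightarrow> a mod 5 = 0 \<and> b mod 5 = 0 \<and> c mod 5 = 0 \<and> e mod 5 = 0) \<and>
      (e = 1 \<longrightarrow> b mod 2 = 0 \<and> d mod 2 = 0 \<and> a mod 3 = 0 \<and> c mod 3 = 0 \<and> d mod 3 = 0) \<and>
      (b > 0 \<or> e > 0 \<longrightarrow> a mod 3 = 0) \<and> (d > 0 \<longrightarrow> a mod 5 = 0))"

text \<open>Exhaustive evaluation over all types with eight members; the nested list bounds make the
  search finite and \<open>a\<close> is recovered as the remaining number.\<close>

lemma not_admissible_8:
  assumes "a + b + c + d + e = 8"
  shows "\<not> admissible_type a b c d e"
proof -
  have "\<forall>e\<in>set [0..<9]. \<forall>d\<in>set [0..<9 - e]. \<forall>c\<in>set [0..<9 - e - d]. \<forall>b\<in>set [0..<9 - e - d - c].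
      \<not> admissible_type (8 - b - c - d - e) b c d e"
    by code_simp
  moreover have "e \<in> set [0..<9]" "d \<in> set [0..<9 - e]" "c \<in> set [0..<9 - e - d]"
    "b \<in> set [0..<9 - e - d - c]" "a = 8 - b - c - d - e"
    using assms by auto
  ultimately show ?thesis by blast
qed

lemma not_admissible_6:
  assumes "a + b + c = 6"
  shows "\<not> admissible_type a b c 0 0"
proof -
  have "\<forall>c\<in>set [0..<7]. \<forall>b\<in>set [0..<7 - c]. \<not> admissible_type (6 - b - c) b c 0 0"
    by code_simp
  moreover have "c \<in> set [0..<7]" "b \<in> set [0..<7 - c]" "a = 6 - b - c"
    using assms by auto
  ultimately show ?thesis by blast
qed

text \<open>The bound 6 is what remains for eight members once order 7 is excluded, and it holds for
  seven members anyway. The conditions come from Lagrange, from the divisibility lemmas above and,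
  for \<open>36 \<le> N\<close>, from the product of two members of order 6.\<close>

lemma (in abelian_partition) admissible:
  assumes "\<And>D. D \<in> \<D> \<Longrightarrow> card D \<le> 6"
  shows "admissible_type (num 2) (num 3) (num 4) (num 5) (num 6)"
    and "card \<D> = num 2 + num 3 + num 4 + num 5 + num 6"
    and "card (carrier Q) = 1 + num 2 + 2 * num 3 + 3 * num 4 + 4 * num 5 + 5 * num 6"
proof -
  have S: "card D \<in> {2, 3, 4, 5, 6}" if "D \<in> \<D>" for D
    using assms[OF that] card_member_ge[OF that] by auto
  have "card \<D> = (\<Sum>D\<in>\<D>. 1)" by simp
  also have "\<dots> = (\<Sum>d\<in>{2, 3, 4, 5, 6}. num d * 1)"
    using sum_members[of "{2, 3, 4, 5, 6}" "\<lambda>_. 1"] S by blast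
  finally show "card \<D> = num 2 + num 3 + num 4 + num 5 + num 6" by simp
  have "card (carrier Q) = 1 + (\<Sum>D\<in>\<D>. card D - 1)" by (rule card_carrier)
  also have "(\<Sum>D\<in>\<D>. card D - 1) = (\<Sum>d\<in>{2, 3, 4, 5, 6}. num d * (d - 1))"
    using sum_members[of "{2, 3, 4, 5, 6}" "\<lambda>d. d - 1"] S by blast
  finally show N: "card (carrier Q) = 1 + num 2 + 2 * num 3 + 3 * num 4 + 4 * num 5 + 5 * num 6"
    by simp
  have p: "Factorial_Ring.prime (2::nat)" "Factorial_Ring.prime (3::nat)" "Factorial_Ring.prime (5::nat)"
    by simp_all
  show "admissible_type (num 2) (num 3) (num 4) (num 5) (num 6)"
    unfolding admissible_type_def Let_def N[symmetric] dvd_eq_mod_eq_0[symmetric]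
    using num_dvd[of 2] num_dvd[of 3] num_dvd[of 4] num_dvd[of 5] num_dvd[of 6] num_mult_le[of 6 6]
      prime_dvd_num_unique[OF _ p(1), of 2] prime_dvd_num_unique[OF _ p(2), of 3]
      prime_dvd_num_unique[OF _ p(1), of 4] prime_dvd_num_unique[OF _ p(3), of 5]
      prime_dvd_num_unique[OF _ p(1), of 6] prime_dvd_num_unique[OF _ p(2), of 6]
      prime_dvd_num_two[OF _ p(2), of 3] prime_dvd_num_two[OF _ p(2), of 6]
      prime_dvd_num_two[OF _ p(3), of 5]
    by auto
qed

text \<open>The four numbers are \<open>n - 1\<close> for \<open>n = 4, 5, 7, 9\<close>. Without a
  maximal member all orders are at most \<open>card \<D> - 2\<close>. For three members this leaves
  no order at all, for four members it gives a group of order 5 with subgroups of order 2, and the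
  two other cases are settled by evaluation.\<close>

lemma (in abelian_partition) exists_maximal_member:
  assumes "card \<D> \<in> {3, 4, 6, 8}"
  obtains D where "D \<in> \<D>" "card D = card \<D> - 1"
proof -
  have False if no: "\<And>D. D \<in> \<D> \<Longrightarrow> card D \<noteq> card \<D> - 1"
  proof -
    have le: "card D \<le> card \<D> - 2" if "D \<in> \<D>" for D
      using card_member_le[OF that] no[OF that] by linarith
    have zero: "num d = 0" if "d > card \<D> - 2" for d
    proof -
      have "{D \<in> \<D>. card D = d} = {}" using le that by fastforce
      then show ?thesis unfolding num_def by (metis card.empty)
    qed
    have le6: "card D \<le> 6" if "D \<in> \<D>" for D using le[OF that] assms by auto
    have sum: "card \<D> = num 2 + num 3 + num 4 + num 5 + num 6" using admissible(2)[OF le6] .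
    have N: "card (carrier Q) = 1 + num 2 + 2 * num 3 + 3 * num 4 + 4 * num 5 + 5 * num 6"
      using admissible(3)[OF le6] .
    have adm: "admissible_type (num 2) (num 3) (num 4) (num 5) (num 6)" using admissible(1)[OF le6] .
    from assms consider "card \<D> = 3" | "card \<D> = 4" | "card \<D> = 6" | "card \<D> = 8" by auto
    then show False
    proof cases
      case 1
      then have "num 2 = 0" "num 3 = 0" "num 4 = 0" "num 5 = 0" "num 6 = 0" using zero by simp_all
      then show False using sum 1 by simp
    next
      case 2
      then have z: "num 3 = 0" "num 4 = 0" "num 5 = 0" "num 6 = 0" using zero by simp_all
      then have "num 2 = 4" using sum 2 by simp
      moreover from this have "card (carrier Q) = 5" using N z by simp
      ultimately show False using num_dvd[of 2] by simp
    next
      case 3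
      then have "num 5 = 0" "num 6 = 0" using zero by simp_all
      moreover from this have "num 2 + num 3 + num 4 = 6" using sum 3 by simp
      ultimately show False using adm not_admissible_6 by metis
    next
      case 4
      then show False using adm sum not_admissible_8 by metis
    qed
  qed
  then show ?thesis using that by blast
qed

text \<open>Equality in the coset argument: the injection from the coset of \<open>g\<close> into
  the other members is onto, so every \<open>E\<close> contains some product of \<open>g\<close>
  with an element \<open>u\<close> of \<open>D\<close>. Multiplying by the inverse of
  \<open>u\<close> gives the factorization.\<close>

lemma (in abelian_partition) maximal_member_product:
  assumes D: "D \<in> \<D>" "card D = card \<D> - 1" and E: "E \<in> \<D>" "E \<noteq> D" and g: "g \<in> carrier Q"
  shows "\<exists>x\<in>E. \<exists>y\<in>D. g = x \<otimes> y"
proof (cases "g \<in> D")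
  case True
  then show ?thesis using one_mem[OF E(1)] g l_one by metis
next
  case False
  have DQ: "D \<inter> carrier Q = D" using D mem_carrier by auto
  obtain f where f: "inj_on f D" "f ` D \<subseteq> \<D> - {D}" "\<And>u. u \<in> D \<Longrightarrow> g \<otimes> u \<in> f u"
    using coset_injection[OF subgroup_self D(1) g False] unfolding meeting_carrier DQ by metis
  have "f ` D = \<D> - {D}"
    using f fin D by (intro card_subset_eq) (simp_all add: card_image)
  then have "E \<in> f ` D" using E by simp
  then obtain u where u: "u \<in> D" "f u = E" by auto
  have uc: "u \<in> carrier Q" using u D mem_carrier by blast
  have "g = (g \<otimes> u) \<otimes> inv u" using uc g by (simp add: m_assoc)
  then show ?thesis using f(3)[OF u(1)] u inv_mem[OF D(1) u(1)] by blast
qed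

lemma (in abelian_partition) maximal_member_normal:
  assumes "D \<in> \<D>" "card D = card \<D> - 1" "g \<in> carrier Q"
  shows "conjugate Q g D = D"
proof (rule normalI[OF assms(1,3)])
  fix E assume "E \<in> \<D>" "E \<noteq> D"
  then show "\<exists>x\<in>E. \<exists>y\<in>D. g = x \<otimes> y" by (rule maximal_member_product[OF assms(1,2) _ _ assms(3)])
qed

lemma (in abelian_partition) maximal_member_card:
  assumes D: "D \<in> \<D>" "card D = card \<D> - 1" and E: "E \<in> \<D>" "E \<noteq> D"
  shows "card D * card E = card (carrier Q)"
proof -
  have "(\<lambda>(x, y). x \<otimes> y) ` (E \<times> D) = carrier Q"
  proof
    show "carrier Q \<subseteq> (\<lambda>(x, y). x \<otimes> y) ` (E \<times> D)"
      using maximal_member_product[OF assms] by fast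
  qed (use D E mem_carrier in auto)
  then have "card (carrier Q) = card (E \<times> D)"
    using card_image[OF product_inj[OF E(1) D(1) E(2)]] by simp
  then show ?thesis by (simp add: card_cartesian_product)
qed

section \<open>Seven members and a subgroup meeting all of them\<close>

lemma (in group) card_subgroup_dvd:
  assumes "subgroup A G" "subgroup B G" "A \<subseteq> B"
  shows "card A dvd card B"
proof -
  have "subgroup A (G\<lparr>carrier := B\<rparr>)" using assms subgroup_incl by blast
  then show ?thesis
    using group.lagrange[OF subgroup_imp_group[OF assms(2)]] by (metis dvd_triv_right order_def partial_object.select_convs(1) partial_object.surjective partial_object.update_convs(1))
qed

text \<open>\<open>c'\<close> of the \<open>c\<close> members of order 4 meet the subgroup in order 2, so that its order is \<open>M\<close>.\<close>
definition admissible_trace :: "nat \<Rightarrow> nat \<Rightarrow> nat \<Rightarrow> nat \<Rightarrow> nat \<Rightarrow> bool" where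
  "admissible_trace a b c d c' \<longleftrightarrow>
    (let N = 1 + a + 2 * b + 3 * c + 4 * d; M = N - 2 * c' in
      (a > 0 \<longrightarrow> N mod 2 = 0) \<and> (b > 0 \<longrightarrow> N mod 3 = 0) \<and> (c > 0 \<longrightarrow> N mod 4 = 0) \<and>
      (d > 0 \<longrightarrow> N mod 5 = 0) \<and> N mod M = 0 \<and> (c' < c \<longrightarrow> M mod 4 = 0))"

text \<open>Positivity of \<open>c'\<close> expresses that the subgroup is proper. The surviving
  type has \<open>N = 1 + 3 + 3 * 4 = 16\<close>, and the subgroup then has order 8.\<close>

lemma admissible_trace_7:
  assumes "a + b + c + d = 7" "c' \<le> c" "c' > 0" "admissible_trace a b c d c'"
  shows "a = 3 \<and> b = 0 \<and> c = 4 \<and> d = 0"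
proof -
  have "\<forall>d\<in>set [0..<8]. \<forall>c\<in>set [0..<8 - d]. \<forall>b\<in>set [0..<8 - d - c]. \<forall>c'\<in>set [1..<c + 1].
    admissible_trace (7 - b - c - d) b c d c' \<longrightarrow> 7 - b - c - d = 3 \<and> b = 0 \<and> c = 4 \<and> d = 0"
    by code_simp
  moreover have "d \<in> set [0..<8]" "c \<in> set [0..<8 - d]" "b \<in> set [0..<8 - d - c]" "c' \<in> set [1..<c + 1]"
    "a = 7 - b - c - d"
    using assms(1-3) by auto
  ultimately show ?thesis using assms(4) by blast
qed

lemma (in group) conj_pow:
  assumes "g \<in> carrier G" "x \<in> carrier G"
  shows "(g \<otimes> x \<otimes> inv g) [^] (n::nat) = g \<otimes> x [^] n \<otimes> inv g"
proof (induction n)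
  case (Suc n)
  have "g \<otimes> x [^] n \<otimes> inv g \<otimes> (g \<otimes> x \<otimes> inv g) = g \<otimes> x [^] n \<otimes> (inv g \<otimes> g) \<otimes> x \<otimes> inv g"
    using assms by (simp only: m_assoc m_closed inv_closed nat_pow_closed)
  also have "\<dots> = g \<otimes> x [^] Suc n \<otimes> inv g"
    using assms by (simp add: m_assoc)
  finally show ?case using Suc by simp
qed (use assms in simp)

section \<open>Proper subgroups that meet each of seven members\<close>

context abelian_partition begin

context
  fixes L
  assumes L: "subgroup L Q" and meet: "\<And>D. D \<in> \<D> \<Longrightarrow> \<exists>x \<in> D \<inter> L. x \<noteq> \<one>"
begin

lemma trace_subgroup: "D \<in> \<D> \<Longrightarrow> subgroup (D \<inter> L) Q"
  using subgroups_Inter_pair sub L by blast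

lemma trace_card_dvd: "D \<in> \<D> \<Longrightarrow> card (D \<inter> L) dvd card D"
  by (rule card_subgroup_dvd[OF trace_subgroup sub]) auto

lemma trace_card_dvd': "D \<in> \<D> \<Longrightarrow> card (D \<inter> L) dvd card L"
  by (rule card_subgroup_dvd[OF trace_subgroup L]) auto

lemma trace_card_ge: assumes "D \<in> \<D>" shows "2 \<le> card (D \<inter> L)"
proof -
  obtain x where "x \<in> D \<inter> L" "x \<noteq> \<one>" using meet assms by blast
  moreover have "\<one> \<in> D \<inter> L" using one_mem[OF assms] subgroup.one_closed[OF L] by blast
  ultimately have "{\<one>, x} \<subseteq> D \<inter> L" "card {\<one>, x} = 2" by auto
  then show ?thesis using card_mono finite_member assms by (metis finite_Int)
qed

lemma trace_card_prime:
  assumes "D \<in> \<D>" "Factorial_Ring.prime (card D)" shows "D \<inter> L = D"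
proof -
  have "card (D \<inter> L) = card D"
    using trace_card_dvd[OF assms(1)] trace_card_ge[OF assms(1)] assms(2)
    by (metis One_nat_def Suc_1 not_less_eq_eq order_refl prime_nat_iff)
  then show ?thesis using finite_member[OF assms(1)] by (intro card_subset_eq) auto
qed

lemma card_proper_subgroup:
  assumes "L \<noteq> carrier Q" shows "2 * card L \<le> card (carrier Q)"
proof -
  obtain k where k: "card (carrier Q) = card L * k"
    using card_subgroup_dvd[OF L subgroup_self] subgroup.subset[OF L] by auto
  have "card L < card (carrier Q)"
    using assms finite_carrier subgroup.subset[OF L] by (intro psubset_card_mono) auto
  then have "k \<noteq> 0 \<and> k \<noteq> 1" using k by auto
  then have "2 \<le> k" by auto
  then show ?thesis using k by simp
qed

text \<open>A member \<open>D\<close> of order 6 is maximal, hence normal, and all other members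
  have one common order \<open>k\<close>. If \<open>k\<close> is prime, the other six members lie in
  \<open>L\<close>, but \<open>6 * (k - 1) < card L\<close> and \<open>card L \<le> 3 * k\<close>
  contradict each other. For \<open>k = 4\<close> and \<open>k = 6\<close> commuting elements of
  coprime orders are found in different members.\<close>

lemma seven_no_six:
  assumes card7: "card \<D> = 7" and proper: "L \<noteq> carrier Q" and D: "D \<in> \<D>"
  shows "card D \<noteq> 6"
proof
  assume D6: "card D = 6"
  have Dmax: "card D = card \<D> - 1" using D6 card7 by simp
  have "\<not> \<D> \<subseteq> {D}" using card_mono[of "{D}" \<D>] card7 by auto
  then obtain E where E: "E \<in> \<D>" "E \<noteq> D" by blast
  define k where "k = card E"
  have N: "card (carrier Q) = 6 * k"
    using maximal_member_card[OF D Dmax E] D6 by (simp add: k_def)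
  have all: "card F = k" if "F \<in> \<D>" "F \<noteq> D" for F
    using maximal_member_card[OF D Dmax that] D6 N by simp
  have "2 \<le> k" "k \<le> 6" using card_member_ge[OF E(1)] card_member_le[OF E(1)] card7 by (simp_all add: k_def)
  then consider "Factorial_Ring.prime k" | "k = 4" | "k = 6"
  proof -
    have "k \<in> {2, 3, 4, 5, 6}" using \<open>2 \<le> k\<close> \<open>k \<le> 6\<close> by auto
    then show ?thesis using that by auto
  qed
  then show False
  proof cases
    case 1
    have "(\<Sum>F\<in>\<D> - {D}. k - 1) \<le> (\<Sum>F\<in>\<D> - {D}. card (F \<inter> L) - 1)"
      using all trace_card_prime 1 by (intro sum_mono) auto
    also have "\<dots> \<le> (\<Sum>F\<in>\<D>. card (F \<inter> L) - 1)"
      using fin by (intro sum_mono2) auto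
    also have "\<dots> = card L - 1" using card_subgroup[OF L] by simp
    finally have "6 * (k - 1) \<le> card L - 1" using card7 D by simp
    then show False using card_proper_subgroup[OF proper] N \<open>2 \<le> k\<close> by linarith
  next
    case 2
    obtain s where s: "s \<in> D" "s \<noteq> \<one>" "s [^] (3::nat) = \<one>"
      using Cauchy_subgroup[OF sub[OF D] finite_member[OF D], of 3] D6 by auto
    obtain t where t: "t \<in> D" "t \<noteq> \<one>" "t [^] (2::nat) = \<one>"
      using Cauchy_subgroup[OF sub[OF D] finite_member[OF D], of 2] D6 by auto
    have Dc: "x \<in> carrier Q" if "x \<in> D" for x using mem_carrier[OF D that] .
    \<comment> \<open>The 3-torsion of \<open>D\<close>. It misses the involution \<open>t\<close>,
      so its order is a divisor of 6 below 6, hence at most 3.\<close>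
    define P where "P = {x \<in> D. x [^] (3::nat) = \<one>}"
    have "subgroup P Q"
    proof (rule subgroupI)
      show "P \<subseteq> carrier Q" "P \<noteq> {}" using Dc one_mem[OF D] by (auto simp: P_def)
      fix x y assume xy: "x \<in> P" "y \<in> P"
      show "inv x \<in> P" using xy inv_mem[OF D] Dc by (auto simp: P_def nat_pow_inv)
      show "x \<otimes> y \<in> P"
        using xy mult_mem[OF D] Dc comm[OF D] pow_mult_distrib[of x y 3] by (auto simp: P_def)
    qed
    then have Pdvd: "card P dvd 6" using card_subgroup_dvd[OF _ sub[OF D]] D6 by (auto simp: P_def)
    have tX: "t \<notin> P"
      using t Dc[OF t(1)] coprime_pow_eq_one[of t 2 3] by (auto simp: P_def)
    have "card P < 6" using psubset_card_mono[OF finite_member[OF D], of P] D6 t(1) tX by (auto simp: P_def)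
    moreover have "card P \<noteq> 4" "card P \<noteq> 5" using Pdvd by auto
    ultimately have "card P \<le> 3" by auto
    moreover have "finite P" using finite_member[OF D] by (auto simp: P_def)
    ultimately have "card (P - {\<one>}) < card E"
      using 2 one_mem[OF D] by (auto simp: P_def k_def card_Diff_singleton)
    moreover have "(\<lambda>g. g \<otimes> s \<otimes> inv g) ` E \<subseteq> P - {\<one>}"
    proof clarify
      fix g assume g: "g \<in> E"
      have gc: "g \<in> carrier Q" using mem_carrier[OF E(1) g] .
      have "g \<otimes> s \<otimes> inv g \<in> D"
        using maximal_member_normal[OF D Dmax gc] s(1) unfolding conjugate_def by blast
      moreover have "(g \<otimes> s \<otimes> inv g) [^] (3::nat) = \<one>"
        using conj_pow[OF gc Dc[OF s(1)]] s(3) gc by simp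
      moreover have "g \<otimes> s \<otimes> inv g \<noteq> \<one>"
        using conj_inj[OF gc] s(2) gc Dc[OF s(1)] unfolding inj_on_def by (metis one_closed r_inv r_one)
      ultimately show "g \<otimes> s \<otimes> inv g \<in> P - {\<one>}" by (simp add: P_def)
    qed
    \<comment> \<open>The four elements of \<open>E\<close> conjugate \<open>s\<close> into at most
      two non-trivial elements of \<open>P\<close>; two that agree differ by a non-trivial element
      \<open>y\<close> of \<open>E\<close> that centralizes \<open>s\<close>.\<close>
    ultimately have "\<not> inj_on (\<lambda>g. g \<otimes> s \<otimes> inv g) E"
      using card_inj_on_le \<open>finite P\<close> by (metis finite_Diff not_le)
    then obtain g h where gh: "g \<in> E" "h \<in> E" "g \<noteq> h" "g \<otimes> s \<otimes> inv g = h \<otimes> s \<otimes> inv h"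
      unfolding inj_on_def by blast
    define y where "y = inv h \<otimes> g"
    have c: "g \<in> carrier Q" "h \<in> carrier Q" "s \<in> carrier Q"
      using mem_carrier[OF E(1)] gh Dc s by auto
    have y: "y \<in> E" "y \<noteq> \<one>" "y [^] (4::nat) = \<one>"
    proof -
      show "y \<in> E" using gh inv_mem[OF E(1)] mult_mem[OF E(1)] by (simp add: y_def)
      show "y \<noteq> \<one>" using gh(3) c unfolding y_def by (metis inv_closed inv_equality inv_inv)
      show "y [^] (4::nat) = \<one>"
        using pow_card_subgroup[OF sub[OF E(1)] finite_member[OF E(1)] \<open>y \<in> E\<close>] 2 k_def by simp
    qed
    have "y \<otimes> s = inv h \<otimes> (g \<otimes> s \<otimes> inv g) \<otimes> g" using c by (simp add: y_def m_assoc)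
    also have "\<dots> = (inv h \<otimes> h) \<otimes> s \<otimes> (inv h \<otimes> g)" unfolding gh(4) using c by (simp only: m_assoc m_closed inv_closed)
    also have "\<dots> = s \<otimes> y" using c by (simp add: y_def)
    finally have "s \<otimes> y = y \<otimes> s" by simp
    moreover have "coprime (3::nat) 4" by (rule prime_imp_coprime) auto
    ultimately show False using coprime_not_commute[OF D E(1) E(2)[symmetric] s(1) y(1) s(2) y(2) s(3) y(3)] by simp
  next
    case 3
    obtain s where s: "s \<in> D" "s \<noteq> \<one>" "s [^] (3::nat) = \<one>"
      using Cauchy_subgroup[OF sub[OF D] finite_member[OF D], of 3] D6 by auto
    obtain t where t: "t \<in> E" "t \<noteq> \<one>" "t [^] (2::nat) = \<one>"
      using Cauchy_subgroup[OF sub[OF E(1)] finite_member[OF E(1)], of 2] 3 by (auto simp: k_def)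
    \<comment> \<open>Now \<open>E\<close> is maximal as well, so both members are normal and
      commute elementwise, in particular their elements of order 3 and 2.\<close>
    have Emax: "card E = card \<D> - 1" using 3 card7 k_def by simp
    have "s \<otimes> t = t \<otimes> s"
      using normalizing_commute[OF D E(1) _ s(1) t(1)] E(2) mem_carrier
        maximal_member_normal[OF D Dmax] maximal_member_normal[OF E(1) Emax] s(1) t(1) D E(1) by metis
    then show False using coprime_not_commute[OF D E(1) _ s(1) t(1)] s t E(2) by force
  qed
qed

text \<open>Orders are now at most 5. Members of prime order lie in \<open>L\<close>; members of
  order 4 either lie in \<open>L\<close> or meet it in order 2, and \<open>B\<close> collects the
  latter. Thus the index of \<open>L\<close> is governed by \<open>card B\<close>, and the
  arithmetic search applies.\<close>

lemma seven_counts: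
  assumes card7: "card \<D> = 7" and proper: "L \<noteq> carrier Q"
  shows "num 2 = 3" "num 4 = 4" "card (carrier Q) = 16" "\<And>D. D \<in> \<D> \<Longrightarrow> card D = 2 \<or> card D = 4"
proof -
  have le5: "card D \<le> 5" if "D \<in> \<D>" for D
    using card_member_le[OF that] seven_no_six[OF assms that] card7 by simp
  have le6: "card D \<le> 6" if "D \<in> \<D>" for D using le5[OF that] by simp
  have "{D \<in> \<D>. card D = 6} = {}" using le5 by fastforce
  then have n6: "num 6 = 0" unfolding num_def by (metis card.empty)
  have sum: "num 2 + num 3 + num 4 + num 5 = 7" using admissible(2)[OF le6] card7 n6 by simp
  have N: "card (carrier Q) = 1 + num 2 + 2 * num 3 + 3 * num 4 + 4 * num 5"
    using admissible(3)[OF le6] n6 by simp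
  define B where "B = {D \<in> \<D>. card D = 4 \<and> card (D \<inter> L) = 2}"
  have B: "B \<subseteq> {D \<in> \<D>. card D = 4}" "B \<subseteq> \<D>" by (auto simp: B_def)
  then have "card B \<le> num 4" unfolding num_def using fin by (intro card_mono) auto
  have tr: "card (D \<inter> L) = card D \<or> D \<in> B" if D: "D \<in> \<D>" for D
  proof (cases "card D = 4")
    case True
    have "card (D \<inter> L) dvd 4" "2 \<le> card (D \<inter> L)" using trace_card_dvd[OF D] trace_card_ge[OF D] True by simp_all
    moreover from this have "card (D \<inter> L) \<noteq> 3" by auto
    ultimately have "card (D \<inter> L) = 2 \<or> card (D \<inter> L) = 4" using dvd_imp_le[of "card (D \<inter> L)" 4] by linarith
    then show ?thesis using True D by (auto simp: B_def)
  next
    case False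
    then have "card D \<in> {2, 3, 5}" using le5[OF D] card_member_ge[OF D] by auto
    then have "Factorial_Ring.prime (card D)" by auto
    then show ?thesis using trace_card_prime[OF D] by simp
  qed
  \<comment> \<open>A member in \<open>B\<close> loses two of its three non-trivial elements when it
    is intersected with \<open>L\<close>; no other member loses any.\<close>
  have "(\<Sum>D\<in>\<D>. card D - 1) = (\<Sum>D\<in>\<D>. card (D \<inter> L) - 1 + (if D \<in> B then 2 else 0))"
  proof (rule sum.cong)
    fix D assume "D \<in> \<D>"
    from tr[OF this] show "card D - 1 = card (D \<inter> L) - 1 + (if D \<in> B then 2 else 0)"
      by (auto simp: B_def)
  qed simp
  also have "\<dots> = (\<Sum>D\<in>\<D>. card (D \<inter> L) - 1) + 2 * card B"
    using fin B by (simp add: sum.distrib sum.If_cases Int_absorb1)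
  finally have NM: "card (carrier Q) = card L + 2 * card B"
    using card_carrier card_subgroup[OF L] by simp
  have L0: "card L > 0" using L subgroup.finite_imp_card_positive finite_carrier by blast
  have "card B > 0" using NM card_proper_subgroup[OF proper] L0 by simp
  have "card L dvd card (carrier Q)"
    using card_subgroup_dvd[OF L subgroup_self] subgroup.subset[OF L] by auto
  \<comment> \<open>A member of order 4 outside \<open>B\<close> is contained in \<open>L\<close>,
    so Lagrange applies to it there.\<close>
  moreover have "4 dvd card L" if "card B < num 4"
  proof -
    have "\<not> {D \<in> \<D>. card D = 4} \<subseteq> B" using that card_mono[of B "{D \<in> \<D>. card D = 4}"] finite_subset[OF B(2) fin]
      by (auto simp: num_def)
    then obtain D where "D \<in> \<D>" "card D = 4" "D \<notin> B" by blast
    then show ?thesis using tr trace_card_dvd' by metis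
  qed
  moreover have "card L = card (carrier Q) - 2 * card B" using NM by simp
  ultimately have *: "num 2 = 3 \<and> num 3 = 0 \<and> num 4 = 4 \<and> num 5 = 0"
    using num_dvd[of 2] num_dvd[of 3] num_dvd[of 4] num_dvd[of 5]
    by (intro admissible_trace_7[OF sum \<open>card B \<le> num 4\<close> \<open>card B > 0\<close>],
        unfold admissible_trace_def Let_def N[symmetric] dvd_eq_mod_eq_0[symmetric]) simp
  then show "num 2 = 3" "num 4 = 4" "card (carrier Q) = 16" using N by auto
  fix D assume D: "D \<in> \<D>"
  have "card D \<noteq> 3" "card D \<noteq> 5" using * D fin by (auto simp: num_def)
  then show "card D = 2 \<or> card D = 4" using le5[OF D] card_member_ge[OF D] by auto
qed

end

end

section \<open>Four members of order 4 in a group of order 16\<close>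

context abelian_partition begin

lemma Int_trivial: "D \<in> \<D> \<Longrightarrow> E \<in> \<D> \<Longrightarrow> D \<noteq> E \<Longrightarrow> x \<in> D \<Longrightarrow> x \<in> E \<Longrightarrow> x = \<one>"
  using disj by blast

text \<open>Factor \<open>x\<close> as \<open>u v\<close> with \<open>u\<close> in \<open>F\<close>
  and \<open>v\<close> in \<open>D'\<close>, and let \<open>y\<close> be the inverse of
  \<open>v\<close>; it is non-trivial because \<open>x\<close> is not in \<open>F\<close>. In this
  way \<open>F\<close> is read as the graph of a map from \<open>D\<close> to
  \<open>D'\<close>.\<close>

lemma complement_graph:
  assumes D: "D \<in> \<D>" "D' \<in> \<D>" "F \<in> \<D>" and ne: "D \<noteq> D'" "D \<noteq> F" "D' \<noteq> F"
    and prod: "card F * card D' = card (carrier Q)" and x: "x \<in> D" "x \<noteq> \<one>"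
  obtains y where "y \<in> D'" "y \<noteq> \<one>" "x \<otimes> y \<in> F"
proof -
  have xc: "x \<in> carrier Q" using mem_carrier[OF D(1) x(1)] .
  obtain u v where uv: "u \<in> F" "v \<in> D'" "x = u \<otimes> v"
    using product_eq[OF D(3,2) ne(3)[symmetric] prod xc] by blast
  have c: "u \<in> carrier Q" "v \<in> carrier Q" using uv D mem_carrier by auto
  have "x \<otimes> inv v = u" using c uv(3) by (simp add: m_assoc)
  then have 1: "x \<otimes> inv v \<in> F" using uv by simp
  have 2: "inv v \<noteq> \<one>"
  proof
    assume "inv v = \<one>"
    then have "x \<in> F" using 1 xc by simp
    then show False using Int_trivial[OF D(1,3) ne(2)] x by blast
  qed
  show ?thesis using that[OF inv_mem[OF D(2) uv(2)] 2 1] .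
qed

text \<open>The graph is one-to-one in both directions: the quotient of two elements of
  \<open>F\<close> with a common factor lies in \<open>D\<close> or in \<open>D'\<close>, and
  \<open>F\<close> meets both trivially.\<close>

lemma complement_graph_inj:
  assumes D: "D \<in> \<D>" "D' \<in> \<D>" "F \<in> \<D>" and ne: "D \<noteq> D'" "D \<noteq> F" "D' \<noteq> F"
    and x: "x \<in> D" "x' \<in> D" "y \<in> D'" "y' \<in> D'" "x \<otimes> y \<in> F" "x' \<otimes> y' \<in> F"
  shows "x = x' \<longleftrightarrow> y = y'"
proof -
  have c: "x \<in> carrier Q" "x' \<in> carrier Q" "y \<in> carrier Q" "y' \<in> carrier Q"
    using x D mem_carrier by auto
  have "x = x'" if "y = y'"
  proof -
    have "(x \<otimes> y) \<otimes> inv (x' \<otimes> y) = x \<otimes> (y \<otimes> inv y) \<otimes> inv x'"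
      using c by (simp only: inv_mult_group m_assoc m_closed inv_closed)
    then have "(x \<otimes> y) \<otimes> inv (x' \<otimes> y) = x \<otimes> inv x'" using c by simp
    moreover have "(x \<otimes> y) \<otimes> inv (x' \<otimes> y) \<in> F" using x that D mult_mem inv_mem by simp
    moreover have "x \<otimes> inv x' \<in> D" using x D mult_mem inv_mem by simp
    ultimately have "x \<otimes> inv x' = \<one>" using Int_trivial[OF D(1,3) ne(2)] by simp
    then show ?thesis using c by (metis inv_closed inv_equality inv_inv)
  qed
  moreover have "y = y'" if "x = x'"
  proof -
    have "inv (x \<otimes> y) \<otimes> (x \<otimes> y') = inv y \<otimes> (inv x \<otimes> x) \<otimes> y'"
      using c by (simp only: inv_mult_group m_assoc m_closed inv_closed)
    then have "inv (x \<otimes> y) \<otimes> (x \<otimes> y') = inv y \<otimes> y'" using c by simp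
    moreover have "inv (x \<otimes> y) \<otimes> (x \<otimes> y') \<in> F" using x that D mult_mem inv_mem by simp
    moreover have "inv y \<otimes> y' \<in> D'" using x D mult_mem inv_mem by simp
    ultimately have "inv y \<otimes> y' = \<one>" using Int_trivial[OF D(2,3) ne(3)] by simp
    then show ?thesis using c by (metis inv_closed inv_equality inv_inv)
  qed
  ultimately show ?thesis by blast
qed

text \<open>Four of the five members of a would-be spread of \<open>C\<^sub>2\<^sup>4\<close> determine the fifth: identifying
  \<open>D\<^sub>2\<close> with \<open>D\<^sub>1\<close> along \<open>D\<^sub>3\<close>, the member \<open>D\<^sub>4\<close> is the graph of a derangement of the three
  non-trivial elements, that is of a 3-cycle.\<close>
lemma partial_spread:
  assumes N: "card (carrier Q) = 16" and num4: "num 4 = 4"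
    and two_four: "\<And>D. D \<in> \<D> \<Longrightarrow> card D = 2 \<or> card D = 4"
  obtains D1 D2 D3 D4 e1 e2 e3 f1 f2 f3 where
    "D1 \<in> \<D>" "D2 \<in> \<D>" "D3 \<in> \<D>" "D4 \<in> \<D>"
    "e1 \<in> D1" "e2 \<in> D1" "e3 \<in> D1" "f1 \<in> D2" "f2 \<in> D2" "f3 \<in> D2"
    "e1 \<otimes> f1 \<in> D3" "e2 \<otimes> f2 \<in> D3" "e3 \<otimes> f3 \<in> D3"
    "e1 \<otimes> f2 \<in> D4" "e2 \<otimes> f3 \<in> D4" "e3 \<otimes> f1 \<in> D4"
    "e1 \<otimes> f3 \<noteq> \<one>" "e2 \<otimes> f1 \<noteq> \<one>"
    "\<And>F. F \<in> \<D> \<Longrightarrow> e1 \<otimes> f3 \<in> F \<Longrightarrow> e2 \<otimes> f1 \<in> F \<Longrightarrow> False"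
    "\<And>x y. x \<in> carrier Q \<Longrightarrow> y \<in> carrier Q \<Longrightarrow> x \<otimes> y = y \<otimes> x"
proof -
  obtain D1 D2 D3 D4 where S: "{D \<in> \<D>. card D = 4} = {D1, D2, D3, D4}" and dist: "distinct [D1, D2, D3, D4]"
  proof -
    have "card {D \<in> \<D>. card D = 4} = Suc (Suc (Suc (Suc 0)))" using num4 by (simp add: num_def)
    then show ?thesis using that by (auto simp: card_Suc_eq)
  qed
  have D: "D1 \<in> \<D>" "D2 \<in> \<D>" "D3 \<in> \<D>" "D4 \<in> \<D>"
    and c4: "card D1 = 4" "card D2 = 4" "card D3 = 4" "card D4 = 4"
    using S by blast+
  have ne: "D1 \<noteq> D2" "D1 \<noteq> D3" "D1 \<noteq> D4" "D2 \<noteq> D3" "D2 \<noteq> D4" "D3 \<noteq> D4" using dist by auto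
  have prod: "card E * card F = card (carrier Q)" if "card E = 4" "card F = 4" for E F :: "'a set"
    using that N by simp
  \<comment> \<open>Two distinct members of order 4 have as many products as the group has elements,
    so the normality criterion is available.\<close>
  have norm: "conjugate Q g E = E" if E: "E \<in> \<D>" "card E = 4" and g: "g \<in> carrier Q" for E g
    by (rule normalI[OF E(1) g]) (metis product_eq E g prod)
  have comm12: "x \<otimes> y = y \<otimes> x" if "x \<in> D1" "y \<in> D2" for x y
    using normalizing_commute[OF D(1,2) ne(1) that] norm D c4 mem_carrier that by auto
  have D1c: "x \<in> carrier Q" if "x \<in> D1" for x using mem_carrier[OF D(1) that] .
  have D2c: "x \<in> carrier Q" if "x \<in> D2" for x using mem_carrier[OF D(2) that] .
  have commQ: "x \<otimes> y = y \<otimes> x" if xy: "x \<in> carrier Q" "y \<in> carrier Q" for x y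
  proof -
    obtain a b where ab: "a \<in> D1" "b \<in> D2" "x = a \<otimes> b"
      using product_eq[OF D(1,2) ne(1) prod[OF c4(1,2)] xy(1)] by blast
    obtain c d where cd: "c \<in> D1" "d \<in> D2" "y = c \<otimes> d"
      using product_eq[OF D(1,2) ne(1) prod[OF c4(1,2)] xy(2)] by blast
    note cc = D1c[OF ab(1)] D2c[OF ab(2)] D1c[OF cd(1)] D2c[OF cd(2)]
    have "x \<otimes> y = a \<otimes> (b \<otimes> c) \<otimes> d" using cc by (simp add: ab cd m_assoc)
    also have "\<dots> = a \<otimes> (c \<otimes> b) \<otimes> d" using comm12[OF cd(1) ab(2)] by simp
    also have "\<dots> = (a \<otimes> c) \<otimes> (b \<otimes> d)" using cc by (simp add: m_assoc)
    also have "\<dots> = (c \<otimes> a) \<otimes> (d \<otimes> b)" using comm D ab cd by metis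
    also have "\<dots> = c \<otimes> (a \<otimes> d) \<otimes> b" using cc by (simp add: m_assoc)
    also have "\<dots> = c \<otimes> (d \<otimes> a) \<otimes> b" using comm12[OF ab(1) cd(2)] by simp
    also have "\<dots> = y \<otimes> x" using cc by (simp add: ab cd m_assoc)
    finally show ?thesis .
  qed
  have "\<exists>f. f \<in> D2 \<and> f \<noteq> \<one> \<and> e \<otimes> f \<in> D3" "\<exists>f. f \<in> D2 \<and> f \<noteq> \<one> \<and> e \<otimes> f \<in> D4"
    if "e \<in> D1" "e \<noteq> \<one>" for e
    using complement_graph[OF D(1,2,3) ne(1,2,4) prod[OF c4(3,2)] that]
      complement_graph[OF D(1,2,4) ne(1,3,5) prod[OF c4(4,2)] that] by (metis, metis)
  then obtain f g where f: "\<And>e. e \<in> D1 \<Longrightarrow> e \<noteq> \<one> \<Longrightarrow> f e \<in> D2 \<and> f e \<noteq> \<one> \<and> e \<otimes> f e \<in> D3"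
    and g: "\<And>e. e \<in> D1 \<Longrightarrow> e \<noteq> \<one> \<Longrightarrow> g e \<in> D2 \<and> g e \<noteq> \<one> \<and> e \<otimes> g e \<in> D4"
    by metis
  have f_inj: "f e = f e' \<longleftrightarrow> e = e'" if "e \<in> D1" "e \<noteq> \<one>" "e' \<in> D1" "e' \<noteq> \<one>" for e e'
    using complement_graph_inj[OF D(1,2,3) ne(1,2,4) that(1,3)] f that by metis
  have g_inj: "g e = g e' \<longleftrightarrow> e = e'" if "e \<in> D1" "e \<noteq> \<one>" "e' \<in> D1" "e' \<noteq> \<one>" for e e'
    using complement_graph_inj[OF D(1,2,4) ne(1,3,5) that(1,3)] g that by metis
  have fg: "g e \<noteq> f e" if "e \<in> D1" "e \<noteq> \<one>" for e
  proof
    assume "g e = f e"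
    then have "e \<otimes> f e = \<one>" using f[OF that] g[OF that] Int_trivial[OF D(3,4) ne(6)] by metis
    then have "inv (f e) = e" using D1c that f[OF that] D2c by (metis inv_equality)
    then show False using f[OF that] inv_mem[OF D(2)] that Int_trivial[OF D(1,2) ne(1)] by metis
  qed
  have "card (D1 - {\<one>}) = Suc (Suc (Suc 0))" "card (D2 - {\<one>}) = 3"
    using c4 one_mem D by (simp_all add: card_Diff_singleton)
  then obtain a b c where abc: "D1 - {\<one>} = {a, b, c}" "a \<noteq> b" "a \<noteq> c" "b \<noteq> c"
    by (auto simp: card_Suc_eq)
  have e: "a \<in> D1" "b \<in> D1" "c \<in> D1" "a \<noteq> \<one>" "b \<noteq> \<one>" "c \<noteq> \<one>" using abc(1) by blast+
  have F: "{f a, f b, f c} = D2 - {\<one>}"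
  proof (rule card_subset_eq)
    show "finite (D2 - {\<one>})" using finite_member[OF D(2)] by simp
    show "card {f a, f b, f c} = card (D2 - {\<one>})"
      using \<open>card (D2 - {\<one>}) = 3\<close> f_inj e abc by auto
  qed (use f e in auto)
  have "g a \<in> {f a, f b, f c}" "g b \<in> {f a, f b, f c}" "g c \<in> {f a, f b, f c}"
    unfolding F using g e by auto
  moreover have "g a \<noteq> g b" "g a \<noteq> g c" "g b \<noteq> g c" using g_inj e abc by auto
  \<comment> \<open>These are the two derangements of three points. Exchanging two of the names
    turns one into the other, which allows a single labelling \<open>e1\<close>, \<open>e2\<close>,
    \<open>e3\<close>.\<close>
  ultimately have "(g a = f b \<and> g b = f c \<and> g c = f a) \<or> (g a = f c \<and> g c = f b \<and> g b = f a)"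
    using fg e by auto
  then obtain e1 e2 e3 where ee: "{e1, e2, e3} = {a, b, c}" "e1 \<noteq> e2" "e1 \<noteq> e3" "e2 \<noteq> e3"
    and gf: "g e1 = f e2" "g e2 = f e3" "g e3 = f e1"
    using abc by (metis insert_commute)
  have e1: "e1 \<in> D1" "e1 \<noteq> \<one>" and e2: "e2 \<in> D1" "e2 \<noteq> \<one>" and e3: "e3 \<in> D1" "e3 \<noteq> \<one>"
    using ee(1) abc(1) by auto
  have mem: "f e1 \<in> D2" "f e2 \<in> D2" "f e3 \<in> D2" "e1 \<otimes> f e1 \<in> D3" "e2 \<otimes> f e2 \<in> D3" "e3 \<otimes> f e3 \<in> D3"
    "e1 \<otimes> f e2 \<in> D4" "e2 \<otimes> f e3 \<in> D4" "e3 \<otimes> f e1 \<in> D4"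
    using f e1 e2 e3 g[OF e1] g[OF e2] g[OF e3] unfolding gf by auto
  have f1: "f e1 \<noteq> \<one>" "f e3 \<noteq> \<one>" using f e1 e3 by auto
  have fne: "f e1 \<noteq> f e2" "f e1 \<noteq> f e3" "f e2 \<noteq> f e3" using f_inj e1 e2 e3 ee by auto
  have off: "e1 \<otimes> f e3 \<notin> D1" "e1 \<otimes> f e3 \<notin> D2" "e1 \<otimes> f e3 \<notin> D3" "e1 \<otimes> f e3 \<notin> D4" "e2 \<otimes> f e1 \<notin> D1"
  proof -
    show "e1 \<otimes> f e3 \<notin> D1" "e2 \<otimes> f e1 \<notin> D1"
      using mult_mem_cancel_left[OF D(1)] e1 e2 mem D2c f1 Int_trivial[OF D(1,2) ne(1)] by metis+
    show "e1 \<otimes> f e3 \<notin> D2"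
      using mult_mem_cancel_right[OF D(2)] e1 mem D1c Int_trivial[OF D(1,2) ne(1)] by metis
    show "e1 \<otimes> f e3 \<notin> D3"
      using complement_graph_inj[OF D(1,2,3) ne(1,2,4) e1(1) e1(1) mem(1) mem(3) mem(4)] fne by blast
    show "e1 \<otimes> f e3 \<notin> D4"
      using complement_graph_inj[OF D(1,2,4) ne(1,3,5) e1(1) e1(1) mem(2) mem(3) mem(7)] fne by blast
  qed
  have ne1: "e1 \<otimes> f e3 \<noteq> \<one>" "e2 \<otimes> f e1 \<noteq> \<one>" using off one_mem[OF D(1)] by auto
  \<comment> \<open>The first product avoids the four members of order 4, so its member has order 2
    and has no room for a second non-trivial element.\<close>
  have notin: False if FD: "F \<in> \<D>" and in1: "e1 \<otimes> f e3 \<in> F" and in2: "e2 \<otimes> f e1 \<in> F" for F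
  proof -
    have "F \<notin> {D1, D2, D3, D4}" using off in1 by auto
    then have "F \<notin> {D \<in> \<D>. card D = 4}" using S by simp
    then have "card F = 2" using two_four[OF FD] FD by simp
    moreover have "e1 \<otimes> f e3 \<noteq> e2 \<otimes> f e1"
      using inj_onD[OF product_inj[OF D(1,2) ne(1)], of "(e1, f e3)" "(e2, f e1)"] e1 e2 mem ee(2) by auto
    then have "card {\<one>, e1 \<otimes> f e3, e2 \<otimes> f e1} = 3" using ne1 by auto
    moreover have "{\<one>, e1 \<otimes> f e3, e2 \<otimes> f e1} \<subseteq> F" using in1 in2 one_mem[OF FD] by auto
    ultimately show False using card_mono[OF finite_member[OF FD], of "{\<one>, e1 \<otimes> f e3, e2 \<otimes> f e1}"] by linarith
  qed
  show ?thesis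
    using that[OF D e1(1) e2(1) e3(1) mem ne1 notin commQ] .
qed

end

section \<open>Non-abelian centralizers\<close>

lemma (in group) group_centralizer_iff:
  "g \<in> group_centralizer G x \<longleftrightarrow> g \<in> carrier G \<and> g \<otimes> x = x \<otimes> g"
  by (simp add: group_centralizer_def)

lemma (in group) subgroup_centralizer:
  assumes x: "x \<in> carrier G"
  shows "subgroup (group_centralizer G x) G"
proof (rule subgroupI)
  fix g h assume g: "g \<in> group_centralizer G x" and h: "h \<in> group_centralizer G x"
  have c: "g \<in> carrier G" "h \<in> carrier G" "g \<otimes> x = x \<otimes> g" "h \<otimes> x = x \<otimes> h"
    using g h by (auto simp: group_centralizer_iff)
  have "inv g \<otimes> (g \<otimes> x) \<otimes> inv g = inv g \<otimes> (x \<otimes> g) \<otimes> inv g" using c by simp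
  then have "x \<otimes> inv g = inv g \<otimes> x"
    using c x by (metis inv_closed inv_solve_left inv_solve_right m_assoc m_closed)
  then show "inv g \<in> group_centralizer G x" using c by (simp add: group_centralizer_iff)
  have "g \<otimes> h \<otimes> x = g \<otimes> (x \<otimes> h)" using c x by (simp add: m_assoc)
  also have "\<dots> = x \<otimes> (g \<otimes> h)" using c x by (metis m_assoc)
  finally show "g \<otimes> h \<in> group_centralizer G x" using c by (simp add: group_centralizer_iff)
next
  show "group_centralizer G x \<noteq> {}" using x unfolding group_centralizer_def by blast
qed (auto simp: group_centralizer_iff)

lemma (in group) centralizer_sym:
  "x \<in> carrier G \<Longrightarrow> y \<in> carrier G \<Longrightarrow> x \<in> group_centralizer G y \<longleftrightarrow> y \<in> group_centralizer G x"
  by (auto simp: group_centralizer_iff)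

lemma (in group) subgroup_mult_cancel:
  assumes "subgroup K G" "y \<in> carrier G" "x \<in> K"
  shows "x \<otimes> y \<in> K \<longleftrightarrow> y \<in> K" "y \<otimes> x \<in> K \<longleftrightarrow> y \<in> K"
proof -
  have x: "x \<in> carrier G" using assms subgroup.mem_carrier by metis
  have i: "inv x \<in> K" using assms subgroup.m_inv_closed by metis
  have "inv x \<otimes> (x \<otimes> y) = y" "y \<otimes> x \<otimes> inv x = y"
    using x assms(2) by (simp_all add: m_assoc flip: m_assoc[of "inv x" x y])
  then show "x \<otimes> y \<in> K \<longleftrightarrow> y \<in> K" "y \<otimes> x \<in> K \<longleftrightarrow> y \<in> K"
    using i assms subgroup.m_closed by metis+
qed

text \<open>What commutes with \<open>g\<close> also commutes with \<open>h\<close>, hence with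
  their quotient; applied to \<open>g\<close> itself this gives the second claim. An equality of two
  centralizers thus becomes a lower bound for the centralizer of one element.\<close>

lemma (in group) centralizer_quotient:
  assumes gh: "g \<in> carrier G" "h \<in> carrier G" "group_centralizer G g = group_centralizer G h"
  shows "t \<in> group_centralizer G g \<Longrightarrow> t \<in> group_centralizer G (inv g \<otimes> h)"
    and "inv g \<otimes> h \<in> group_centralizer G g"
proof -
  have cc: "inv g \<otimes> h \<in> group_centralizer G t"
    if "t \<in> group_centralizer G g" for t
  proof -
    have t: "t \<in> carrier G" using that by (simp add: group_centralizer_iff)
    have "g \<in> group_centralizer G t" "h \<in> group_centralizer G t"
      using that gh centralizer_sym[OF t] by auto
    then show ?thesis using subgroup_centralizer[OF t] subgroup.m_closed subgroup.m_inv_closed by metis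
  qed
  show "t \<in> group_centralizer G g \<Longrightarrow> t \<in> group_centralizer G (inv g \<otimes> h)"
    using cc gh centralizer_sym by (simp add: group_centralizer_iff)
  show "inv g \<otimes> h \<in> group_centralizer G g"
    using cc gh by (simp add: group_centralizer_iff)
qed

text \<open>The elements outside a non-abelian centralizer \<open>K = C(x)\<close> contribute many centralizers:
  if \<open>C(y u) = C(y v)\<close> with \<open>u, v \<in> K\<close>, then \<open>u\<inverse> v\<close> commutes with the element \<open>y u\<close>, which lies
  outside \<open>K\<close>.\<close>
lemma (in group) ten_le_card_Cent:
  assumes fin: "finite (Cent G)" and x: "x \<in> carrier G" "x \<notin> group_center G"
    and nonab: "a \<in> group_centralizer G x" "b \<in> group_centralizer G x" "a \<otimes> b \<noteq> b \<otimes> a"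
  shows "10 \<le> card (Cent G)"
proof -
  let ?C = "group_centralizer G"
  define K where "K = ?C x"
  have K: "subgroup K G" unfolding K_def by (rule subgroup_centralizer[OF x(1)])
  have Kc: "k \<in> carrier G" if "k \<in> K" for k using subgroup.mem_carrier[OF K that] .
  have xK: "x \<in> K" using x by (simp add: K_def group_centralizer_iff)
  have xcom: "x \<in> ?C k" if "k \<in> K" for k using that x by (auto simp: K_def group_centralizer_iff)
  obtain y where y: "y \<in> carrier G" "y \<notin> K"
    using x unfolding K_def group_center_def group_centralizer_def by force
  have yu: "y \<otimes> u \<in> carrier G" "y \<otimes> u \<notin> K" if "u \<in> K" for u
    using y Kc[OF that] subgroup_mult_cancel(2)[OF K y(1) that] by auto
  have quot: "inv (y \<otimes> u) \<otimes> (y \<otimes> v) = inv u \<otimes> v" if "u \<in> K" "v \<in> K" for u v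
  proof -
    have "inv (y \<otimes> u) \<otimes> (y \<otimes> v) = inv u \<otimes> (inv y \<otimes> y) \<otimes> v"
      using y Kc that by (simp only: inv_mult_group m_assoc m_closed inv_closed)
    then show ?thesis using y Kc that by simp
  qed
  have sep: "y \<otimes> u \<in> ?C (inv u \<otimes> v)" if "u \<in> K" "v \<in> K" "?C (y \<otimes> u) = ?C (y \<otimes> v)" for u v
    using centralizer_quotient(1)[OF yu(1)[OF that(1)] yu(1)[OF that(2)] that(3)] yu(1)[OF that(1)]
    unfolding quot[OF that(1,2)] by (simp add: group_centralizer_iff)
  have sepx: "?C (y \<otimes> u) \<noteq> ?C (y \<otimes> (u \<otimes> x))" if u: "u \<in> K" for u
  proof
    assume eq: "?C (y \<otimes> u) = ?C (y \<otimes> (u \<otimes> x))"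
    have "inv u \<otimes> (u \<otimes> x) = x" using Kc[OF u] x by (simp flip: m_assoc)
    then have "y \<otimes> u \<in> K" using sep[OF u _ eq] u xK subgroup.m_closed[OF K] by (simp add: K_def)
    then show False using yu[OF u] by blast
  qed
  \<comment> \<open>Elements of \<open>K\<close> have centralizers containing \<open>x\<close>,
    elements outside \<open>K\<close> do not, so the two sources contribute disjoint
    families.\<close>
  define In where "In = {c \<in> Cent G. x \<in> c}"
  define Out where "Out = {c \<in> Cent G. x \<notin> c}"
  have InI: "?C k \<in> In" if "k \<in> K" for k using xcom[OF that] Kc[OF that] by (simp add: In_def Cent_def)
  have OutI: "?C (y \<otimes> u) \<in> Out" if "u \<in> K" for u
    using yu[OF that] x centralizer_sym[OF x(1) yu(1)[OF that]] by (simp add: Out_def Cent_def K_def)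
  have cardCent: "card (Cent G) = card In + card Out"
    using fin by (subst card_Un_disjoint[symmetric]) (auto simp: In_def Out_def intro: arg_cong[where f = card])
  have finIO: "finite In" "finite Out" using fin by (auto simp: In_def Out_def)
  have one: "\<one> \<in> K" "?C \<one> = carrier G" using subgroup.one_closed[OF K] by (auto simp: group_centralizer_def)
  \<comment> \<open>The elements \<open>a\<close>, \<open>b\<close> and \<open>a \<otimes> b\<close>
    pairwise do not commute, so their centralizers differ from each other and from the two that
    contain both \<open>a\<close> and \<open>b\<close>.\<close>
  have five: "card {carrier G, K, ?C a, ?C b, ?C (a \<otimes> b)} = 5 \<and>
      {carrier G, K, ?C a, ?C b, ?C (a \<otimes> b)} \<subseteq> In \<and> a \<otimes> b \<in> K \<and>
      a \<notin> ?C (a \<otimes> b) \<and> b \<notin> ?C (a \<otimes> b)"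
    if ab: "a \<in> K" "b \<in> K" "a \<otimes> b \<noteq> b \<otimes> a" for a b
  proof -
    have c: "a \<in> carrier G" "b \<in> carrier G" using ab Kc by auto
    have mem: "a \<in> ?C a" "b \<in> ?C b" "b \<notin> ?C a" "a \<notin> ?C b" using c ab by (auto simp: group_centralizer_iff)
    have nab: "a \<notin> ?C (a \<otimes> b)" "b \<notin> ?C (a \<otimes> b)"
      using c ab(3) by (auto simp: group_centralizer_iff m_assoc) (metis m_assoc r_cancel m_closed)
    have abK: "a \<otimes> b \<in> K" using ab subgroup.m_closed[OF K] by simp
    have "distinct [carrier G, K, ?C a, ?C b, ?C (a \<otimes> b)]"
      using mem nab c y ab by auto
    then have "card (set [carrier G, K, ?C a, ?C b, ?C (a \<otimes> b)]) = 5"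
      by (subst distinct_card) auto
    moreover have "{carrier G, K, ?C a, ?C b, ?C (a \<otimes> b)} \<subseteq> In"
      using InI[OF one(1)] InI[OF xK] InI[OF ab(1)] InI[OF ab(2)] InI[OF abK] one(2) by (simp add: K_def)
    ultimately show ?thesis using nab abK by simp
  qed
  \<comment> \<open>Ten arises as 5 + 5 if every element of \<open>K\<close> that is not central in
    \<open>K\<close> has its centralizer inside \<open>K\<close>, and as 6 + 4 otherwise.\<close>
  show ?thesis
  proof (cases "\<exists>a\<in>K. \<exists>b\<in>K. a \<otimes> b \<noteq> b \<otimes> a \<and> \<not> ?C a \<subseteq> K")
    case False
    have a: "a \<in> K" and b: "b \<in> K" using nonab by (auto simp: K_def)
    have ax: "a \<otimes> x \<in> K" using a xK subgroup.m_closed[OF K] by simp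
    \<comment> \<open>If some \<open>k\<close> in \<open>K\<close> commutes with just one of
      \<open>u\<close> and \<open>v\<close>, their quotient is not central in \<open>K\<close>, so
      its centralizer stays inside \<open>K\<close> and cannot contain the element
      \<open>y \<otimes> u\<close>.\<close>
    have sep2: "?C (y \<otimes> u) \<noteq> ?C (y \<otimes> v)"
      if uv: "u \<in> K" "v \<in> K" "k \<in> K" "(u \<in> ?C k) \<noteq> (v \<in> ?C k)" for u v k
    proof
      assume eq: "?C (y \<otimes> u) = ?C (y \<otimes> v)"
      define w where "w = inv u \<otimes> v"
      have w: "w \<in> K" using uv subgroup.m_closed[OF K] subgroup.m_inv_closed[OF K] by (simp add: w_def)
      have "v = u \<otimes> w" using uv Kc by (simp add: w_def flip: m_assoc)
      then have "w \<notin> ?C k"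
        using uv(4) subgroup_mult_cancel[OF subgroup_centralizer[OF Kc[OF uv(3)]]] Kc[OF w] Kc[OF uv(1)] by metis
      then have "w \<otimes> k \<noteq> k \<otimes> w" using Kc[OF w] by (simp add: group_centralizer_iff)
      then have "?C w \<subseteq> K" using False w uv(3) by blast
      then show False using sep[OF uv(1,2) eq] yu(2)[OF uv(1)] w_def by blast
    qed
    have axC: "a \<otimes> x \<in> ?C a" "a \<otimes> x \<notin> ?C b"
      using a b nonab(3) xcom[OF a] xcom[OF b] subgroup_mult_cancel(2)[OF subgroup_centralizer] Kc
      by (auto simp: group_centralizer_iff)
    have m: "a \<in> ?C a" "b \<notin> ?C a" "a \<notin> ?C b" "b \<in> ?C b" "x \<in> ?C a" "x \<in> ?C b" "\<one> \<in> ?C a" "\<one> \<in> ?C b"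
      using a b nonab(3) xcom[OF a] xcom[OF b] Kc by (auto simp: group_centralizer_iff)
    have "distinct [?C (y \<otimes> \<one>), ?C (y \<otimes> x), ?C (y \<otimes> a), ?C (y \<otimes> (a \<otimes> x)), ?C (y \<otimes> b)]"
      using sepx[OF one(1)] sepx[OF a] x(1)
        sep2[OF one(1) a b] sep2[OF one(1) ax b] sep2[OF one(1) b a]
        sep2[OF xK a b] sep2[OF xK ax b] sep2[OF xK b a] sep2[OF a b a] sep2[OF ax b a] m axC
      by simp
    then have "card (set [?C (y \<otimes> \<one>), ?C (y \<otimes> x), ?C (y \<otimes> a), ?C (y \<otimes> (a \<otimes> x)), ?C (y \<otimes> b)]) = 5"
      by (subst distinct_card) auto
    moreover have "set [?C (y \<otimes> \<one>), ?C (y \<otimes> x), ?C (y \<otimes> a), ?C (y \<otimes> (a \<otimes> x)), ?C (y \<otimes> b)] \<subseteq> Out"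
      using OutI[OF one(1)] OutI[OF xK] OutI[OF a] OutI[OF ax] OutI[OF b] by simp
    ultimately have "5 \<le> card Out" using card_mono[OF finIO(2)] by metis
    moreover have "5 \<le> card In" using five[OF a b nonab(3)] card_mono[OF finIO(1)] by metis
    ultimately show ?thesis using cardCent by simp
  next
    case True
    then obtain a b where ab: "a \<in> K" "b \<in> K" "a \<otimes> b \<noteq> b \<otimes> a" "\<not> ?C a \<subseteq> K" by blast
    note c = Kc[OF ab(1)] Kc[OF ab(2)]
    have ax: "a \<otimes> x \<in> K" using ab xK subgroup.m_closed[OF K] by simp
    \<comment> \<open>The sixth centralizer: equality would make all of \<open>C(a)\<close> commute
      with \<open>x\<close>, that is, lie in \<open>K\<close>.\<close>
    have "?C (a \<otimes> x) \<noteq> ?C a"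
    proof
      assume eq: "?C (a \<otimes> x) = ?C a"
      have "inv a \<otimes> (a \<otimes> x) = x" using c x by (simp flip: m_assoc)
      then have "?C a \<subseteq> K"
        using centralizer_quotient(1)[OF c(1) Kc[OF ax] eq[symmetric]] by (auto simp: K_def)
      then show False using ab(4) by blast
    qed
    moreover have m: "a \<in> ?C (a \<otimes> x)" "b \<notin> ?C (a \<otimes> x)"
    proof -
      have "a \<otimes> x \<in> ?C k \<longleftrightarrow> a \<in> ?C k" if "k \<in> K" for k
        by (rule subgroup_mult_cancel(2)[OF subgroup_centralizer[OF Kc[OF that]] c(1) xcom[OF that]])
      then show "a \<in> ?C (a \<otimes> x)" "b \<notin> ?C (a \<otimes> x)"
        using centralizer_sym[OF Kc[OF ax]] ab c by (auto simp: group_centralizer_iff)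
    qed
    moreover have "b \<in> ?C b" "a \<notin> ?C b" using c ab(3) by (auto simp: group_centralizer_iff)
    ultimately have "?C (a \<otimes> x) \<notin> {carrier G, K, ?C a, ?C b, ?C (a \<otimes> b)}"
      using five[OF ab(1-3)] ab(2) c by auto
    then have "card (insert (?C (a \<otimes> x)) {carrier G, K, ?C a, ?C b, ?C (a \<otimes> b)}) = 6"
      using five[OF ab(1-3)] by (subst card_insert_disjoint) auto
    moreover have "insert (?C (a \<otimes> x)) {carrier G, K, ?C a, ?C b, ?C (a \<otimes> b)} \<subseteq> In"
      using five[OF ab(1-3)] InI[OF ax] by simp
    ultimately have In: "6 \<le> card In" using card_mono[OF finIO(1)] by metis
    define bad where "bad u v \<longleftrightarrow> ?C (y \<otimes> u) = ?C (y \<otimes> v) \<or> ?C (y \<otimes> u) = ?C (y \<otimes> (v \<otimes> x))" for u v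
    \<comment> \<open>As \<open>u\<close> and \<open>x\<close> are central in \<open>K\<close>, the
      quotient coming from a bad pair commutes with the same elements of \<open>K\<close> as
      \<open>v\<close> does. Two such quotients lie in the centralizer of
      \<open>y \<otimes> u\<close> and are centralized by all of it, so they commute.\<close>
    have bad_comm: "v \<otimes> v' = v' \<otimes> v"
      if v: "v \<in> K" "v' \<in> K" and bad: "bad u v" "bad u v'" and u: "u \<in> {\<one>, x}" for u v v'
    proof -
      have uK: "u \<in> K" using u one(1) xK by auto
      have ucom: "inv u \<in> ?C k" if "k \<in> K" for k
        using u xcom[OF that] subgroup.m_inv_closed[OF subgroup_centralizer[OF Kc[OF that]]]
          subgroup.one_closed[OF subgroup_centralizer[OF Kc[OF that]]] by auto
      have ex: "\<exists>w\<in>K. (\<forall>k\<in>K. w \<in> ?C k \<longleftrightarrow> v \<in> ?C k) \<and> w \<in> ?C (y \<otimes> u) \<and> (\<forall>t\<in>?C (y \<otimes> u). t \<in> ?C w)"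
        if v: "v \<in> K" "bad u v" for v
      proof -
        obtain s where s: "s \<in> {v, v \<otimes> x}" "?C (y \<otimes> u) = ?C (y \<otimes> s)"
          using v(2) unfolding bad_def by blast
        have sK: "s \<in> K" using s v xK subgroup.m_closed[OF K] by auto
        define w where "w = inv u \<otimes> s"
        have w: "w \<in> K" using uK sK subgroup.m_closed[OF K] subgroup.m_inv_closed[OF K] by (simp add: w_def)
        have "w \<in> ?C k \<longleftrightarrow> v \<in> ?C k" if k: "k \<in> K" for k
        proof -
          have "w \<in> ?C k \<longleftrightarrow> s \<in> ?C k"
            using subgroup_mult_cancel(1)[OF subgroup_centralizer[OF Kc[OF k]] Kc[OF sK] ucom[OF k]] w_def by simp
          also have "\<dots> \<longleftrightarrow> v \<in> ?C k"
            using subgroup_mult_cancel(2)[OF subgroup_centralizer[OF Kc[OF k]] Kc[OF v(1)] xcom[OF k]] s(1) by auto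
          finally show ?thesis .
        qed
        moreover have "w \<in> ?C (y \<otimes> u)" "t \<in> ?C w" if "t \<in> ?C (y \<otimes> u)" for t
          using centralizer_quotient[OF yu(1)[OF uK] yu(1)[OF sK] s(2)] that unfolding quot[OF uK sK] w_def
          by auto
        moreover have "y \<otimes> u \<in> ?C (y \<otimes> u)" using yu[OF uK] by (simp add: group_centralizer_iff)
        ultimately show ?thesis using w by blast
      qed
      obtain w w' where w: "w \<in> K" "\<And>k. k \<in> K \<Longrightarrow> w \<in> ?C k \<longleftrightarrow> v \<in> ?C k" "\<And>t. t \<in> ?C (y \<otimes> u) \<Longrightarrow> t \<in> ?C w"
        and w': "w' \<in> K" "\<And>k. k \<in> K \<Longrightarrow> w' \<in> ?C k \<longleftrightarrow> v' \<in> ?C k" "w' \<in> ?C (y \<otimes> u)"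
        using ex[OF v(1) bad(1)] ex[OF v(2) bad(2)] by metis
      have "w' \<in> ?C w" using w(3) w'(3) by blast
      then have "v' \<in> ?C w" using w'(2)[OF w(1)] by blast
      then have "w \<in> ?C v'" using centralizer_sym Kc w(1) v by blast
      then have "v \<in> ?C v'" using w(2)[OF v(2)] by blast
      then show ?thesis by (simp add: group_centralizer_iff)
    qed
    have abK: "a \<otimes> b \<in> K" and nc: "a \<otimes> (a \<otimes> b) \<noteq> a \<otimes> b \<otimes> a" "b \<otimes> (a \<otimes> b) \<noteq> a \<otimes> b \<otimes> b"
      using five[OF ab(1-3)] c by (auto simp: group_centralizer_iff)
    \<comment> \<open>The three candidates pairwise do not commute, so each of the two elements
      \<open>\<one>\<close> and \<open>x\<close> spoils at most one of them.\<close>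
    have "\<exists>v\<in>{a, b, a \<otimes> b}. \<not> bad \<one> v \<and> \<not> bad x v"
      using bad_comm ab abK nc by (metis insertCI)
    then obtain v where v: "v \<in> K" "\<not> bad \<one> v" "\<not> bad x v" using ab abK by auto
    have vx: "v \<otimes> x \<in> K" using v xK subgroup.m_closed[OF K] by simp
    have "distinct [?C (y \<otimes> \<one>), ?C (y \<otimes> x), ?C (y \<otimes> v), ?C (y \<otimes> (v \<otimes> x))]"
      using sepx[OF one(1)] sepx[OF v(1)] v(2,3) x(1) unfolding bad_def by simp
    then have "card (set [?C (y \<otimes> \<one>), ?C (y \<otimes> x), ?C (y \<otimes> v), ?C (y \<otimes> (v \<otimes> x))]) = 4"
      by (subst distinct_card) auto
    moreover have "set [?C (y \<otimes> \<one>), ?C (y \<otimes> x), ?C (y \<otimes> v), ?C (y \<otimes> (v \<otimes> x))] \<subseteq> Out"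
      using OutI[OF one(1)] OutI[OF xK] OutI[OF v(1)] OutI[OF vx] by simp
    ultimately have "4 \<le> card Out" using card_mono[OF finIO(2)] by metis
    then show ?thesis using In cardCent by simp
  qed
qed

section \<open>Groups in which non-central elements have abelian centralizers\<close>

lemma (in group) subgroup_center: "subgroup (group_center G) G"
proof -
  have eq: "group_center G = (\<Inter>x\<in>carrier G. group_centralizer G x) \<inter> carrier G"
    by (auto simp: group_center_def group_centralizer_def)
  show ?thesis
  proof (rule subgroupI)
    show "group_center G \<noteq> {}" unfolding group_center_def by auto
  qed (unfold eq, use subgroup.m_closed[OF subgroup_centralizer] subgroup.m_inv_closed[OF subgroup_centralizer] in auto)
qed

lemma (in group) center_commute: "z \<in> group_center G \<Longrightarrow> g \<in> carrier G \<Longrightarrow> z \<otimes> g = g \<otimes> z"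
  by (simp add: group_center_def)

lemma (in group) center_normal: "group_center G \<lhd> G"
proof -
  have "g \<otimes> z \<otimes> inv g = z" if "g \<in> carrier G" "z \<in> group_center G" for g z
    using that center_commute[OF that(2), of "inv g"] subgroup.mem_carrier[OF subgroup_center that(2)]
    by (simp add: m_assoc flip: m_assoc[of g "inv g" z])
  then show ?thesis using subgroup_center by (auto simp: normal_inv_iff)
qed

lemma (in group) center_subset_centralizer:
  "x \<in> carrier G \<Longrightarrow> group_center G \<subseteq> group_centralizer G x"
  by (auto simp: group_center_def group_centralizer_def)

lemma (in group) centralizer_eq_carrier_iff:
  assumes x: "x \<in> carrier G"
  shows "group_centralizer G x = carrier G \<longleftrightarrow> x \<in> group_center G"
proof -
  have "group_centralizer G x = carrier G \<longleftrightarrow> (\<forall>g\<in>carrier G. g \<otimes> x = x \<otimes> g)"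
    by (auto simp: group_centralizer_def)
  moreover have "x \<in> group_center G \<longleftrightarrow> (\<forall>g\<in>carrier G. g \<otimes> x = x \<otimes> g)"
    using x unfolding group_center_def mem_Collect_eq by (simp add: eq_commute)
  ultimately show ?thesis by simp
qed

text \<open>The name refers to abelian centralizers: these are CA-groups, but with a possibly
  non-trivial centre. Fewer than ten centralizers in a non-abelian group lead here.\<close>

locale ca_group = group G for G (structure) +
  assumes finite_Cent: "finite (Cent G)"
    and abelian_centralizer: "\<lbrakk>x \<in> carrier G - group_center G; a \<in> group_centralizer G x;
      b \<in> group_centralizer G x\<rbrakk> \<Longrightarrow> a \<otimes> b = b \<otimes> a"
    and nonabelian: "group_center G \<noteq> carrier G"
begin

abbreviation Z where "Z \<equiv> group_center G"
abbreviation C where "C \<equiv> group_centralizer G"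
abbreviation \<pi> where "\<pi> \<equiv> r_coset G Z"

definition centralizer_images :: "'a set set set" where
  "centralizer_images = (\<lambda>c. \<pi> ` c) ` (Cent G - {carrier G})"

text \<open>Abelian centralizers make commuting transitive on the non-central elements. The
  resulting classes, enlarged by the centre, are the proper centralizers.\<close>

lemma commute_iff:
  assumes "x \<in> carrier G - Z" "y \<in> carrier G - Z"
  shows "x \<otimes> y = y \<otimes> x \<longleftrightarrow> C x = C y"
proof
  assume xy: "x \<otimes> y = y \<otimes> x"
  have yx: "y \<in> C x" and "x \<in> C y" using xy assms by (auto simp: group_centralizer_iff)
  have "g \<in> C y" if "g \<in> C x" for g
    using abelian_centralizer[OF assms(1) that yx] that by (simp add: group_centralizer_iff)
  moreover have "g \<in> C x" if "g \<in> C y" for g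
    using abelian_centralizer[OF assms(2) that \<open>x \<in> C y\<close>] that by (simp add: group_centralizer_iff)
  ultimately have "C x \<subseteq> C y" "C y \<subseteq> C x" by blast+
  then show "C x = C y" by blast
next
  assume "C x = C y"
  then have "x \<in> C y" using assms by (auto simp: group_centralizer_iff)
  then show "x \<otimes> y = y \<otimes> x" by (simp add: group_centralizer_iff)
qed

lemma centralizer_eq: "x \<in> carrier G - Z \<Longrightarrow> y \<in> C x \<Longrightarrow> y \<notin> Z \<Longrightarrow> C y = C x"
  using commute_iff[of y x] by (auto simp: group_centralizer_iff)

lemma proper_Cent_iff: "c \<in> Cent G - {carrier G} \<longleftrightarrow> (\<exists>x\<in>carrier G - Z. c = C x)"
  using centralizer_eq_carrier_iff by (auto simp: Cent_def)

lemma \<pi>_eq_iff: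
  assumes "g \<in> carrier G" "h \<in> carrier G"
  shows "\<pi> g = \<pi> h \<longleftrightarrow> (\<exists>z\<in>Z. h = z \<otimes> g)"
proof
  assume "\<pi> g = \<pi> h"
  then have "h \<in> \<pi> g" using rcos_self[OF assms(2) subgroup_center] by simp
  then show "\<exists>z\<in>Z. h = z \<otimes> g" by (auto simp: r_coset_def)
next
  assume "\<exists>z\<in>Z. h = z \<otimes> g"
  then have "h \<in> \<pi> g" by (auto simp: r_coset_def)
  then show "\<pi> g = \<pi> h" using repr_independence[OF _ assms(1) subgroup_center] by simp
qed

lemma \<pi>_mem_iff:
  assumes "Z \<subseteq> c" "subgroup c G" "g \<in> carrier G"
  shows "\<pi> g \<in> \<pi> ` c \<longleftrightarrow> g \<in> c"
proof
  assume "\<pi> g \<in> \<pi> ` c"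
  then obtain h where h: "h \<in> c" "\<pi> h = \<pi> g" by auto
  then obtain z where "z \<in> Z" "g = z \<otimes> h"
    using \<pi>_eq_iff[OF subgroup.mem_carrier[OF assms(2) h(1)] assms(3)] by auto
  then show "g \<in> c" using h(1) assms(1) subgroup.m_closed[OF assms(2)] by blast
qed auto

lemma \<pi>_mem_centralizer:
  "x \<in> carrier G \<Longrightarrow> g \<in> carrier G \<Longrightarrow> \<pi> g \<in> \<pi> ` C x \<longleftrightarrow> g \<in> C x"
  using \<pi>_mem_iff center_subset_centralizer subgroup_centralizer by blast

sublocale Q: group "G Mod Z"
  by (rule normal.factorgroup_is_group[OF center_normal])

sublocale proj: group_hom G "G Mod Z" \<pi>
  by (unfold_locales) (rule normal.r_coset_hom_Mod[OF center_normal])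

lemma \<pi>_one_iff: "g \<in> carrier G \<Longrightarrow> \<pi> g = Z \<longleftrightarrow> g \<in> Z"
  using coset_join1[OF _ _ subgroup_center] coset_join2[OF _ subgroup_center] subgroup.subset[OF subgroup_center]
  by blast

lemma carrier_quotient: "carrier (G Mod Z) = \<pi> ` carrier G"
  by (rule carrier_FactGroup)

lemma \<pi>_conjugate:
  assumes "g \<in> carrier G" "c \<subseteq> carrier G"
  shows "conjugate (G Mod Z) (\<pi> g) (\<pi> ` c) = \<pi> ` conjugate G g c"
proof -
  have "\<pi> (g \<otimes> x \<otimes> inv g) = \<pi> g \<otimes>\<^bsub>G Mod Z\<^esub> \<pi> x \<otimes>\<^bsub>G Mod Z\<^esub> inv\<^bsub>G Mod Z\<^esub> \<pi> g" if "x \<in> c" for x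
  proof -
    have "x \<in> carrier G" using that assms by auto
    then show ?thesis using assms(1) by (simp only: proj.hom_mult proj.hom_inv m_closed inv_closed)
  qed
  then show ?thesis unfolding conjugate_def image_image by (intro image_cong) auto
qed

lemma centralizer_conjugate:
  assumes "g \<in> carrier G" "x \<in> carrier G"
  shows "conjugate G g (C x) = C (g \<otimes> x \<otimes> inv g)"
proof -
  have sub: "conjugate G g (C x) \<subseteq> C (g \<otimes> x \<otimes> inv g)" if g: "g \<in> carrier G" and x: "x \<in> carrier G" for g x
  proof (clarsimp simp: conjugate_def group_centralizer_iff g x)
    fix h assume h: "h \<in> carrier G" "h \<otimes> x = x \<otimes> h"
    have *: "g \<otimes> a \<otimes> inv g \<otimes> (g \<otimes> b \<otimes> inv g) = g \<otimes> (a \<otimes> b) \<otimes> inv g" if "a \<in> carrier G" "b \<in> carrier G" for a b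
    proof -
      have "g \<otimes> a \<otimes> inv g \<otimes> (g \<otimes> b \<otimes> inv g) = g \<otimes> a \<otimes> (inv g \<otimes> g) \<otimes> b \<otimes> inv g"
        using g that by (simp only: m_assoc m_closed inv_closed)
      then show ?thesis using g that by (simp add: m_assoc)
    qed
    show "g \<otimes> h \<otimes> inv g \<otimes> (g \<otimes> x \<otimes> inv g) = g \<otimes> x \<otimes> inv g \<otimes> (g \<otimes> h \<otimes> inv g)"
      using h x by (simp add: *)
  qed
  have "C (g \<otimes> x \<otimes> inv g) \<subseteq> conjugate G g (C x)"
  proof
    fix h assume h: "h \<in> C (g \<otimes> x \<otimes> inv g)"
    have hc: "h \<in> carrier G" using h by (simp add: group_centralizer_iff)
    have "inv g \<otimes> h \<otimes> inv (inv g) \<in> conjugate G (inv g) (C (g \<otimes> x \<otimes> inv g))"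
      using h unfolding conjugate_def by blast
    then have "inv g \<otimes> h \<otimes> inv (inv g) \<in> C (inv g \<otimes> (g \<otimes> x \<otimes> inv g) \<otimes> inv (inv g))"
      using sub[of "inv g" "g \<otimes> x \<otimes> inv g"] assms by auto
    moreover have "inv g \<otimes> (g \<otimes> x \<otimes> inv g) \<otimes> inv (inv g) = (inv g \<otimes> g) \<otimes> x \<otimes> (inv g \<otimes> g)"
      using assms by (simp only: m_assoc m_closed inv_closed inv_inv)
    ultimately have "inv g \<otimes> h \<otimes> g \<in> C x" using assms by simp
    moreover have "g \<otimes> (inv g \<otimes> h \<otimes> g) \<otimes> inv g = (g \<otimes> inv g) \<otimes> h \<otimes> (g \<otimes> inv g)"
      using assms hc by (simp only: m_assoc m_closed inv_closed)
    then have "h = g \<otimes> (inv g \<otimes> h \<otimes> g) \<otimes> inv g" using assms hc by simp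
    ultimately show "h \<in> conjugate G g (C x)" unfolding conjugate_def by blast
  qed
  then show ?thesis using sub[OF assms] by blast
qed

lemma centralizer_images_iff: "D \<in> centralizer_images \<longleftrightarrow> (\<exists>x\<in>carrier G - Z. D = \<pi> ` C x)"
proof -
  have "D \<in> centralizer_images \<longleftrightarrow> (\<exists>c. c \<in> Cent G - {carrier G} \<and> D = \<pi> ` c)"
    unfolding centralizer_images_def by (rule image_iff[unfolded Bex_def])
  then show ?thesis unfolding proper_Cent_iff by metis
qed

lemma class_eq:
  assumes "D \<in> centralizer_images" "g \<in> carrier G - Z" "\<pi> g \<in> D"
  shows "D = \<pi> ` C g"
proof -
  obtain x where x: "x \<in> carrier G - Z" "D = \<pi> ` C x" using assms centralizer_images_iff by blast
  then have "g \<in> C x" using assms(2,3) \<pi>_mem_centralizer by auto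
  then show ?thesis using centralizer_eq[OF x(1)] assms(2) x(2) by auto
qed

sublocale abelian_partition "G Mod Z" centralizer_images
proof
  show "finite centralizer_images" using finite_Cent by (simp add: centralizer_images_def)
  fix D assume D: "D \<in> centralizer_images"
  then obtain x where x: "x \<in> carrier G - Z" "D = \<pi> ` C x" unfolding centralizer_images_iff ..
  have xC: "x \<in> C x" using x by (simp add: group_centralizer_iff)
  have sub: "subgroup D (G Mod Z)"
    unfolding x(2) by (rule proj.subgroup_img_is_subgroup) (use x subgroup_centralizer in blast)
  show "D \<subseteq> carrier (G Mod Z)" "\<one>\<^bsub>G Mod Z\<^esub> \<in> D"
    "\<And>U V. U \<in> D \<Longrightarrow> V \<in> D \<Longrightarrow> U \<otimes>\<^bsub>G Mod Z\<^esub> V \<in> D"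
    "\<And>U. U \<in> D \<Longrightarrow> inv\<^bsub>G Mod Z\<^esub> U \<in> D"
    using subgroup.subset[OF sub] subgroup.one_closed[OF sub] subgroup.m_closed[OF sub]
      subgroup.m_inv_closed[OF sub] by blast+
  have "\<pi> x \<noteq> Z" using x \<pi>_one_iff by blast
  then show "D \<noteq> {\<one>\<^bsub>G Mod Z\<^esub>}" using xC x by auto
  obtain y where "y \<in> carrier G" "y \<notin> C x" using x unfolding group_center_def group_centralizer_def by force
  then have "\<pi> y \<notin> D" "\<pi> y \<in> carrier (G Mod Z)"
    using x \<pi>_mem_centralizer by (auto simp: carrier_quotient)
  then show "D \<noteq> carrier (G Mod Z)" by blast
  show "conjugate (G Mod Z) g D \<in> centralizer_images" if g: "g \<in> carrier (G Mod Z)" for g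
  proof -
    obtain h where h: "h \<in> carrier G" "g = \<pi> h" using g by (auto simp: carrier_quotient)
    have "conjugate (G Mod Z) g D = \<pi> ` C (h \<otimes> x \<otimes> inv h)"
      unfolding h(2) x(2) using h x centralizer_conjugate \<pi>_conjugate
      by (metis DiffD1 group_centralizer_iff subsetI)
    moreover have "h \<otimes> x \<otimes> inv h \<notin> Z"
    proof
      assume "h \<otimes> x \<otimes> inv h \<in> Z"
      then have "inv h \<otimes> (h \<otimes> x \<otimes> inv h) \<otimes> h \<in> Z"
        using normal.inv_op_closed1[OF center_normal h(1)] by simp
      moreover have "inv h \<otimes> (h \<otimes> x \<otimes> inv h) \<otimes> h = (inv h \<otimes> h) \<otimes> x \<otimes> (inv h \<otimes> h)"
        using h x by (simp only: m_assoc m_closed inv_closed DiffD1)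
      ultimately show False using h x by simp
    qed
    ultimately show ?thesis unfolding centralizer_images_iff using h x by blast
  qed
  show "U \<otimes>\<^bsub>G Mod Z\<^esub> V = V \<otimes>\<^bsub>G Mod Z\<^esub> U" if UV: "U \<in> D" "V \<in> D" for U V
  proof -
    obtain a b where ab: "a \<in> C x" "b \<in> C x" "U = \<pi> a" "V = \<pi> b" using UV x by auto
    have "a \<otimes> b = b \<otimes> a" using abelian_centralizer[OF x(1) ab(1,2)] .
    then show ?thesis using ab by (metis group_centralizer_iff proj.hom_mult)
  qed
  show "D = E" if E: "E \<in> centralizer_images" and U: "U \<in> D" "U \<in> E" "U \<noteq> \<one>\<^bsub>G Mod Z\<^esub>" for E U
  proof -
    obtain g where g: "g \<in> C x" "U = \<pi> g" using U x by auto
    then have "g \<in> carrier G - Z" using U(3) \<pi>_one_iff by (auto simp: group_centralizer_iff)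
    then show ?thesis using class_eq[OF D] class_eq[OF E] U g by metis
  qed
next
  fix U assume "U \<in> carrier (G Mod Z)"
  then obtain g where g: "g \<in> carrier G" "U = \<pi> g" by (auto simp: carrier_quotient)
  show "\<exists>D\<in>centralizer_images. U \<in> D"
  proof (cases "g \<in> Z")
    case False
    then have "\<pi> ` C g \<in> centralizer_images" using g centralizer_images_iff by blast
    moreover have "U \<in> \<pi> ` C g" using g by (auto simp: group_centralizer_iff)
    ultimately show ?thesis by blast
  next
    case True
    \<comment> \<open>The identity lies in every member, so covering it amounts to the existence of
      one non-central element.\<close>
    obtain x where x: "x \<in> carrier G - Z" using nonabelian unfolding group_center_def by blast
    then have "\<pi> ` C x \<in> centralizer_images" using centralizer_images_iff by blast
    moreover have "U \<in> \<pi> ` C x" using True x g center_subset_centralizer by blast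
    ultimately show ?thesis by blast
  qed
qed

lemma commute_iff_class:
  assumes "x \<in> carrier G - Z" "y \<in> carrier G - Z"
  shows "x \<otimes> y = y \<otimes> x \<longleftrightarrow> (\<exists>D\<in>centralizer_images. \<pi> x \<in> D \<and> \<pi> y \<in> D)"
proof
  assume "x \<otimes> y = y \<otimes> x"
  then have "x \<in> C x" "y \<in> C x" using assms by (auto simp: group_centralizer_iff)
  then show "\<exists>D\<in>centralizer_images. \<pi> x \<in> D \<and> \<pi> y \<in> D" using centralizer_images_iff assms(1) by blast
next
  assume "\<exists>D\<in>centralizer_images. \<pi> x \<in> D \<and> \<pi> y \<in> D"
  then obtain D where D: "D \<in> centralizer_images" "\<pi> x \<in> D" "\<pi> y \<in> D" by blast
  then have "\<pi> y \<in> \<pi> ` C x" using class_eq[OF D(1) assms(1)] by blast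
  then have "y \<in> C x" using \<pi>_mem_centralizer assms by blast
  then show "x \<otimes> y = y \<otimes> x" by (simp add: group_centralizer_iff)
qed

text \<open>Centralizers contain the centre and are therefore determined by their images. The one
  left out is the whole group, the centralizer of the identity.\<close>

lemma card_centralizer_images: "card centralizer_images = card (Cent G) - 1"
proof -
  have "inj_on (\<lambda>c. \<pi> ` c) (Cent G)"
  proof (rule inj_onI)
    fix c d assume cd: "c \<in> Cent G" "d \<in> Cent G" "\<pi> ` c = \<pi> ` d"
    then obtain x y where xy: "x \<in> carrier G" "y \<in> carrier G" "c = C x" "d = C y" by (auto simp: Cent_def)
    have "g \<in> c \<longleftrightarrow> g \<in> d" if "g \<in> carrier G" for g
      using \<pi>_mem_centralizer[OF xy(1) that] \<pi>_mem_centralizer[OF xy(2) that] cd(3) xy by simp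
    then show "c = d" using xy by (auto simp: group_centralizer_iff)
  qed
  then have "card centralizer_images = card (Cent G - {carrier G})"
    unfolding centralizer_images_def by (intro card_image) (auto intro: inj_on_subset)
  moreover have "carrier G \<in> Cent G"
    using centralizer_eq_carrier_iff[OF one_closed] subgroup.one_closed[OF subgroup_center]
    by (metis Cent_def image_eqI one_closed)
  ultimately show ?thesis using finite_Cent by simp
qed

section \<open>Centralizers inside a non-abelian subgroup\<close>

context
  fixes H
  assumes H: "subgroup H G" and H_nonabelian: "\<not> comm_group (G\<lparr>carrier := H\<rparr>)"
begin

lemma nonabelian_subgroup:
  obtains a b where "a \<in> H" "b \<in> H" "a \<otimes> b \<noteq> b \<otimes> a"
proof -
  interpret H: group "G\<lparr>carrier := H\<rparr>" using H by (rule subgroup_imp_group)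
  show ?thesis using that H.group_comm_groupI H_nonabelian by auto
qed

lemma H_carrier: "h \<in> H \<Longrightarrow> h \<in> carrier G"
  using subgroup.mem_carrier[OF H] .

lemma centralizer_subgroup:
  "group_centralizer (G\<lparr>carrier := H\<rparr>) h = C h \<inter> H"
  using H_carrier by (auto simp: group_centralizer_def)

lemma subgroup_image: "subgroup (\<pi> ` H) (G Mod Z)"
  by (rule proj.subgroup_img_is_subgroup[OF H])

lemma meeting_subgroup_iff: "D \<in> meeting (\<pi> ` H) \<longleftrightarrow> (\<exists>h\<in>H - Z. D = \<pi> ` C h)"
proof
  assume "D \<in> meeting (\<pi> ` H)"
  then obtain h where h: "D \<in> centralizer_images" "h \<in> H" "\<pi> h \<in> D" "\<pi> h \<noteq> Z" unfolding meeting_def by auto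
  then have "h \<in> carrier G - Z" using \<pi>_one_iff H_carrier by blast
  then show "\<exists>h\<in>H - Z. D = \<pi> ` C h" using class_eq h by blast
next
  assume "\<exists>h\<in>H - Z. D = \<pi> ` C h"
  then obtain h where h: "h \<in> H - Z" "D = \<pi> ` C h" by blast
  then have "h \<in> carrier G - Z" "\<pi> h \<noteq> Z" "h \<in> C h"
    using \<pi>_one_iff H_carrier by (auto simp: group_centralizer_iff)
  then show "D \<in> meeting (\<pi> ` H)" using h centralizer_images_iff unfolding meeting_def by auto
qed

text \<open>The summand 1 is \<open>H\<close> itself, the centralizer in \<open>H\<close> of its
  elements in \<open>Z\<close>. It differs from all the others because these are abelian and
  \<open>H\<close> is not.\<close>

lemma card_Cent_subgroup: "card (Cent (G\<lparr>carrier := H\<rparr>)) = card (meeting (\<pi> ` H)) + 1"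
proof -
  define F where "F D = {h \<in> H. \<pi> h \<in> D}" for D
  have F: "F (\<pi> ` C h) = C h \<inter> H" if "h \<in> H" for h
    unfolding F_def using \<pi>_mem_centralizer H_carrier that by auto
  have notH: "C h \<inter> H \<noteq> H" if "h \<in> H - Z" for h
    using nonabelian_subgroup abelian_centralizer[of h] that H_carrier by (metis DiffD1 DiffD2 DiffI IntD1)
  have "Cent (G\<lparr>carrier := H\<rparr>) = insert H (F ` meeting (\<pi> ` H))"
  proof (intro equalityI subsetI)
    fix c assume "c \<in> Cent (G\<lparr>carrier := H\<rparr>)"
    then obtain h where h: "h \<in> H" "c = C h \<inter> H" unfolding Cent_def centralizer_subgroup by auto
    show "c \<in> insert H (F ` meeting (\<pi> ` H))"
    proof (cases "h \<in> Z")
      case True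
      then have "c = H" using h centralizer_eq_carrier_iff[OF H_carrier[OF h(1)]] H_carrier by auto
      then show ?thesis by simp
    next
      case False
      then show ?thesis using h F meeting_subgroup_iff by blast
    qed
  next
    fix c assume "c \<in> insert H (F ` meeting (\<pi> ` H))"
    then consider "c = H" | D where "D \<in> meeting (\<pi> ` H)" "c = F D" by auto
    then consider "c = H" | h where "h \<in> H" "c = C h \<inter> H" using F meeting_subgroup_iff by (metis DiffD1)
    then show "c \<in> Cent (G\<lparr>carrier := H\<rparr>)"
    proof cases
      case 1
      have "C \<one> \<inter> H = H" using H_carrier by (auto simp: group_centralizer_iff)
      then show ?thesis using 1 subgroup.one_closed[OF H] unfolding Cent_def centralizer_subgroup by force
    next
      case 2
      then show ?thesis unfolding Cent_def centralizer_subgroup by auto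
    qed
  qed
  moreover have "F D \<noteq> H" if D: "D \<in> meeting (\<pi> ` H)" for D
  proof -
    obtain h where h: "h \<in> H - Z" "D = \<pi> ` C h" using D unfolding meeting_subgroup_iff ..
    then show ?thesis using F[of h] notH[OF h(1)] by auto
  qed
  then have "H \<notin> F ` meeting (\<pi> ` H)" by auto
  moreover have "inj_on F (meeting (\<pi> ` H))"
  proof (rule inj_onI)
    fix D E assume DE: "D \<in> meeting (\<pi> ` H)" "E \<in> meeting (\<pi> ` H)" "F D = F E"
    then obtain h where h: "h \<in> H - Z" "D = \<pi> ` C h" unfolding meeting_subgroup_iff by blast
    then have hc: "h \<in> carrier G - Z" using H_carrier by auto
    have "h \<in> F D" using h hc by (auto simp: F_def group_centralizer_iff)
    then have "\<pi> h \<in> E" using DE(3) by (auto simp: F_def)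
    then show "D = E" using class_eq[of E, OF _ hc] h DE(2) by (simp add: meeting_def)
  qed
  moreover have "finite (meeting (\<pi> ` H))" using fin by (simp add: meeting_def)
  ultimately show ?thesis by (simp add: card_image)
qed

lemma subgroup_not_in_class: "D \<in> centralizer_images \<Longrightarrow> \<not> \<pi> ` H \<subseteq> D"
proof
  assume D: "D \<in> centralizer_images" "\<pi> ` H \<subseteq> D"
  obtain x where x: "x \<in> carrier G - Z" "D = \<pi> ` C x" using D(1) unfolding centralizer_images_iff ..
  then have "H \<subseteq> C x" using D(2) \<pi>_mem_centralizer H_carrier by blast
  then show False using abelian_centralizer[OF x(1)] nonabelian_subgroup by (metis subsetD)
qed

end

end

section \<open>Isoclinism and groups of prime order\<close>

lemma (in group) prime_order_iso_integer_mod_group: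
  assumes "Factorial_Ring.prime p" "card (carrier G) = p"
  shows "G \<cong> integer_mod_group p"
proof -
  have p: "p > 1" using assms(1) prime_gt_1_nat by blast
  have fin: "finite (carrier G)" using assms(2) p by (intro card_ge_0_finite) simp
  have "\<not> carrier G \<subseteq> {\<one>}" using assms(2) p card_mono[of "{\<one>}" "carrier G"] by auto
  then obtain x where x: "x \<in> carrier G" "x \<noteq> \<one>" by blast
  have "x [^] p = \<one>" using pow_order_eq_1[OF x(1)] assms(2) by (simp add: order_def)
  then have "ord x dvd p" using pow_eq_id[OF x(1)] by simp
  moreover have "ord x \<noteq> 1" using ord_eq_1[OF x(1)] x(2) by simp
  ultimately have ord: "ord x = p" using assms(1) prime_nat_iff by blast
  have eq: "x [^] (i::int) = x [^] j \<longleftrightarrow> int p dvd j - i" for i j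
    using int_pow_eq[OF x(1), of i j] ord by simp
  have carr: "carrier (integer_mod_group p) = {0..<int p}"
    using p by (simp add: carrier_integer_mod_group)
  have "(\<lambda>i::int. x [^] i) \<in> hom (integer_mod_group p) G"
  proof (rule homI)
    fix i j :: int
    have "x [^] ((i + j) mod int p) = x [^] (i + j)"
      unfolding eq by (metis dvd_minus_mod)
    then show "x [^] (i \<otimes>\<^bsub>integer_mod_group p\<^esub> j) = x [^] i \<otimes> x [^] j"
      using x by (simp add: int_pow_mult)
  qed (use x in simp)
  moreover have "bij_betw (\<lambda>i::int. x [^] i) {0..<int p} (carrier G)"
  proof -
    have inj: "inj_on (\<lambda>i::int. x [^] i) {0..<int p}"
    proof (rule inj_onI)
      fix i j assume ij: "i \<in> {0..<int p}" "j \<in> {0..<int p}" "x [^] i = x [^] j"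
      then have "int p dvd j - i" by (simp add: eq)
      then have "j mod int p = i mod int p" by (simp add: mod_eq_dvd_iff)
      then show "i = j" using ij by simp
    qed
    moreover have "(\<lambda>i::int. x [^] i) ` {0..<int p} = carrier G"
      by (rule card_subset_eq[OF fin]) (use x assms(2) card_image[OF inj] in auto)
    ultimately show ?thesis by (simp add: bij_betw_def)
  qed
  ultimately have "integer_mod_group p \<cong> G" unfolding is_iso_def iso_def carr by blast
  then show ?thesis using group.iso_sym[OF group_integer_mod_group] by blast
qed

lemma (in group) group_commutator_center_mult:
  assumes z: "z \<in> group_center G" "z' \<in> group_center G" and g: "g \<in> carrier G" "h \<in> carrier G"
  shows "group_commutator G (z \<otimes> g) (z' \<otimes> h) = group_commutator G g h"
proof -
  have zc: "z \<in> carrier G" "z' \<in> carrier G" using z by (auto simp: group_center_def)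
  have *: "group_commutator G (u \<otimes> a) b = group_commutator G a b"
    if "u \<in> group_center G" "a \<in> carrier G" "b \<in> carrier G" for u a b
  proof -
    have u: "u \<in> carrier G" using that by (simp add: group_center_def)
    have "group_commutator G (u \<otimes> a) b = u \<otimes> (a \<otimes> b \<otimes> inv a) \<otimes> inv u \<otimes> inv b"
      unfolding group_commutator_def using u that(2,3) by (simp only: inv_mult_group m_assoc m_closed inv_closed)
    also have "\<dots> = (a \<otimes> b \<otimes> inv a) \<otimes> (u \<otimes> inv u) \<otimes> inv b"
      using center_commute[OF that(1), of "a \<otimes> b \<otimes> inv a"] u that(2,3)
      by (simp only: m_assoc m_closed inv_closed)
    finally show ?thesis using u that by (simp add: group_commutator_def)
  qed
  have inv_comm: "group_commutator G a b = inv (group_commutator G b a)"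
    if "a \<in> carrier G" "b \<in> carrier G" for a b
    using that by (simp add: group_commutator_def inv_mult_group m_assoc)
  have "group_commutator G (z \<otimes> g) (z' \<otimes> h) = group_commutator G g (z' \<otimes> h)"
    using * z g zc by simp
  also have "\<dots> = inv (group_commutator G (z' \<otimes> h) g)" by (rule inv_comm) (use g zc in simp_all)
  also have "\<dots> = inv (group_commutator G h g)" using * z g by simp
  also have "\<dots> = group_commutator G g h" by (rule inv_comm[symmetric]) (use g in simp_all)
  finally show ?thesis .
qed

text \<open>Every coset of the centre has a representative in \<open>H\<close>, so intersecting
  cosets with \<open>H\<close> identifies the central quotients. Commutators ignore central factors,
  hence the commutator subgroups are equal and the second isomorphism is the identity.\<close>

lemma (in group) isoclinic_subgroup:
  assumes H: "subgroup H G"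
    and ZH: "\<And>g. g \<in> carrier G \<Longrightarrow> \<exists>z\<in>group_center G. \<exists>h\<in>H. g = z \<otimes> h"
  shows "isoclinic G (G\<lparr>carrier := H\<rparr>)"
proof -
  let ?Z = "group_center G" and ?H = "G\<lparr>carrier := H\<rparr>"
  interpret H: group ?H using H by (rule subgroup_imp_group)
  have Hc: "h \<in> carrier G" if "h \<in> H" for h using subgroup.mem_carrier[OF H that] .
  have Zc: "z \<in> carrier G" if "z \<in> ?Z" for z using that by (simp add: group_center_def)
  have ZHeq: "group_center ?H = H \<inter> ?Z"
  proof -
    have "z \<in> ?Z" if z: "z \<in> H" "\<forall>h\<in>H. z \<otimes> h = h \<otimes> z" for z
    proof -
      have "z \<otimes> g = g \<otimes> z" if g: "g \<in> carrier G" for g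
      proof -
        obtain w h where wh: "w \<in> ?Z" "h \<in> H" "g = w \<otimes> h" using ZH[OF g] by blast
        have "z \<in> group_centralizer G w" using center_commute[OF wh(1) Hc[OF z(1)]] Hc[OF z(1)]
          by (simp add: group_centralizer_iff)
        then have "w \<in> group_centralizer G z" using centralizer_sym Zc[OF wh(1)] Hc[OF z(1)] by blast
        moreover have "h \<in> group_centralizer G z" using z(2) wh(2) Hc by (simp add: group_centralizer_iff)
        ultimately have "g \<in> group_centralizer G z"
          unfolding wh(3) using subgroup.m_closed[OF subgroup_centralizer[OF Hc[OF z(1)]]] by blast
        then show ?thesis by (simp add: group_centralizer_iff)
      qed
      then show ?thesis using Hc[OF z(1)] by (simp add: group_center_def)
    qed
    moreover have "z \<otimes> h = h \<otimes> z" if "z \<in> ?Z" "h \<in> H" for z h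
      using that Hc by (simp add: group_center_def)
    ultimately have "z \<in> H \<inter> ?Z \<longleftrightarrow> z \<in> H \<and> (\<forall>h\<in>H. z \<otimes> h = h \<otimes> z)" for z by blast
    then show ?thesis by (auto simp: group_center_def[of ?H])
  qed
  have ZHn: "group_center ?H \<lhd> ?H" by (rule H.center_normal)
  have coset_H: "group_center ?H #>\<^bsub>?H\<^esub> h = (?Z #> h) \<inter> H" if h: "h \<in> H" for h
  proof -
    have "z \<in> H" if "z \<in> ?Z" "z \<otimes> h \<in> H" for z
      using subgroup_mult_cancel(2)[OF H Zc[OF that(1)] h] that(2) by simp
    moreover have "z \<otimes> h \<in> H" if "z \<in> H" for z using subgroup.m_closed[OF H that h] .
    ultimately show ?thesis unfolding ZHeq r_coset_def by auto
  qed
  have coset_rep: "\<exists>h\<in>H. \<exists>z\<in>?Z. g = z \<otimes> h \<and> ?Z #> g = ?Z #> h" if g: "g \<in> carrier G" for g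
  proof -
    obtain z h where zh: "z \<in> ?Z" "h \<in> H" "g = z \<otimes> h" using ZH[OF g] by blast
    have "g \<in> ?Z #> h" using zh by (auto simp: r_coset_def)
    then have "?Z #> g = ?Z #> h" using repr_independence[OF _ Hc[OF zh(2)] subgroup_center] by simp
    then show ?thesis using zh by blast
  qed
  have coset_eq: "\<exists>z\<in>?Z. h' = z \<otimes> h" if h: "h \<in> H" "h' \<in> H" and eq: "(?Z #> h) \<inter> H = (?Z #> h') \<inter> H" for h h'
  proof -
    have "h' \<in> ?Z #> h" using rcos_self[OF Hc[OF h(2)] subgroup_center] h(2) eq by blast
    then show ?thesis by (auto simp: r_coset_def)
  qed
  let ?\<phi> = "\<lambda>U. U \<inter> H"
  have "?\<phi> \<in> iso (G Mod ?Z) (?H Mod group_center ?H)"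
  proof (rule isoI)
    show "?\<phi> \<in> hom (G Mod ?Z) (?H Mod group_center ?H)"
    proof (rule homI)
      fix U assume "U \<in> carrier (G Mod ?Z)"
      then obtain h where "h \<in> H" "U = ?Z #> h" using coset_rep by (auto simp: carrier_FactGroup)
      then show "U \<inter> H \<in> carrier (?H Mod group_center ?H)" using coset_H by (auto simp: carrier_FactGroup)
    next
      fix U V assume "U \<in> carrier (G Mod ?Z)" "V \<in> carrier (G Mod ?Z)"
      then obtain h k where hk: "h \<in> H" "U = ?Z #> h" "k \<in> H" "V = ?Z #> k"
        using coset_rep by (auto simp: carrier_FactGroup) metis
      have "U \<otimes>\<^bsub>G Mod ?Z\<^esub> V = ?Z #> (h \<otimes> k)"
        using normal.rcos_sum[OF center_normal] hk Hc by simp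
      then have "(U \<otimes>\<^bsub>G Mod ?Z\<^esub> V) \<inter> H = group_center ?H #>\<^bsub>?H\<^esub> (h \<otimes> k)"
        using coset_H subgroup.m_closed[OF H hk(1,3)] by simp
      also have "\<dots> = (group_center ?H #>\<^bsub>?H\<^esub> h) <#>\<^bsub>?H\<^esub> (group_center ?H #>\<^bsub>?H\<^esub> k)"
        using normal.rcos_sum[OF ZHn, of h k] hk by simp
      finally show "(U \<otimes>\<^bsub>G Mod ?Z\<^esub> V) \<inter> H = (U \<inter> H) \<otimes>\<^bsub>?H Mod group_center ?H\<^esub> (V \<inter> H)"
        using coset_H hk by simp
    qed
    show "bij_betw ?\<phi> (carrier (G Mod ?Z)) (carrier (?H Mod group_center ?H))"
      unfolding bij_betw_def
    proof
      show "inj_on ?\<phi> (carrier (G Mod ?Z))"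
      proof (rule inj_onI)
        fix U V assume UV: "U \<in> carrier (G Mod ?Z)" "V \<in> carrier (G Mod ?Z)" "U \<inter> H = V \<inter> H"
        then obtain h k where hk: "h \<in> H" "U = ?Z #> h" "k \<in> H" "V = ?Z #> k"
          using coset_rep by (auto simp: carrier_FactGroup) metis
        then obtain z where "z \<in> ?Z" "k = z \<otimes> h" using coset_eq UV(3) by blast
        then have "k \<in> ?Z #> h" by (auto simp: r_coset_def)
        then show "U = V" using repr_independence[OF _ Hc[OF hk(1)] subgroup_center] hk by simp
      qed
      show "?\<phi> ` carrier (G Mod ?Z) = carrier (?H Mod group_center ?H)"
      proof (intro equalityI subsetI)
        fix V assume "V \<in> ?\<phi> ` carrier (G Mod ?Z)"
        then obtain g where "g \<in> carrier G" "V = (?Z #> g) \<inter> H" by (auto simp: carrier_FactGroup)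
        then obtain h where "h \<in> H" "V = (?Z #> h) \<inter> H" using coset_rep by metis
        then show "V \<in> carrier (?H Mod group_center ?H)" using coset_H by (auto simp: carrier_FactGroup)
      next
        fix V assume "V \<in> carrier (?H Mod group_center ?H)"
        then obtain h where "h \<in> H" "V = (?Z #> h) \<inter> H" using coset_H by (auto simp: carrier_FactGroup)
        then show "V \<in> ?\<phi> ` carrier (G Mod ?Z)" using Hc by (auto simp: carrier_FactGroup)
      qed
    qed
  qed
  moreover have der: "derived G (carrier G) = derived G H"
  proof -
    have "derived_set G (carrier G) = derived_set G H"
    proof (intro equalityI subsetI)
      fix w assume "w \<in> derived_set G (carrier G)"
      then obtain g1 g2 where g: "g1 \<in> carrier G" "g2 \<in> carrier G" "w = group_commutator G g1 g2"
        by (auto simp: group_commutator_def)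
      obtain z1 h1 where 1: "z1 \<in> ?Z" "h1 \<in> H" "g1 = z1 \<otimes> h1" using ZH[OF g(1)] by blast
      obtain z2 h2 where 2: "z2 \<in> ?Z" "h2 \<in> H" "g2 = z2 \<otimes> h2" using ZH[OF g(2)] by blast
      have "w = group_commutator G h1 h2"
        using g(3) group_commutator_center_mult[OF 1(1) 2(1) Hc[OF 1(2)] Hc[OF 2(2)]] 1 2 by simp
      then show "w \<in> derived_set G H" using 1 2 by (auto simp: group_commutator_def)
    qed (use Hc in auto)
    then show ?thesis by (simp add: derived_def)
  qed
  have "commutator_subgroup ?H = commutator_subgroup G"
    using der derived_consistent[OF subset_refl H] by (simp add: commutator_subgroup_def)
  then have "(\<lambda>x. x) \<in> iso (commutator_subgroup G) (commutator_subgroup ?H)"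
    by (simp add: iso_set_refl)
  moreover have "group_commutator G g1 g2 = group_commutator ?H h1 h2"
    if g: "g1 \<in> carrier G" "g2 \<in> carrier G" and h: "h1 \<in> carrier ?H" "h2 \<in> carrier ?H"
      and eq: "(?Z #> g1) \<inter> H = group_center ?H #>\<^bsub>?H\<^esub> h1" "(?Z #> g2) \<inter> H = group_center ?H #>\<^bsub>?H\<^esub> h2"
    for g1 g2 h1 h2
  proof -
    have hH: "h1 \<in> H" "h2 \<in> H" using h by auto
    have lift: "\<exists>z\<in>?Z. g = z \<otimes> h" if "g \<in> carrier G" "h \<in> H" "(?Z #> g) \<inter> H = group_center ?H #>\<^bsub>?H\<^esub> h" for g h
    proof -
      obtain k z where k: "k \<in> H" "z \<in> ?Z" "g = z \<otimes> k" "?Z #> g = ?Z #> k" using coset_rep \<open>g \<in> carrier G\<close> by blast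
      then have "\<exists>w\<in>?Z. k = w \<otimes> h" using coset_eq[OF that(2) k(1)] that(3) coset_H[OF that(2)] by simp
      then obtain w where "w \<in> ?Z" "k = w \<otimes> h" by blast
      then have "g = (z \<otimes> w) \<otimes> h" using k Zc Hc[OF that(2)] by (simp add: m_assoc)
      then show ?thesis using subgroup.m_closed[OF subgroup_center k(2) \<open>w \<in> ?Z\<close>] by blast
    qed
    obtain z1 z2 where "z1 \<in> ?Z" "g1 = z1 \<otimes> h1" "z2 \<in> ?Z" "g2 = z2 \<otimes> h2"
      using lift[OF g(1) hH(1) eq(1)] lift[OF g(2) hH(2) eq(2)] by blast
    then have "group_commutator G g1 g2 = group_commutator G h1 h2"
      using group_commutator_center_mult Hc hH by simp
    then show ?thesis using m_inv_consistent[OF H] hH by (simp add: group_commutator_def)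
  qed
  ultimately show ?thesis unfolding isoclinic_def by (intro bexI[of _ ?\<phi>] bexI[of _ "\<lambda>x. x"]) simp_all
qed

section \<open>The commutator subgroup\<close>

context ca_group begin

lemma subgroup_C: "x \<in> carrier G \<Longrightarrow> subgroup (C x) G"
  by (rule subgroup_centralizer)

text \<open>Here \<open>A = C(a)\<close> is a normal abelian subgroup and \<open>G = A C(c)\<close>; the commutator subgroup turns out
  to be the image of \<open>u \<mapsto> [u, c]\<close> on \<open>A\<close>, a homomorphism with kernel \<open>Z\<close>.\<close>
context
  fixes a c
  assumes a: "a \<in> carrier G - Z" and c: "c \<in> carrier G - Z" and ne: "\<pi> ` C a \<noteq> \<pi> ` C c"
    and full: "card (\<pi> ` C a) = card centralizer_images - 1" and pr: "Factorial_Ring.prime (card (\<pi> ` C a))"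
begin

abbreviation A where "A \<equiv> C a"
abbreviation p where "p \<equiv> card (\<pi> ` C a)"

definition comm_with where "comm_with v u = u \<otimes> v \<otimes> inv u \<otimes> inv v"
definition B where "B = comm_with c ` A"

lemma D: "\<pi> ` A \<in> centralizer_images" and E: "\<pi> ` C c \<in> centralizer_images"
  using a c centralizer_images_iff by blast+

lemma A_carrier: "u \<in> A \<Longrightarrow> u \<in> carrier G" and Cc_carrier: "u \<in> C c \<Longrightarrow> u \<in> carrier G"
  by (simp_all add: group_centralizer_iff)

lemma A_subgroup: "subgroup A G" and Cc_subgroup: "subgroup (C c) G"
  using subgroup_C a c by auto

lemmas A_mult = subgroup.m_closed[OF A_subgroup]
lemmas A_inv = subgroup.m_inv_closed[OF A_subgroup]

lemma A_comm: "u \<in> A \<Longrightarrow> v \<in> A \<Longrightarrow> u \<otimes> v = v \<otimes> u"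
  using abelian_centralizer[OF a] .

lemma Cc_comm: "u \<in> C c \<Longrightarrow> v \<in> C c \<Longrightarrow> u \<otimes> v = v \<otimes> u"
  using abelian_centralizer[OF c] .

lemma A_conj:
  assumes g: "g \<in> carrier G" and u: "u \<in> A"
  shows "g \<otimes> u \<otimes> inv g \<in> A"
proof -
  have "conjugate (G Mod Z) (\<pi> g) (\<pi> ` A) = \<pi> ` A"
    using maximal_member_normal[OF D full] g by (simp add: carrier_quotient)
  then have "\<pi> ` conjugate G g A = \<pi> ` A"
    using \<pi>_conjugate[OF g] A_carrier by (metis subsetI)
  moreover have "g \<otimes> u \<otimes> inv g \<in> conjugate G g A" using u unfolding conjugate_def by blast
  ultimately have "\<pi> (g \<otimes> u \<otimes> inv g) \<in> \<pi> ` A" by blast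
  moreover have "a \<in> carrier G" "g \<otimes> u \<otimes> inv g \<in> carrier G" using a g A_carrier[OF u] by auto
  ultimately show ?thesis using \<pi>_mem_centralizer by blast
qed

lemma factorization:
  assumes g: "g \<in> carrier G"
  obtains u v where "u \<in> A" "v \<in> C c" "g = u \<otimes> v"
proof -
  \<comment> \<open>The product lemma puts the factor from the maximal member last; factoring
    \<open>inv g\<close> and inverting reverses the order.\<close>
  have "\<pi> (inv g) \<in> carrier (G Mod Z)" unfolding carrier_quotient using g by blast
  then obtain U V where UV: "U \<in> \<pi> ` C c" "V \<in> \<pi> ` A" "\<pi> (inv g) = U \<otimes>\<^bsub>G Mod Z\<^esub> V"
    using maximal_member_product[OF D full E ne[symmetric], of "\<pi> (inv g)"] by auto
  then obtain v u where vu: "v \<in> C c" "u \<in> A" "\<pi> (inv g) = \<pi> v \<otimes>\<^bsub>G Mod Z\<^esub> \<pi> u" by blast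
  note cc = Cc_carrier[OF vu(1)] A_carrier[OF vu(2)]
  have "\<pi> (v \<otimes> u) = \<pi> (inv g)" using vu(3) cc proj.hom_mult by simp
  then obtain z where z: "z \<in> Z" "inv g = z \<otimes> (v \<otimes> u)"
    using \<pi>_eq_iff[of "v \<otimes> u" "inv g"] cc g by auto
  have zc: "z \<in> carrier G" using z by (simp add: group_center_def)
  have zv: "z \<otimes> v \<in> C c"
    using z(1) vu(1) center_subset_centralizer[of c] c subgroup.m_closed[OF Cc_subgroup] by blast
  have "inv g = (z \<otimes> v) \<otimes> u" using z(2) zc cc by (simp add: m_assoc)
  then have "g = inv ((z \<otimes> v) \<otimes> u)" using g by (metis inv_inv)
  then have "g = inv u \<otimes> inv (z \<otimes> v)" using zc cc by (simp add: inv_mult_group)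
  then show ?thesis using that A_inv[OF vu(2)] subgroup.m_inv_closed[OF Cc_subgroup zv] by blast
qed

lemma comm_with_alt:
  assumes "v \<in> carrier G" "u \<in> A"
  shows "comm_with v u = u \<otimes> inv (v \<otimes> u \<otimes> inv v)"
  using assms A_carrier by (simp add: comm_with_def inv_mult_group m_assoc)

lemma comm_with_mem: "v \<in> carrier G \<Longrightarrow> u \<in> A \<Longrightarrow> comm_with v u \<in> A"
  using comm_with_alt A_conj A_mult A_inv by simp

lemma conj_mult:
  assumes "g \<in> carrier G" "u \<in> carrier G" "v \<in> carrier G"
  shows "g \<otimes> (u \<otimes> v) \<otimes> inv g = (g \<otimes> u \<otimes> inv g) \<otimes> (g \<otimes> v \<otimes> inv g)"
proof -
  have "(g \<otimes> u \<otimes> inv g) \<otimes> (g \<otimes> v \<otimes> inv g) = g \<otimes> u \<otimes> (inv g \<otimes> g) \<otimes> v \<otimes> inv g"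
    using assms by (simp only: m_assoc m_closed inv_closed)
  then show ?thesis using assms by (simp add: m_assoc)
qed

lemma conj_inv:
  assumes "g \<in> carrier G" "u \<in> carrier G"
  shows "g \<otimes> inv u \<otimes> inv g = inv (g \<otimes> u \<otimes> inv g)"
  using assms by (simp add: inv_mult_group m_assoc)

text \<open>Holds because \<open>A\<close> is abelian and invariant under conjugation by
  \<open>v\<close>.\<close>

lemma comm_with_mult:
  assumes "v \<in> carrier G" "u \<in> A" "w \<in> A"
  shows "comm_with v (u \<otimes> w) = comm_with v u \<otimes> comm_with v w"
proof -
  let ?s = "\<lambda>x. v \<otimes> x \<otimes> inv v"
  have s: "?s u \<in> A" "?s w \<in> A" using A_conj assms by auto
  note cc = A_carrier[OF assms(2)] A_carrier[OF assms(3)] A_carrier[OF s(1)] A_carrier[OF s(2)]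
  have "comm_with v (u \<otimes> w) = u \<otimes> w \<otimes> inv (?s u \<otimes> ?s w)"
    using comm_with_alt[OF assms(1) A_mult[OF assms(2,3)]] conj_mult[OF assms(1) cc(1,2)] by simp
  also have "\<dots> = u \<otimes> (w \<otimes> inv (?s w)) \<otimes> inv (?s u)"
    using cc by (simp add: inv_mult_group m_assoc del: inv_closed)
  also have "\<dots> = u \<otimes> (inv (?s u) \<otimes> (w \<otimes> inv (?s w)))"
    using cc A_comm[OF A_mult[OF assms(3) A_inv[OF s(2)]] A_inv[OF s(1)]] by (simp only: m_assoc m_closed inv_closed)
  also have "\<dots> = comm_with v u \<otimes> comm_with v w"
    using comm_with_alt assms cc by (simp add: m_assoc del: inv_closed)
  finally show ?thesis .
qed

lemma comm_with_eq_one_iff: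
  assumes "v \<in> carrier G" "u \<in> carrier G"
  shows "comm_with v u = \<one> \<longleftrightarrow> u \<otimes> v = v \<otimes> u"
proof -
  have "comm_with v u = (u \<otimes> v) \<otimes> inv (v \<otimes> u)"
    using assms by (simp add: comm_with_def inv_mult_group m_assoc)
  then show ?thesis using assms by (metis inv_equality inv_inv inv_closed m_closed r_inv)
qed

lemma A_Int_Cc: "u \<in> A \<Longrightarrow> u \<otimes> c = c \<otimes> u \<longleftrightarrow> u \<in> Z"
proof
  assume u: "u \<in> A" "u \<otimes> c = c \<otimes> u"
  show "u \<in> Z"
  proof (rule ccontr)
    assume uZ: "u \<notin> Z"
    have "u \<in> C c" using u A_carrier by (simp add: group_centralizer_iff)
    then have "C u = C c" "C u = C a" using centralizer_eq a c u uZ by blast+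
    then show False using ne by simp
  qed
qed (use c in \<open>simp add: center_commute\<close>)

lemma comm_with_group_hom: "v \<in> carrier G \<Longrightarrow> group_hom (G\<lparr>carrier := A\<rparr>) G (comm_with v)"
  using subgroup_imp_group[OF A_subgroup] comm_with_mult comm_with_mem A_carrier
  by (auto simp: group_hom_def group_hom_axioms_def hom_def)

lemma B_subgroup: "subgroup B G"
  using group_hom.img_is_subgroup[OF comm_with_group_hom, of c] c by (simp add: B_def)

lemma B_subset: "B \<subseteq> A" using comm_with_mem c by (auto simp: B_def)

lemma comm_with_eq_iff:
  assumes u: "u \<in> A" "w \<in> A"
  shows "comm_with c u = comm_with c w \<longleftrightarrow> \<pi> u = \<pi> w"
proof -
  note cc = A_carrier[OF u(1)] A_carrier[OF u(2)]
  have cG: "c \<in> carrier G" using c by simp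
  interpret f: group_hom "G\<lparr>carrier := A\<rparr>" G "comm_with c" by (rule comm_with_group_hom[OF cG])
  have i: "comm_with c (inv u) = inv (comm_with c u)"
    using f.hom_inv[of u] u m_inv_consistent[OF A_subgroup] by simp
  have "comm_with c u = comm_with c w \<longleftrightarrow> comm_with c w \<otimes> inv (comm_with c u) = \<one>"
    using comm_with_mem[OF cG] u A_carrier by (metis inv_closed inv_equality inv_inv r_inv)
  also have "\<dots> \<longleftrightarrow> comm_with c (w \<otimes> inv u) = \<one>"
    using comm_with_mult[OF cG u(2) A_inv[OF u(1)]] i by simp
  also have "\<dots> \<longleftrightarrow> w \<otimes> inv u \<in> Z"
    using comm_with_eq_one_iff[OF cG] A_Int_Cc A_mult[OF u(2) A_inv[OF u(1)]] A_carrier by metis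
  also have "\<dots> \<longleftrightarrow> \<pi> u = \<pi> w"
  proof
    assume "w \<otimes> inv u \<in> Z"
    moreover have "w = (w \<otimes> inv u) \<otimes> u" using cc by (simp add: m_assoc)
    ultimately show "\<pi> u = \<pi> w" using \<pi>_eq_iff[OF cc] by blast
  next
    assume "\<pi> u = \<pi> w"
    then obtain z where "z \<in> Z" "w = z \<otimes> u" using \<pi>_eq_iff[OF cc] by blast
    moreover from this have "z \<in> carrier G" by (simp add: group_center_def)
    ultimately show "w \<otimes> inv u \<in> Z" using cc by (simp add: m_assoc)
  qed
  finally show ?thesis .
qed

lemma card_B: "card B = p"
proof -
  \<comment> \<open>\<open>f\<close> inverts the injection that \<open>comm_with c\<close> induces
    on cosets of the centre; by \<open>comm_with_eq_iff\<close> its value does not depend on the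
    choice.\<close>
  define f where "f b = \<pi> (SOME u. u \<in> A \<and> comm_with c u = b)" for b
  have f: "f (comm_with c u) = \<pi> u" if u: "u \<in> A" for u
  proof -
    have "\<exists>w. w \<in> A \<and> comm_with c w = comm_with c u" using u by blast
    then show ?thesis unfolding f_def using comm_with_eq_iff u by (metis (mono_tags, lifting) someI_ex)
  qed
  have "bij_betw f B (\<pi> ` A)"
    unfolding bij_betw_def B_def inj_on_def using f comm_with_eq_iff by (auto simp: image_image)
  then show ?thesis by (rule bij_betw_same_card)
qed

lemma finite_B: "finite B"
  using card_B pr prime_gt_0_nat card_ge_0_finite by metis

lemma B_central_cases: "B \<inter> Z = {\<one>} \<or> B \<subseteq> Z"
proof -
  have s: "subgroup (B \<inter> Z) G" using subgroups_Inter_pair[OF B_subgroup subgroup_center] .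
  have "card (B \<inter> Z) dvd p" using card_subgroup_dvd[OF s B_subgroup] card_B by simp
  then consider "card (B \<inter> Z) = 1" | "card (B \<inter> Z) = card B" using pr card_B prime_nat_iff by metis
  then show ?thesis
  proof cases
    case 1
    then show ?thesis using subgroup.one_closed[OF s] by (metis card_1_singletonE singletonD)
  next
    case 2
    then have "B \<inter> Z = B" using finite_B by (intro card_subset_eq) auto
    then show ?thesis by blast
  qed
qed

text \<open>The commutator \<open>w\<close> of \<open>a\<close> and \<open>c\<close> is central and
  non-trivial, so moving \<open>a\<close> past \<open>c [^] n\<close> costs \<open>w [^] n\<close>.
  For \<open>n = ?k\<close> the power of \<open>c\<close> is central, whence
  \<open>w [^] ?k = \<one>\<close>. As also \<open>w [^] p = \<one>\<close>, the prime
  \<open>p\<close> divides \<open>?k\<close>, and no member is larger than \<open>p\<close>.\<close>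

lemma central_card:
  assumes "B \<subseteq> Z" shows "card (\<pi> ` C c) = p"
proof -
  let ?k = "card (\<pi> ` C c)"
  have cG: "c \<in> carrier G" and aA: "a \<in> A" using c a by (auto simp: group_centralizer_iff)
  define w where "w = comm_with c a"
  have w: "w \<in> B" using aA by (simp add: B_def w_def)
  have wZ: "w \<in> Z" using w assms by blast
  have wc: "w \<in> carrier G" using wZ by (simp add: group_center_def)
  have w1: "w \<noteq> \<one>"
    using comm_with_eq_one_iff[OF cG] A_Int_Cc[OF aA] a by (auto simp: w_def)
  have ac: "a \<otimes> c = w \<otimes> (c \<otimes> a)"
    using a cG by (simp add: w_def comm_with_def m_assoc flip: m_assoc[of "inv c" c a])
  have pow: "a \<otimes> c [^] n = w [^] n \<otimes> (c [^] n \<otimes> a)" for n :: nat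
  proof (induction n)
    case 0
    then show ?case using a by simp
  next
    case (Suc n)
    have aG: "a \<in> carrier G" using a by simp
    have "a \<otimes> c [^] Suc n = (a \<otimes> c [^] n) \<otimes> c" using aG cG by (simp add: m_assoc)
    also have "\<dots> = w [^] n \<otimes> c [^] n \<otimes> (a \<otimes> c)" using Suc aG cG wc by (simp add: m_assoc)
    also have "\<dots> = w [^] n \<otimes> (c [^] n \<otimes> w) \<otimes> c \<otimes> a" unfolding ac using aG cG wc by (simp add: m_assoc)
    also have "\<dots> = w [^] n \<otimes> (w \<otimes> c [^] n) \<otimes> c \<otimes> a"
      using center_commute[OF wZ, of "c [^] n"] cG by simp
    also have "\<dots> = w [^] Suc n \<otimes> (c [^] Suc n \<otimes> a)" using aG cG wc by (simp add: m_assoc)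
    finally show ?case .
  qed
  have "c \<in> C c" using cG by (simp add: group_centralizer_iff)
  then have "\<pi> c [^]\<^bsub>G Mod Z\<^esub> ?k = \<one>\<^bsub>G Mod Z\<^esub>"
    using Q.pow_card_subgroup[OF sub[OF E] finite_member[OF E]] by blast
  then have "\<pi> (c [^] ?k) = Z" using proj.hom_nat_pow[OF cG, of ?k] by simp
  then have "c [^] ?k \<in> Z" using \<pi>_one_iff cG by simp
  then have "c [^] ?k \<otimes> a = a \<otimes> c [^] ?k" using center_commute a by blast
  then have "\<one> \<otimes> (c [^] ?k \<otimes> a) = w [^] ?k \<otimes> (c [^] ?k \<otimes> a)" using pow[of ?k] a cG by simp
  then have "w [^] ?k = \<one>" using a cG wc by (metis DiffD1 nat_pow_closed m_closed one_closed r_cancel)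
  moreover have "w [^] p = \<one>" using pow_card_subgroup[OF B_subgroup finite_B w] card_B by simp
  ultimately have "\<not> coprime p ?k" using coprime_pow_eq_one[OF wc] w1 by blast
  then have "p dvd ?k" using pr prime_imp_coprime by blast
  moreover have "?k \<le> p" using card_member_le[OF E] full by simp
  moreover have "?k > 0" using card_member_ge[OF E] by simp
  ultimately show ?thesis by (simp add: dvd_imp_le le_antisym)
qed

text \<open>\<open>B\<close> is built from \<open>c\<close> alone; other elements of
  \<open>C c\<close> must give nothing new. If \<open>B\<close> meets the centre trivially, its
  image is all of that of \<open>A\<close>, so \<open>u\<close> may be replaced by a commutator
  [t,c]; since \<open>v\<close> and \<open>c\<close> commute, [[t,c],v] = [[t,v],c] lies in
  \<open>B\<close>. If \<open>B\<close> is central, commutators are multiplicative in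
  \<open>v\<close> as well.\<close>

lemma comm_with_mem_B:
  assumes v: "v \<in> C c" and u: "u \<in> A"
  shows "comm_with v u \<in> B"
  using B_central_cases
proof
  assume triv: "B \<inter> Z = {\<one>}"
  have Bc: "b \<in> carrier G" if "b \<in> B" for b using that B_subset A_carrier by blast
  have "inj_on \<pi> B"
  proof (rule inj_onI)
    fix x y assume xy: "x \<in> B" "y \<in> B" "\<pi> x = \<pi> y"
    then obtain z where z: "z \<in> Z" "y = z \<otimes> x" using \<pi>_eq_iff Bc by blast
    then have zc: "z \<in> carrier G" by (simp add: group_center_def)
    have "z \<in> B" using subgroup_mult_cancel(2)[OF B_subgroup zc xy(1)] xy(2) z(2) by simp
    then have "z = \<one>" using triv z(1) by blast
    then show "x = y" using z(2) Bc xy by simp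
  qed
  then have "card (\<pi> ` B) = p" using card_B by (simp add: card_image)
  then have "\<pi> ` B = \<pi> ` A"
    using B_subset finite_member[OF D] by (intro card_subset_eq) auto
  then obtain b where b: "b \<in> B" "\<pi> b = \<pi> u" using u by (metis imageE imageI)
  then obtain z where z: "z \<in> Z" "u = z \<otimes> b" using \<pi>_eq_iff Bc A_carrier u by blast
  obtain t where t: "t \<in> A" "b = comm_with c t" using b(1) by (auto simp: B_def)
  have vG: "v \<in> carrier G" and cG: "c \<in> carrier G" using v c Cc_carrier by auto
  have vZ: "\<one> \<otimes> v = v" "\<one> \<in> Z" using vG subgroup.one_closed[OF subgroup_center] by auto
  have bA: "b \<in> A" using b B_subset by blast
  have "comm_with v u = group_commutator G (z \<otimes> b) (\<one> \<otimes> v)" using z vZ by (simp add: comm_with_def group_commutator_def)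
  also have "\<dots> = comm_with v b"
    using group_commutator_center_mult[OF z(1) vZ(2) Bc[OF b(1)] vG] by (simp add: comm_with_def group_commutator_def)
  also have "\<dots> = b \<otimes> inv (v \<otimes> b \<otimes> inv v)" by (rule comm_with_alt[OF vG bA])
  also have "\<dots> = comm_with c (comm_with v t)"
  proof -
    let ?c = "c \<otimes> t \<otimes> inv c" and ?v = "v \<otimes> t \<otimes> inv v"
    let ?vc = "v \<otimes> ?c \<otimes> inv v"
    have m: "?c \<in> A" "?v \<in> A" "?vc \<in> A" using A_conj cG vG t(1) by auto
    note cc = A_carrier[OF t(1)] A_carrier[OF m(1)] A_carrier[OF m(2)] A_carrier[OF m(3)]
    have eq: "c \<otimes> ?v \<otimes> inv c = ?vc"
    proof -
      have "c \<otimes> ?v \<otimes> inv c = (c \<otimes> v) \<otimes> t \<otimes> inv (c \<otimes> v)" using cG vG cc by (simp add: inv_mult_group m_assoc)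
      also have "c \<otimes> v = v \<otimes> c" using v by (simp add: group_centralizer_iff)
      finally show ?thesis using cG vG cc by (simp add: inv_mult_group m_assoc)
    qed
    have b': "b = t \<otimes> inv ?c" using comm_with_alt[OF cG t(1)] t(2) by simp
    have "v \<otimes> b \<otimes> inv v = ?v \<otimes> inv ?vc"
      unfolding b' using conj_mult[OF vG cc(1)] conj_inv[OF vG cc(2)] cc by simp
    then have l: "b \<otimes> inv (v \<otimes> b \<otimes> inv v) = t \<otimes> inv ?c \<otimes> (?vc \<otimes> inv ?v)"
      using b' cc by (simp add: inv_mult_group del: inv_closed)
    have "c \<otimes> comm_with v t \<otimes> inv c = ?c \<otimes> inv ?vc"
      using comm_with_alt[OF vG t(1)] conj_mult[OF cG cc(1)] conj_inv[OF cG cc(3)] cc eq by simp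
    then have "comm_with c (comm_with v t) = comm_with v t \<otimes> inv (?c \<otimes> inv ?vc)"
      using comm_with_alt[OF cG comm_with_mem[OF vG t(1)]] by simp
    then have r: "comm_with c (comm_with v t) = t \<otimes> inv ?v \<otimes> (?vc \<otimes> inv ?c)"
      using comm_with_alt[OF vG t(1)] cc by (simp add: inv_mult_group del: inv_closed)
    have "inv ?c \<otimes> (?vc \<otimes> inv ?v) = inv ?v \<otimes> (?vc \<otimes> inv ?c)"
      using A_comm[OF A_inv[OF m(1)] A_mult[OF m(3) A_inv[OF m(2)]]]
        A_comm[OF A_mult[OF m(3) A_inv[OF m(1)]] A_inv[OF m(2)]] 
        A_comm[OF A_inv[OF m(1)] A_inv[OF m(2)]] cc
      by (simp only: m_assoc m_closed inv_closed)
    then show ?thesis unfolding l r using cc by (simp only: m_assoc m_closed inv_closed)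
  qed
  also have "\<dots> \<in> B" using comm_with_mem[OF vG t(1)] by (simp add: B_def)
  finally show ?thesis .
next
  assume cen: "B \<subseteq> Z"
  \<comment> \<open>The good elements \<open>v\<close>. Centrality of \<open>B\<close> makes them a
    subgroup; it contains \<open>c\<close>, and by \<open>central_card\<close> the image of
    \<open>C c\<close> has prime order, so the image of \<open>S\<close> is all of it.\<close>
  define S where "S = {v \<in> C c. \<forall>u\<in>A. comm_with v u \<in> B}"
  have bZ: "b \<otimes> g = g \<otimes> b" if "b \<in> B" "g \<in> carrier G" for b g
    using center_commute cen that by blast
  have bc: "b \<in> carrier G" if "b \<in> B" for b using that subgroup.mem_carrier[OF B_subgroup] by blast
  have S: "subgroup S G"
  proof (rule subgroupI)
    show "S \<subseteq> carrier G" using Cc_carrier by (auto simp: S_def)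
    have "c \<in> S" using c by (auto simp: S_def B_def group_centralizer_iff)
    then show "S \<noteq> {}" by blast
    fix x y assume xy: "x \<in> S" "y \<in> S"
    have xyc: "x \<in> carrier G" "y \<in> carrier G" using xy Cc_carrier by (auto simp: S_def)
    have "comm_with (x \<otimes> y) u \<in> B" if u: "u \<in> A" for u
    proof -
      note uc = A_carrier[OF u]
      have b: "comm_with x u \<in> B" "comm_with y u \<in> B" using xy u by (auto simp: S_def)
      have "comm_with x u \<otimes> comm_with y u = comm_with x u \<otimes> (x \<otimes> comm_with y u \<otimes> inv x)"
        using bZ[OF b(2) xyc(1)] bc[OF b(2)] xyc by (simp add: m_assoc flip: bZ[OF b(2)])
      also have "\<dots> = (u \<otimes> x \<otimes> inv u) \<otimes> (inv x \<otimes> x) \<otimes> (u \<otimes> y \<otimes> inv u \<otimes> inv y) \<otimes> inv x"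
        unfolding comm_with_def using uc xyc by (simp only: m_assoc m_closed inv_closed)
      also have "\<dots> = (u \<otimes> x \<otimes> inv u) \<otimes> (u \<otimes> y \<otimes> inv u \<otimes> inv y) \<otimes> inv x"
        using uc xyc by simp
      also have "\<dots> = (u \<otimes> x) \<otimes> (inv u \<otimes> u) \<otimes> (y \<otimes> inv u \<otimes> inv y \<otimes> inv x)"
        using uc xyc by (simp only: m_assoc m_closed inv_closed)
      also have "\<dots> = comm_with (x \<otimes> y) u"
        unfolding comm_with_def using uc xyc by (simp add: inv_mult_group m_assoc)
      finally show ?thesis using b subgroup.m_closed[OF B_subgroup] by metis
    qed
    then show "x \<otimes> y \<in> S" using xy subgroup.m_closed[OF Cc_subgroup] by (auto simp: S_def)
    have "comm_with (inv x) u \<in> B" if u: "u \<in> A" for u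
    proof -
      note uc = A_carrier[OF u]
      have b: "comm_with x u \<in> B" using xy u by (auto simp: S_def)
      have "inv (comm_with x u) = inv x \<otimes> inv (comm_with x u) \<otimes> x"
        using bZ[OF subgroup.m_inv_closed[OF B_subgroup b] xyc(1)] bc[OF b] xyc
        by (simp add: m_assoc flip: m_assoc[of "inv x" x])
      also have "\<dots> = (inv x \<otimes> x) \<otimes> (u \<otimes> inv x \<otimes> inv u) \<otimes> x"
        unfolding comm_with_def using uc xyc by (simp only: inv_mult_group inv_inv m_assoc m_closed inv_closed)
      also have "\<dots> = comm_with (inv x) u"
        unfolding comm_with_def using uc xyc by (simp add: m_assoc)
      finally show ?thesis using subgroup.m_inv_closed[OF B_subgroup b] by metis
    qed
    then show "inv x \<in> S" using xy subgroup.m_inv_closed[OF Cc_subgroup] by (auto simp: S_def)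
  qed
  have cS: "c \<in> S" using c by (auto simp: S_def B_def group_centralizer_iff)
  have sS: "subgroup (\<pi> ` S) (G Mod Z)" by (rule proj.subgroup_img_is_subgroup[OF S])
  have SC: "\<pi> ` S \<subseteq> \<pi> ` C c" by (auto simp: S_def)
  have "card (\<pi> ` S) dvd p"
    using Q.card_subgroup_dvd[OF sS sub[OF E] SC] central_card[OF cen] by simp
  moreover have "card (\<pi> ` S) \<noteq> 1"
  proof
    assume "card (\<pi> ` S) = 1"
    then have "\<pi> c = \<one>\<^bsub>G Mod Z\<^esub>"
      using cS subgroup.one_closed[OF sS] by (metis card_1_singletonE imageI singletonD)
    then show False using \<pi>_one_iff c by auto
  qed
  ultimately have "card (\<pi> ` S) = p" using pr prime_nat_iff by blast
  then have "\<pi> ` S = \<pi> ` C c"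
    using SC finite_member[OF E] central_card[OF cen] by (intro card_subset_eq) auto
  then obtain s where s: "s \<in> S" "\<pi> s = \<pi> v" using v by (metis imageE imageI)
  have sc: "s \<in> carrier G" "v \<in> carrier G" using s v Cc_carrier by (auto simp: S_def)
  then obtain z where z: "z \<in> Z" "v = z \<otimes> s" using \<pi>_eq_iff s(2) by blast
  have uZ: "\<one> \<otimes> u = u" "\<one> \<in> Z" using A_carrier[OF u] subgroup.one_closed[OF subgroup_center] by auto
  have "comm_with v u = group_commutator G (\<one> \<otimes> u) (z \<otimes> s)" using z uZ by (simp add: comm_with_def group_commutator_def)
  also have "\<dots> = comm_with s u"
    using group_commutator_center_mult[OF uZ(2) z(1) A_carrier[OF u] sc(1)] by (simp add: comm_with_def group_commutator_def)
  finally show ?thesis using s(1) u by (auto simp: S_def)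
qed

text \<open>Write \<open>g = u v\<close> and \<open>h = s t\<close> with factors in \<open>A\<close>
  and \<open>C c\<close>. Both subgroups are abelian and \<open>A\<close> is normal, so [g,h]
  collapses to [u,t] times the inverse of [s,v], and both factors are known to lie in
  \<open>B\<close>.\<close>

lemma derived_eq_B: "derived G (carrier G) = B"
proof
  have "derived_set G (carrier G) \<subseteq> B"
  proof
    fix w assume "w \<in> derived_set G (carrier G)"
    then obtain g h where gh: "g \<in> carrier G" "h \<in> carrier G" "w = g \<otimes> h \<otimes> inv g \<otimes> inv h" by auto
    obtain u v where uv: "u \<in> A" "v \<in> C c" "g = u \<otimes> v" using factorization[OF gh(1)] .
    obtain s t where st: "s \<in> A" "t \<in> C c" "h = s \<otimes> t" using factorization[OF gh(2)] .
    note cc = A_carrier[OF uv(1)] Cc_carrier[OF uv(2)] A_carrier[OF st(1)] Cc_carrier[OF st(2)]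
    let ?s = "v \<otimes> s \<otimes> inv v" and ?u = "t \<otimes> u \<otimes> inv t"
    have m: "?s \<in> A" "?u \<in> A" using A_conj cc uv st by auto
    note mc = A_carrier[OF m(1)] A_carrier[OF m(2)]
    have "w = u \<otimes> ?s \<otimes> (v \<otimes> t \<otimes> inv v) \<otimes> inv u \<otimes> inv t \<otimes> inv s"
    proof -
      have "u \<otimes> ?s \<otimes> (v \<otimes> t \<otimes> inv v) \<otimes> inv u \<otimes> inv t \<otimes> inv s
        = u \<otimes> v \<otimes> s \<otimes> (inv v \<otimes> v) \<otimes> t \<otimes> inv v \<otimes> inv u \<otimes> inv t \<otimes> inv s"
        using cc by (simp only: m_assoc m_closed inv_closed)
      also have "\<dots> = w" unfolding gh(3) uv(3) st(3) using cc by (simp add: inv_mult_group m_assoc)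
      finally show ?thesis by simp
    qed
    also have "v \<otimes> t \<otimes> inv v = t" using Cc_comm[OF uv(2) st(2)] cc by (simp add: m_assoc)
    also have "u \<otimes> ?s \<otimes> t \<otimes> inv u \<otimes> inv t \<otimes> inv s = u \<otimes> ?s \<otimes> inv ?u \<otimes> inv s"
      using cc by (simp add: inv_mult_group m_assoc)
    also have "\<dots> = u \<otimes> (inv ?u \<otimes> ?s) \<otimes> inv s"
      using A_comm[OF m(1) A_inv[OF m(2)]] cc(1,3) mc by (simp only: m_assoc m_closed inv_closed)
    also have "\<dots> = (u \<otimes> inv ?u) \<otimes> inv (s \<otimes> inv ?s)"
      using cc(1,3) mc by (simp only: m_assoc m_closed inv_closed inv_mult_group inv_inv)
    also have "\<dots> = comm_with t u \<otimes> inv (comm_with v s)"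
      using comm_with_alt cc uv st by simp
    also have "\<dots> \<in> B"
      using comm_with_mem_B uv st subgroup.m_closed[OF B_subgroup] subgroup.m_inv_closed[OF B_subgroup] by blast
    finally show "w \<in> B" .
  qed
  then show "derived G (carrier G) \<subseteq> B"
    unfolding derived_def by (rule generate_subgroup_incl[OF _ B_subgroup])
  show "B \<subseteq> derived G (carrier G)"
  proof
    fix b assume "b \<in> B"
    then obtain u where u: "u \<in> A" "b = comm_with c u" by (auto simp: B_def)
    then have "b \<in> derived_set G (carrier G)" using A_carrier[OF u(1)] c unfolding comm_with_def by blast
    then show "b \<in> derived G (carrier G)" unfolding derived_def by (rule generate.incl)
  qed
qed

end

text \<open>The auxiliary \<open>c\<close> may be chosen in any other member, which yields the third
  claim for each \<open>E\<close>. That claim serves to find a member of prime order met by the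
  subgroup when the commutator subgroup is central.\<close>

lemma derived_prime_order:
  assumes D: "D \<in> centralizer_images" "card D = card centralizer_images - 1" "Factorial_Ring.prime (card D)"
  shows "card (derived G (carrier G)) = card D" and "\<pi> ` derived G (carrier G) \<subseteq> D"
    and "\<lbrakk>derived G (carrier G) \<subseteq> Z; E \<in> centralizer_images\<rbrakk> \<Longrightarrow> card E = card D"
proof -
  obtain a where a: "a \<in> carrier G - Z" "D = \<pi> ` C a" using D(1) unfolding centralizer_images_iff ..
  have "card centralizer_images \<noteq> 1" using D(2,3) by auto
  then have "\<not> centralizer_images \<subseteq> {D}" using D(1) by (metis card_1_singleton_iff One_nat_def subset_singletonD empty_iff)
  then obtain F where F: "F \<in> centralizer_images" "F \<noteq> D" by blast
  have *: "derived G (carrier G) = B a c" "card (B a c) = card D" "B a c \<subseteq> C a" "B a c \<subseteq> Z \<Longrightarrow> card E = card D"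
    if c: "c \<in> carrier G - Z" "E = \<pi> ` C c" "E \<noteq> D" for c E
    using derived_eq_B[of a c] card_B[of a c] B_subset[of a c] central_card[of a c] a c D by auto
  obtain c where "c \<in> carrier G - Z" "F = \<pi> ` C c" using F(1) unfolding centralizer_images_iff ..
  note ** = *[OF this F(2)]
  show "card (derived G (carrier G)) = card D" "\<pi> ` derived G (carrier G) \<subseteq> D" using ** a(2) by auto
  show "card E = card D" if E: "derived G (carrier G) \<subseteq> Z" "E \<in> centralizer_images"
  proof (cases "E = D")
    case False
    obtain c where "c \<in> carrier G - Z" "E = \<pi> ` C c" using E(2) unfolding centralizer_images_iff ..
    from *[OF this False] E(1) show ?thesis by simp
  qed simp
qed

end

section \<open>Subgroups\<close>

text \<open>Bilinearity in disguise: interchanging the two inner factors of either product costs a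
  central commutator, after which both products agree.\<close>

lemma (in group) commute_products_iff:
  assumes c: "x \<in> carrier G" "x' \<in> carrier G" "y \<in> carrier G" "y' \<in> carrier G"
    and x: "x \<otimes> x' = x' \<otimes> x" and y: "y \<otimes> y' = y' \<otimes> y"
    and k: "group_commutator G x' y \<in> group_center G" "group_commutator G x y' \<in> group_center G"
  shows "(x \<otimes> y) \<otimes> (x' \<otimes> y') = (x' \<otimes> y') \<otimes> (x \<otimes> y) \<longleftrightarrow>
    group_commutator G x' y = group_commutator G x y'"
proof -
  have *: "(a \<otimes> d) \<otimes> (b \<otimes> d') = inv (group_commutator G b d) \<otimes> ((a \<otimes> b) \<otimes> (d \<otimes> d'))"
    if h: "a \<in> carrier G" "b \<in> carrier G" "d \<in> carrier G" "d' \<in> carrier G" "group_commutator G b d \<in> group_center G"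
    for a b d d'
  proof -
    let ?k = "group_commutator G b d"
    have kc: "?k \<in> carrier G" "inv ?k \<in> group_center G"
      using h(5) subgroup.m_inv_closed[OF subgroup_center] by (auto simp: group_center_def)
    have "?k \<otimes> (d \<otimes> b) = b \<otimes> d \<otimes> inv b \<otimes> (inv d \<otimes> d) \<otimes> b"
      using h(1-4) unfolding group_commutator_def by (simp only: m_assoc m_closed inv_closed)
    then have "?k \<otimes> (d \<otimes> b) = b \<otimes> d" using h(1-4) by (simp add: m_assoc)
    then have "d \<otimes> b = inv ?k \<otimes> (b \<otimes> d)" using h(1-4) kc(1) by (simp add: inv_solve_left)
    then have "(a \<otimes> d) \<otimes> (b \<otimes> d') = a \<otimes> (inv ?k \<otimes> (b \<otimes> d)) \<otimes> d'"
      using h by (metis m_assoc m_closed)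
    also have "\<dots> = (a \<otimes> inv ?k) \<otimes> (b \<otimes> d \<otimes> d')" using h kc by (simp add: m_assoc)
    also have "\<dots> = (inv ?k \<otimes> a) \<otimes> (b \<otimes> d \<otimes> d')" using center_commute[OF kc(2) h(1)] by simp
    finally show ?thesis using h kc by (simp add: m_assoc)
  qed
  have kc: "group_commutator G x' y \<in> carrier G" "group_commutator G x y' \<in> carrier G"
    using k by (auto simp: group_center_def)
  have "(x \<otimes> y) \<otimes> (x' \<otimes> y') = (x' \<otimes> y') \<otimes> (x \<otimes> y) \<longleftrightarrow>
      inv (group_commutator G x' y) = inv (group_commutator G x y')"
    unfolding *[OF c(1,2,3,4) k(1)] *[OF c(2,1,4,3) k(2)] x[symmetric] y[symmetric]
    using c kc by (intro right_cancel) auto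
  then show ?thesis using kc by (metis inv_inv)
qed

context ca_group begin

lemma class_commute:
  assumes "D \<in> centralizer_images" "g \<in> carrier G" "h \<in> carrier G" "\<pi> g \<in> D" "\<pi> h \<in> D"
  shows "g \<otimes> h = h \<otimes> g"
proof -
  obtain x where x: "x \<in> carrier G - Z" "D = \<pi> ` C x" using assms(1) unfolding centralizer_images_iff ..
  then have "g \<in> C x" "h \<in> C x" using assms \<pi>_mem_centralizer by auto
  then show ?thesis using abelian_centralizer[OF x(1)] by blast
qed

text \<open>Lift the partial spread to G. The member \<open>D3\<close> gives [x3,y2] = [x2,y3] and
  \<open>D4\<close> gives [x3,y2] = [x1,y1]. Together they say that \<open>x1 \<otimes> y3\<close>
  and \<open>x2 \<otimes> y1\<close> commute, although no member contains both images.\<close>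

lemma no_sixteen:
  assumes "card (carrier (G Mod Z)) = 16" "num 4 = 4"
    and "\<And>D. D \<in> centralizer_images \<Longrightarrow> card D = 2 \<or> card D = 4"
  shows False
proof (rule partial_spread[OF assms])
  fix D1 D2 D3 D4 e1 e2 e3 f1 f2 f3
  assume D: "D1 \<in> centralizer_images" "D2 \<in> centralizer_images" "D3 \<in> centralizer_images" "D4 \<in> centralizer_images"
    and e: "e1 \<in> D1" "e2 \<in> D1" "e3 \<in> D1" and f: "f1 \<in> D2" "f2 \<in> D2" "f3 \<in> D2"
    and D3: "e1 \<otimes>\<^bsub>G Mod Z\<^esub> f1 \<in> D3" "e2 \<otimes>\<^bsub>G Mod Z\<^esub> f2 \<in> D3" "e3 \<otimes>\<^bsub>G Mod Z\<^esub> f3 \<in> D3"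
    and D4: "e1 \<otimes>\<^bsub>G Mod Z\<^esub> f2 \<in> D4" "e2 \<otimes>\<^bsub>G Mod Z\<^esub> f3 \<in> D4" "e3 \<otimes>\<^bsub>G Mod Z\<^esub> f1 \<in> D4"
    and ne: "e1 \<otimes>\<^bsub>G Mod Z\<^esub> f3 \<noteq> \<one>\<^bsub>G Mod Z\<^esub>" "e2 \<otimes>\<^bsub>G Mod Z\<^esub> f1 \<noteq> \<one>\<^bsub>G Mod Z\<^esub>"
    and no: "\<And>F. F \<in> centralizer_images \<Longrightarrow> e1 \<otimes>\<^bsub>G Mod Z\<^esub> f3 \<in> F \<Longrightarrow> e2 \<otimes>\<^bsub>G Mod Z\<^esub> f1 \<in> F \<Longrightarrow> False"
    and ab: "\<And>x y. x \<in> carrier (G Mod Z) \<Longrightarrow> y \<in> carrier (G Mod Z) \<Longrightarrow> x \<otimes>\<^bsub>G Mod Z\<^esub> y = y \<otimes>\<^bsub>G Mod Z\<^esub> x"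
  have lift: "\<exists>g\<in>carrier G. u = \<pi> g" if "D \<in> centralizer_images" "u \<in> D" for D u
    using mem_carrier[OF that] unfolding carrier_quotient by blast
  obtain x1 x2 x3 y1 y2 y3 where x: "x1 \<in> carrier G" "x2 \<in> carrier G" "x3 \<in> carrier G"
    "e1 = \<pi> x1" "e2 = \<pi> x2" "e3 = \<pi> x3" and y: "y1 \<in> carrier G" "y2 \<in> carrier G" "y3 \<in> carrier G"
    "f1 = \<pi> y1" "f2 = \<pi> y2" "f3 = \<pi> y3"
    using lift[OF D(1) e(1)] lift[OF D(1) e(2)] lift[OF D(1) e(3)]
      lift[OF D(2) f(1)] lift[OF D(2) f(2)] lift[OF D(2) f(3)] by blast
  \<comment> \<open>The quotient by the centre is abelian here, so all commutators are
    central.\<close>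
  have kz: "group_commutator G g h \<in> Z" if gh: "g \<in> carrier G" "h \<in> carrier G" for g h
  proof -
    have "\<pi> (h \<otimes> g) = \<pi> (g \<otimes> h)"
      using ab[of "\<pi> h" "\<pi> g"] gh proj.hom_mult carrier_quotient by (metis imageI)
    then obtain z where z: "z \<in> Z" "g \<otimes> h = z \<otimes> (h \<otimes> g)" using \<pi>_eq_iff[of "h \<otimes> g" "g \<otimes> h"] gh by auto
    then have "z \<in> carrier G" by (simp add: group_center_def)
    then have "(g \<otimes> h) \<otimes> inv (h \<otimes> g) = z" unfolding z(2) using gh by (simp add: m_assoc del: inv_mult_group)
    then show ?thesis using z(1) gh by (simp add: group_commutator_def inv_mult_group m_assoc)
  qed
  note h = x(1-3) y(1-3)
  have xx: "x2 \<otimes> x3 = x3 \<otimes> x2" "x1 \<otimes> x3 = x3 \<otimes> x1" "x1 \<otimes> x2 = x2 \<otimes> x1"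
    using class_commute[OF D(1)] e x by auto
  have yy: "y2 \<otimes> y3 = y3 \<otimes> y2" "y2 \<otimes> y1 = y1 \<otimes> y2" "y3 \<otimes> y1 = y1 \<otimes> y3"
    using class_commute[OF D(2)] f y by auto
  have "(x2 \<otimes> y2) \<otimes> (x3 \<otimes> y3) = (x3 \<otimes> y3) \<otimes> (x2 \<otimes> y2)"
    using class_commute[OF D(3), of "x2 \<otimes> y2" "x3 \<otimes> y3"] D3 x y h proj.hom_mult by auto
  then have "group_commutator G x3 y2 = group_commutator G x2 y3"
    using commute_products_iff[of x2 x3 y2 y3] h xx yy kz by blast
  moreover have "(x1 \<otimes> y2) \<otimes> (x3 \<otimes> y1) = (x3 \<otimes> y1) \<otimes> (x1 \<otimes> y2)"
    using class_commute[OF D(4), of "x1 \<otimes> y2" "x3 \<otimes> y1"] D4 x y h proj.hom_mult by auto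
  then have "group_commutator G x3 y2 = group_commutator G x1 y1"
    using commute_products_iff[of x1 x3 y2 y1] h xx yy kz by blast
  ultimately have "group_commutator G x2 y3 = group_commutator G x1 y1" by simp
  then have com: "(x1 \<otimes> y3) \<otimes> (x2 \<otimes> y1) = (x2 \<otimes> y1) \<otimes> (x1 \<otimes> y3)"
    using commute_products_iff[of x1 x2 y3 y1] h xx yy kz by blast
  have p: "\<pi> (x1 \<otimes> y3) = e1 \<otimes>\<^bsub>G Mod Z\<^esub> f3" "\<pi> (x2 \<otimes> y1) = e2 \<otimes>\<^bsub>G Mod Z\<^esub> f1"
    using x y h proj.hom_mult by auto
  have nz: "x1 \<otimes> y3 \<in> carrier G - Z" "x2 \<otimes> y1 \<in> carrier G - Z"
  proof -
    have "\<pi> (x1 \<otimes> y3) \<noteq> Z" "\<pi> (x2 \<otimes> y1) \<noteq> Z"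
      using ne unfolding p one_FactGroup .
    then show "x1 \<otimes> y3 \<in> carrier G - Z" "x2 \<otimes> y1 \<in> carrier G - Z"
      using h \<pi>_one_iff by blast+
  qed
  then obtain F where "F \<in> centralizer_images" "\<pi> (x1 \<otimes> y3) \<in> F" "\<pi> (x2 \<otimes> y1) \<in> F"
    using commute_iff_class[OF nz] com by blast
  then show False using no p by simp
qed

section \<open>Comparing a non-abelian subgroup with the whole group\<close>

context
  fixes H
  assumes H: "subgroup H G" and nonab: "\<not> comm_group (G\<lparr>carrier := H\<rparr>)"
begin

lemma isoclinic_full:
  assumes "\<pi> ` H = carrier (G Mod Z)"
  shows "isoclinic G (G\<lparr>carrier := H\<rparr>)"
proof (rule isoclinic_subgroup[OF H])
  fix g assume g: "g \<in> carrier G"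
  then have "\<pi> g \<in> \<pi> ` H" using assms by (simp add: carrier_quotient)
  then obtain h where "h \<in> H" "\<pi> h = \<pi> g" by auto
  then show "\<exists>z\<in>Z. \<exists>h\<in>H. g = z \<otimes> h"
    using \<pi>_eq_iff[OF subgroup.mem_carrier[OF H] g] by blast
qed

lemma meeting_full_iff:
  "meeting (\<pi> ` H) = centralizer_images \<longleftrightarrow> card (Cent (G\<lparr>carrier := H\<rparr>)) = card (Cent G)"
proof -
  have sub: "meeting (\<pi> ` H) \<subseteq> centralizer_images" by (auto simp: meeting_def)
  have "card (Cent G) > 0"
    using finite_Cent one_closed by (auto simp: Cent_def card_gt_0_iff)
  then have "card (Cent (G\<lparr>carrier := H\<rparr>)) = card (Cent G) \<longleftrightarrow> card (meeting (\<pi> ` H)) = card centralizer_images"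
    using card_Cent_subgroup[OF H nonab] card_centralizer_images by auto
  then show ?thesis using card_subset_eq[OF fin sub] by auto
qed

lemma isoclinic_prime:
  assumes "meeting (\<pi> ` H) = centralizer_images" and "\<And>D. D \<in> centralizer_images \<Longrightarrow> Factorial_Ring.prime (card D)"
  shows "isoclinic G (G\<lparr>carrier := H\<rparr>)"
proof (rule isoclinic_full)
  have meet: "\<exists>x\<in>D \<inter> \<pi> ` H. x \<noteq> \<one>\<^bsub>G Mod Z\<^esub>" if "D \<in> centralizer_images" for D
    using assms(1) that unfolding meeting_def by blast
  have "D \<subseteq> \<pi> ` H" if "D \<in> centralizer_images" for D
    using trace_card_prime[OF subgroup_image[OF H nonab] meet that assms(2)[OF that]] by blast
  then have "carrier (G Mod Z) \<subseteq> \<pi> ` H" using cover by blast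
  then show "\<pi> ` H = carrier (G Mod Z)"
    using subgroup.subset[OF subgroup_image[OF H nonab]] by blast
qed

lemma isoclinic_8:
  assumes "card centralizer_images = 7" "meeting (\<pi> ` H) = centralizer_images"
  shows "isoclinic G (G\<lparr>carrier := H\<rparr>)"
proof (rule isoclinic_full, rule ccontr)
  assume ne: "\<pi> ` H \<noteq> carrier (G Mod Z)"
  have meet: "\<exists>x\<in>D \<inter> \<pi> ` H. x \<noteq> \<one>\<^bsub>G Mod Z\<^esub>" if "D \<in> centralizer_images" for D
    using assms(2) that unfolding meeting_def by blast
  note * = seven_counts[OF subgroup_image[OF H nonab] meet assms(1) ne]
  show False using no_sixteen[OF *(3,2,4)] .
qed

text \<open>For the third claim a member \<open>E\<close> of order \<open>card D\<close> is needed
  that the image of \<open>H\<close> meets non-trivially. If the commutator subgroup is central, all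
  members have this order; otherwise it lies in \<open>H\<close> and has a non-central element over
  \<open>D\<close>. As the order is prime, \<open>E\<close> lies in the image of \<open>H\<close>,
  and the coset argument there produces \<open>card D\<close> further members.\<close>

lemma prime_case:
  assumes D: "D \<in> centralizer_images" "card D = card centralizer_images - 1" "Factorial_Ring.prime (card D)"
  shows "derived G H = derived G (carrier G)" and "card (derived G (carrier G)) = card D"
    and "meeting (\<pi> ` H) = centralizer_images"
proof -
  note der = derived_prime_order[OF D]
  show card: "card (derived G (carrier G)) = card D" by (rule der(1))
  have H_sub: "H \<subseteq> carrier G" by (rule subgroup.subset[OF H])
  have fin_der: "finite (derived G (carrier G))"
    using card D(3) prime_gt_0_nat card_ge_0_finite by metis
  have dsub: "derived G H \<subseteq> derived G (carrier G)" by (rule mono_derived[OF H_sub])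
  have s1: "subgroup (derived G H) G" "subgroup (derived G (carrier G)) G"
    using derived_is_subgroup H_sub by auto
  obtain a b where ab: "a \<in> H" "b \<in> H" "a \<otimes> b \<noteq> b \<otimes> a" using nonabelian_subgroup[OF H nonab] .
  have abc: "a \<in> carrier G" "b \<in> carrier G" using ab H_sub by auto
  have "a \<otimes> b \<otimes> inv a \<otimes> inv b \<in> derived G H"
    unfolding derived_def by (rule generate.incl) (use ab in auto)
  moreover have "a \<otimes> b \<otimes> inv a \<otimes> inv b \<noteq> \<one>"
  proof
    assume "a \<otimes> b \<otimes> inv a \<otimes> inv b = \<one>"
    then have "(a \<otimes> b) \<otimes> inv (b \<otimes> a) = \<one>" using abc by (simp add: inv_mult_group m_assoc)
    then show False using abc ab(3) by (metis inv_closed inv_equality inv_inv m_closed)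
  qed
  ultimately have "card (derived G H) \<noteq> 1"
    using subgroup.one_closed[OF s1(1)] by (metis card_1_singletonE singletonD)
  moreover have "card (derived G H) dvd card D"
    using card_subgroup_dvd[OF s1 dsub] card by simp
  ultimately have "card (derived G H) = card D" using D(3) prime_nat_iff by blast
  then show eq: "derived G H = derived G (carrier G)"
    using card dsub fin_der by (intro card_subset_eq) auto
  have derH: "derived G H \<subseteq> H" using derived_incl[OF subset_refl H] .
  have "\<exists>E\<in>centralizer_images. card E = card D \<and> (\<exists>h\<in>H - Z. \<pi> h \<in> E)"
  proof (cases "derived G (carrier G) \<subseteq> Z")
    case True
    have "a \<notin> Z" using ab abc center_commute by blast
    then have "\<pi> ` C a \<in> centralizer_images" "\<pi> a \<in> \<pi> ` C a"
      using abc centralizer_images_iff by (blast, auto simp: group_centralizer_iff)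
    then show ?thesis using der(3)[OF True] ab \<open>a \<notin> Z\<close> by blast
  next
    case False
    then obtain h where "h \<in> derived G H" "h \<notin> Z" using eq by blast
    then show ?thesis using der(2) eq derH D(1) by blast
  qed
  then obtain E h where E: "E \<in> centralizer_images" "card E = card D" and h: "h \<in> H - Z" "\<pi> h \<in> E" by blast
  have hc: "\<pi> h \<in> E \<inter> \<pi> ` H" "\<pi> h \<noteq> Z" using h H_sub \<pi>_one_iff by auto
  have EL: "subgroup (E \<inter> \<pi> ` H) (G Mod Z)"
    by (rule Q.subgroups_Inter_pair[OF sub[OF E(1)] subgroup_image[OF H nonab]])
  have "card (E \<inter> \<pi> ` H) dvd card D"
    using Q.card_subgroup_dvd[OF EL sub[OF E(1)]] E(2) by auto
  moreover have "card (E \<inter> \<pi> ` H) \<noteq> 1"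
    using subgroup.one_closed[OF EL] hc by (metis card_1_singletonE one_FactGroup singletonD)
  ultimately have cE: "card (E \<inter> \<pi> ` H) = card D" using D(3) prime_nat_iff by blast
  have "card D \<le> card (meeting (\<pi> ` H) - {E})"
    using card_Int_le[OF subgroup_image[OF H nonab] E(1) subgroup_not_in_class[OF H nonab E(1)]] cE by simp
  moreover have Em: "E \<in> meeting (\<pi> ` H)" using E hc unfolding meeting_def by auto
  moreover have msub: "meeting (\<pi> ` H) \<subseteq> centralizer_images" by (auto simp: meeting_def)
  moreover have "card (meeting (\<pi> ` H)) > 0"
    using Em finite_subset[OF msub fin] by (auto simp: card_gt_0_iff)
  ultimately have "card centralizer_images \<le> card (meeting (\<pi> ` H))"
    using D(2) finite_subset[OF msub fin] by (simp add: card_Diff_singleton)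
  then show "meeting (\<pi> ` H) = centralizer_images" using card_seteq[OF fin msub] by blast
qed

text \<open>With three or four members every order is 2 or 3, so all members have prime
  order.\<close>

lemma isoclinic_4_5:
  assumes D: "D \<in> centralizer_images" "card D = card centralizer_images - 1" "Factorial_Ring.prime (card D)"
    and c: "card centralizer_images \<in> {3, 4}"
  shows "isoclinic G (G\<lparr>carrier := H\<rparr>)"
proof -
  have "Factorial_Ring.prime (card E)" if "E \<in> centralizer_images" for E
  proof -
    have "card E = 2 \<or> card E = 3" using card_member_le[OF that] card_member_ge[OF that] c by auto
    then show ?thesis by auto
  qed
  then show ?thesis using prime_case(3)[OF D] D(1) isoclinic_prime by blast
qed

end

end

lemma (in group) ca_groupI:
  assumes "0 < card (Cent G)" "card (Cent G) < 10" "a \<in> carrier G" "b \<in> carrier G" "a \<otimes> b \<noteq> b \<otimes> a"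
  shows "ca_group G"
proof
  show fin: "finite (Cent G)" using assms(1) by (rule card_ge_0_finite)
  show "u \<otimes> v = v \<otimes> u"
    if x: "x \<in> carrier G - group_center G" and "u \<in> group_centralizer G x" "v \<in> group_centralizer G x" for x u v
  proof (rule ccontr)
    assume "u \<otimes> v \<noteq> v \<otimes> u"
    then have "10 \<le> card (Cent G)" using ten_le_card_Cent[OF fin _ _ that(2,3)] x by simp
    then show False using assms(2) by simp
  qed
  show "group_center G \<noteq> carrier G" using assms(3-5) center_commute by blast
qed

theorem theorem3p9:
  fixes n :: nat and G :: "('a, 'b) monoid_scheme" and H :: "'a set"
  assumes "n > 0"
    and "group G"
    and "n_centralizer n G"
    and "subgroup H G"
    and "\<not> comm_group (G\<lparr>carrier := H\<rparr>)"
  shows "(n = 4 \<or> n = 5 \<longrightarrow> isoclinic G (G\<lparr>carrier := H\<rparr>)) \<and>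
    (n = 4 \<or> n = 5 \<or> n = 7 \<or> n = 9 \<longrightarrow>
       card (Cent G) = card (Cent (G\<lparr>carrier := H\<rparr>)) \<and>
       commutator_subgroup G \<cong> commutator_subgroup (G\<lparr>carrier := H\<rparr>) \<and>
       commutator_subgroup (G\<lparr>carrier := H\<rparr>) \<cong> integer_mod_group (n - 2)) \<and>
    (n = 8 \<and> card (Cent G) = card (Cent (G\<lparr>carrier := H\<rparr>)) \<longrightarrow>
       isoclinic G (G\<lparr>carrier := H\<rparr>))"
proof -
  interpret group G by fact
  interpret GH: group "G\<lparr>carrier := H\<rparr>" using assms(4) by (rule subgroup_imp_group)
  note H = assms(4) and nonab = assms(5)
  have n: "card (Cent G) = n" using assms(3) by (simp add: n_centralizer_def)
  obtain a b where ab: "a \<in> H" "b \<in> H" "a \<otimes>\<^bsub>G\<^esub> b \<noteq> b \<otimes>\<^bsub>G\<^esub> a"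
    using GH.group_comm_groupI nonab by auto
  \<comment> \<open>Positivity of \<open>n\<close> makes \<open>Cent G\<close> finite, since an
    infinite set has \<open>card\<close> 0.\<close>
  have ca: "ca_group G" if "n < 10"
    using ca_groupI[of a b] ab subgroup.mem_carrier[OF H] n assms(1) that by auto
  have prime: "(n = 4 \<or> n = 5 \<longrightarrow> isoclinic G (G\<lparr>carrier := H\<rparr>)) \<and>
       card (Cent G) = card (Cent (G\<lparr>carrier := H\<rparr>)) \<and>
       commutator_subgroup G \<cong> commutator_subgroup (G\<lparr>carrier := H\<rparr>) \<and>
       commutator_subgroup (G\<lparr>carrier := H\<rparr>) \<cong> integer_mod_group (n - 2)"
    if n4: "n = 4 \<or> n = 5 \<or> n = 7 \<or> n = 9"
  proof -
    interpret ca_group G using ca n4 by auto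
    have c: "card centralizer_images = n - 1" using card_centralizer_images n by simp
    have "n - 1 \<in> {3, 4, 6, 8}" using n4 by auto
    then have "card centralizer_images \<in> {3, 4, 6, 8}" unfolding c .
    then obtain D where D: "D \<in> centralizer_images" "card D = card centralizer_images - 1" using exists_maximal_member by blast
    have cD: "card D = n - 2" using D(2) c by simp
    then have "Factorial_Ring.prime (card D)" using n4 by auto
    note pc = prime_case[OF H nonab D this]
    have "commutator_subgroup (G\<lparr>carrier := H\<rparr>) = commutator_subgroup G"
      using pc(1) derived_consistent[OF subset_refl H] by (simp add: commutator_subgroup_def)
    moreover have "group (commutator_subgroup G)"
      unfolding commutator_subgroup_def
      by (rule subgroup_imp_group) (simp add: derived_is_subgroup)
    then have "commutator_subgroup G \<cong> integer_mod_group (n - 2)"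
      using group.prime_order_iso_integer_mod_group[of "commutator_subgroup G" "n - 2"]
        pc(2) cD \<open>Factorial_Ring.prime (card D)\<close> by (simp add: commutator_subgroup_def)
    moreover have "isoclinic G (G\<lparr>carrier := H\<rparr>)" if "n = 4 \<or> n = 5"
    proof (rule isoclinic_4_5[OF H nonab D \<open>Factorial_Ring.prime (card D)\<close>])
      show "card centralizer_images \<in> {3, 4}" unfolding c using that by auto
    qed
    ultimately show ?thesis
      using meeting_full_iff[OF H nonab] pc(3) by (simp add: iso_refl)
  qed
  have "isoclinic G (G\<lparr>carrier := H\<rparr>)" if n8: "n = 8" "card (Cent G) = card (Cent (G\<lparr>carrier := H\<rparr>))"
  proof -
    interpret ca_group G using ca n8 by auto
    show ?thesis
      using isoclinic_8[OF H nonab] card_centralizer_images n n8 meeting_full_iff[OF H nonab] by simp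
  qed
  then show ?thesis using prime by blast
qed

end
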